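(* There is an irreducible Hermitian Yang Mills connection on $P_1\rightarrow T^*\mathbb{S}^3$ for Stenzel's Calabi-Yau structure. On the complement of the zero section it is given by $$A=A_c^1+\frac{\epsilon}{2R_+}\left(\theta^4\otimes T_2+\theta^5\otimes T_3\right),$$ and its curvature by $$F_A=-\frac12\left(\theta^{23}+\frac{R_-^2}{R_+^2}\theta^{45}\right)\otimes T_1+\frac{\epsilon}{2R_+}\left(T_2\otimes\theta^{12}+T_3\otimes\theta^{13}\right)-\frac{\epsilon}{4}\frac{r}{R_+^3}\left(T_2\otimes dr\wedge\theta^4+T_3\otimes dr\wedge\theta^5\right).$$
   Context: Fix $\epsilon>0$. Let $C_{ij}\in\mathfrak{so}(4)$ be the skew matrix with $(i,j)$ entry $1$, $(j,i)$ entry $-1$ and all others zero, and $X_1=C_{12},X_2=C_{13},X_3=C_{14},X_4=C_{23},X_5=C_{24},X_6=C_{34}$, a basis of $\mathfrak{spin}(4)=\mathfrak{so}(4)$. Let $\theta^1,\dots,\theta^6$ be the dual left-invariant 1-forms on $Spin(4)=SU(2)\times SU(2)$ and $\theta^{ij}=\theta^i\wedge\theta^j$, etc. They satisfy $d\theta^1=\theta^{24}+\theta^{35}$, $d\theta^2=-\theta^{14}+\theta^{36}$, $d\theta^3=-\theta^{15}-\theta^{26}$, $d\theta^4=\theta^{12}+\theta^{56}$, $d\theta^5=\theta^{13}-\theta^{46}$, $d\theta^6=\theta^{23}+\theta^{45}$. Let $H\cong U(1)$ be the subgroup $\gamma(t)=(\mathrm{diag}(e^{it},e^{-it}),\mathrm{diag}(e^{it},e^{-it}))$,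 with $\gamma'(0)=-2X_6$. $T^*\mathbb{S}^3$ is identified with $X_\epsilon=\{z\in\mathbb{C}^4:\sum z_i^2=\epsilon^2\}$, $r^2=\sum|z_i|^2$, zero section $\{r=\epsilon\}$, with $Spin(4)$ acting through $SO(4)$ on $z$. Put $R_\pm=\sqrt{(r^2\pm\epsilon^2)/2}$. The complement of the zero section is identified with $(\epsilon,\infty)\times Spin(4)/H$ via $(r,kH)\mapsto k\cdot(R_+,iR_-,0,0)$, and forms on it are written as forms on $(\epsilon,\infty)\times Spin(4)$. Stenzel's Calabi-Yau structure is $$\omega=\dot{\mathcal{G}}\,dr\wedge\theta^1+\mathcal{G}(\theta^{24}+\theta^{35}),$$ $$\Omega_1=-(R_+^2\theta^{123}-R_-^2\theta^{145})-\tfrac r2dr\wedge(\theta^{25}-\theta^{34}),$$ $$\Omega_2=\tfrac r2\left(\tfrac{R_+}{R_-}dr\wedge\theta^{23}-\tfrac{R_-}{R_+}dr\wedge\theta^{45}\right)+R_+R_-(\theta^{134}-\theta^{125}),$$ with $\Omega=\Omega_1+i\Omega_2$, where $\mathcal{G}=R_+R_-\mathcal{F}'(r^2)$, $\dot{\mathcal{G}}=d\mathcal{G}/dr$, and for $r^2=\epsilon^2\cosh t$, $\mathcal{F}'(r^2)=\frac1{\sinh t}\left(\frac3{4\epsilon^2}\right)^{1/3}(\sinh2t-2t)^{1/3}$. It extends smoothly over the zero section. Let $T_1,T_2,T_3$ be a basis of $\mathfrak{su}(2)$ with $[T_i,T_j]=2\epsilon_{ijk}T_k$ and $T_1=\mathrm{diag}(i,-i)$.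 $P_1=Spin(4)\times_{(U(1),\lambda_1)}SU(2)$ with $\lambda_1(\theta)=\mathrm{diag}(e^{i\theta},e^{-i\theta})$ is an $SU(2)$-bundle over $Spin(4)/H$; its pull back to the complement of the zero section extends to an $SU(2)$-bundle over $T^*\mathbb{S}^3$, also denoted $P_1$. Connections on $P_1$ over the complement of the zero section are written as $\mathfrak{su}(2)$-valued 1-forms on $(\epsilon,\infty)\times Spin(4)$ (pull back along the canonical map $Spin(4)\to P_1$). The canonical invariant connection is $A_c^1=-\frac{\theta^6}{2}\otimes T_1$. A connection $A$ is Hermitian Yang Mills if $F_A\wedge\Omega_1=0$ and $\Lambda F_A=0$, where $\Lambda F_A=\ast(F_A\wedge\frac{\omega^2}{2})$. *)

theory Defs
  imports "HOL-Analysis.Analysis"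
begin

section \<open>Differential forms\<close>

text \<open>
  A form of degree \<open>k\<close> on (a submanifold of) the Euclidean space \<open>'p\<close> takes a point and a list
  of \<open>k\<close> tangent vectors.  A form on a submanifold is represented by a form on an ambient
  neighbourhood; only its values on tangent vectors of the submanifold are meaningful, and forms
  are only ever compared there.
\<close>

type_synonym ('p, 'b) form = "'p \<Rightarrow> 'p list \<Rightarrow> 'b"

text \<open>
  Wedge product of a \<open>p\<close>-form and a \<open>q\<close>-form as a sum over shuffles, so that
  \<open>(\<alpha> \<and> \<beta>)(u, v) = \<alpha>(u) \<beta>(v) - \<alpha>(v) \<beta>(u)\<close> for 1-forms.  The set \<open>S\<close> holds the positions of the
  arguments passed to \<open>\<alpha>\<close>; the exponent counts the inversions of the corresponding shuffle.
\<close>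

definition wedge ::
  "nat \<Rightarrow> nat \<Rightarrow> ('p, 'b::real_vector) form \<Rightarrow> ('p, real) form \<Rightarrow> ('p, 'b) form" where
  "wedge p q \<alpha> \<beta> x vs =
     (\<Sum>S | S \<subseteq> {..<p + q} \<and> card S = p.
        ((-1) ^ card {(i, j). i \<in> S \<and> j \<in> {..<p + q} - S \<and> j < i} * \<beta> x (nths vs (- S)))
          *\<^sub>R \<alpha> x (nths vs S))"

definition pullback ::
  "('p::real_normed_vector \<Rightarrow> 'q::real_normed_vector) \<Rightarrow> ('q, 'b) form \<Rightarrow> ('p, 'b) form" where
  "pullback f \<alpha> x vs = \<alpha> (f x) (map (frechet_derivative f (at x)) vs)"

definition ext_deriv1 ::
  "('p::real_normed_vector, 'b::real_normed_vector) form \<Rightarrow> ('p, 'b) form" where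
  "ext_deriv1 \<alpha> x vs =
     frechet_derivative (\<lambda>y. \<alpha> y [vs ! 1]) (at x) (vs ! 0) -
     frechet_derivative (\<lambda>y. \<alpha> y [vs ! 0]) (at x) (vs ! 1)"

definition alternating_multilinear :: "nat \<Rightarrow> ('p::real_vector list \<Rightarrow> 'b::real_vector) \<Rightarrow> bool" where
  "alternating_multilinear k m \<longleftrightarrow>
     (\<forall>vs i. length vs = k \<longrightarrow> i < k \<longrightarrow> linear (\<lambda>u. m (vs[i := u]))) \<and>
     (\<forall>vs i j. length vs = k \<longrightarrow> i < j \<longrightarrow> j < k \<longrightarrow> vs ! i = vs ! j \<longrightarrow> m vs = 0)"

fun times_differentiable_on ::
  "nat \<Rightarrow> 'p::real_normed_vector set \<Rightarrow> ('p \<Rightarrow> 'b::real_normed_vector) \<Rightarrow> bool" where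
  "times_differentiable_on 0 U f \<longleftrightarrow> continuous_on U f"
| "times_differentiable_on (Suc n) U f \<longleftrightarrow>
     (\<forall>x\<in>U. f differentiable (at x)) \<and>
     (\<forall>v. times_differentiable_on n U (\<lambda>x. frechet_derivative f (at x) v))"

definition smooth_on :: "'p::real_normed_vector set \<Rightarrow> ('p \<Rightarrow> 'b::real_normed_vector) \<Rightarrow> bool" where
  "smooth_on U f \<longleftrightarrow> (\<forall>n. times_differentiable_on n U f)"

definition smooth_form_near ::
  "nat \<Rightarrow> 'p::real_normed_vector set \<Rightarrow> ('p, 'b::real_normed_vector) form \<Rightarrow> bool" where
  "smooth_form_near k X \<alpha> \<longleftrightarrow>
     (\<exists>U. open U \<and> X \<subseteq> U \<and> (\<forall>z\<in>U. alternating_multilinear k (\<alpha> z)) \<and>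
          (\<forall>vs. length vs = k \<longrightarrow> smooth_on U (\<lambda>z. \<alpha> z vs)))"


section \<open>The groups SU(2) and Spin(4)\<close>

type_synonym mat2 = "complex^2^2"

definition cadj :: "mat2 \<Rightarrow> mat2" where
  "cadj m = (\<chi> i j. cnj (m $ j $ i))"

definition SU2 :: "mat2 set" where
  "SU2 = {g. cadj g ** g = mat 1 \<and> det g = 1}"

definition su2 :: "mat2 set" where
  "su2 = {m. cadj m = - m \<and> trace m = 0}"

definition bracket :: "mat2 \<Rightarrow> mat2 \<Rightarrow> mat2" where
  "bracket m n = m ** n - n ** m"

definition diag2 :: "complex \<Rightarrow> complex \<Rightarrow> mat2" where
  "diag2 a b = vector [vector [a, 0], vector [0, b]]"

definition su2_basis :: "mat2 \<Rightarrow> mat2 \<Rightarrow> mat2 \<Rightarrow> bool" where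
  "su2_basis T1 T2 T3 \<longleftrightarrow>
     T1 \<in> su2 \<and> T2 \<in> su2 \<and> T3 \<in> su2 \<and> T1 = diag2 \<i> (- \<i>) \<and>
     bracket T1 T2 = 2 *\<^sub>R T3 \<and> bracket T2 T3 = 2 *\<^sub>R T1 \<and> bracket T3 T1 = 2 *\<^sub>R T2"

text \<open>
  \<open>\<complex>\<^sup>4\<close> is the complexification of the quaternions, that is, the 2 by 2 complex matrices.
  Under this identification the determinant is \<open>\<Sum> z\<^sub>i\<^sup>2\<close>, and \<open>Spin(4) = SU(2) \<times> SU(2)\<close>
  acts through \<open>SO(4)\<close> by \<open>m \<mapsto> p m q\<^sup>-\<^sup>1\<close>.
\<close>

definition to_mat :: "complex^4 \<Rightarrow> mat2" where
  "to_mat z = vector [vector [z $ 1 + \<i> * z $ 2, z $ 3 + \<i> * z $ 4],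
                      vector [- z $ 3 + \<i> * z $ 4, z $ 1 - \<i> * z $ 2]]"

definition of_mat :: "mat2 \<Rightarrow> complex^4" where
  "of_mat m = vector [(m $ 1 $ 1 + m $ 2 $ 2) / 2, (m $ 1 $ 1 - m $ 2 $ 2) / (2 * \<i>),
                      (m $ 1 $ 2 - m $ 2 $ 1) / 2, (m $ 1 $ 2 + m $ 2 $ 1) / (2 * \<i>)]"

definition spin_act :: "mat2 \<Rightarrow> mat2 \<Rightarrow> complex^4 \<Rightarrow> complex^4" where
  "spin_act p q z = of_mat (p ** to_mat z ** cadj q)"

text \<open>The isomorphism from \<open>su(2) \<oplus> su(2)\<close> to \<open>so(4)\<close>: the derivative of the action at the identity.\<close>

definition spin_to_so4 :: "mat2 \<Rightarrow> mat2 \<Rightarrow> complex^4^4" where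
  "spin_to_so4 a b = matrix (\<lambda>z. of_mat (a ** to_mat z - to_mat z ** b))"

definition C_mat :: "4 \<Rightarrow> 4 \<Rightarrow> complex^4^4" where
  "C_mat i j = (\<chi> k l. (if k = i \<and> l = j then 1 else 0) - (if k = j \<and> l = i then 1 else 0))"

definition X_index :: "nat \<Rightarrow> 4 \<times> 4" where
  "X_index i = (if i = 1 then (1, 2) else if i = 2 then (1, 3) else if i = 3 then (1, 4)
                else if i = 4 then (2, 3) else if i = 5 then (2, 4) else (3, 4))"

definition X_vec :: "nat \<Rightarrow> complex^4^4" where
  "X_vec i = C_mat (fst (X_index i)) (snd (X_index i))"

definition X_coord :: "nat \<Rightarrow> mat2 \<Rightarrow> mat2 \<Rightarrow> real" where
  "X_coord i a b = Re (spin_to_so4 a b $ fst (X_index i) $ snd (X_index i))"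

text \<open>The homomorphism \<open>\<lambda>\<^sub>1\<close> from \<open>U(1)\<close> to \<open>SU(2)\<close>, and the subgroup \<open>H\<close>, parametrised by \<open>\<gamma>\<close>.\<close>

definition lambda1 :: "real \<Rightarrow> mat2" where
  "lambda1 t = diag2 (cis t) (cis (- t))"

definition gamma_H :: "real \<Rightarrow> mat2 \<times> mat2" where
  "gamma_H t = (lambda1 t, lambda1 t)"


section \<open>The manifold and left-invariant forms off the zero section\<close>

definition Xeps :: "real \<Rightarrow> (complex^4) set" where
  "Xeps \<epsilon> = {z. (\<Sum>i\<in>UNIV. (z $ i)\<^sup>2) = (of_real \<epsilon>)\<^sup>2}"

definition T_Xeps :: "complex^4 \<Rightarrow> (complex^4) set" where
  "T_Xeps z = {u. (\<Sum>i\<in>UNIV. z $ i * u $ i) = 0}"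

definition Rplus :: "real \<Rightarrow> real \<Rightarrow> real" where
  "Rplus \<epsilon> r = sqrt ((r\<^sup>2 + \<epsilon>\<^sup>2) / 2)"

definition Rminus :: "real \<Rightarrow> real \<Rightarrow> real" where
  "Rminus \<epsilon> r = sqrt ((r\<^sup>2 - \<epsilon>\<^sup>2) / 2)"

text \<open>Points and tangent vectors of \<open>(\<epsilon>, \<infinity>) \<times> Spin(4)\<close>.\<close>

type_synonym cyl = "real \<times> mat2 \<times> mat2"

definition cyl :: "real \<Rightarrow> cyl set" where
  "cyl \<epsilon> = {\<epsilon><..} \<times> SU2 \<times> SU2"

definition T_cyl :: "cyl \<Rightarrow> cyl set" where
  "T_cyl x = (case x of (r, p, q) \<Rightarrow> {(\<rho>, P, Q). cadj p ** P \<in> su2 \<and> cadj q ** Q \<in> su2})"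

definition cyl_map :: "real \<Rightarrow> cyl \<Rightarrow> complex^4" where
  "cyl_map \<epsilon> x = (case x of (r, p, q) \<Rightarrow>
     spin_act p q (vector [of_real (Rplus \<epsilon> r), \<i> * of_real (Rminus \<epsilon> r), 0, 0]))"

definition dr :: "(cyl, real) form" where
  "dr x vs = fst (hd vs)"

definition theta :: "nat \<Rightarrow> (cyl, real) form" where
  "theta i x vs = (case x of (r, p, q) \<Rightarrow> case hd vs of (\<rho>, P, Q) \<Rightarrow>
     X_coord i (cadj p ** P) (cadj q ** Q))"

definition theta2 :: "nat \<Rightarrow> nat \<Rightarrow> (cyl, real) form" where
  "theta2 i j = wedge 1 1 (theta i) (theta j)"

definition theta3 :: "nat \<Rightarrow> nat \<Rightarrow> nat \<Rightarrow> (cyl, real) form" where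
  "theta3 i j k = wedge 1 2 (theta i) (theta2 j k)"


section \<open>Stenzel's Calabi-Yau structure\<close>

definition Fprime :: "real \<Rightarrow> real \<Rightarrow> real" where
  "Fprime \<epsilon> s = (let t = arcosh (s / \<epsilon>\<^sup>2) in
     1 / sinh t * root 3 (3 / (4 * \<epsilon>\<^sup>2)) * root 3 (sinh (2 * t) - 2 * t))"

definition G_fun :: "real \<Rightarrow> real \<Rightarrow> real" where
  "G_fun \<epsilon> r = Rplus \<epsilon> r * Rminus \<epsilon> r * Fprime \<epsilon> (r\<^sup>2)"

definition omega_cyl :: "real \<Rightarrow> (cyl, real) form" where
  "omega_cyl \<epsilon> x vs = (let r = fst x in
     deriv (G_fun \<epsilon>) r * wedge 1 1 dr (theta 1) x vs +
     G_fun \<epsilon> r * (theta2 2 4 x vs + theta2 3 5 x vs))"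

definition Omega1_cyl :: "real \<Rightarrow> (cyl, real) form" where
  "Omega1_cyl \<epsilon> x vs = (let r = fst x in
     - ((Rplus \<epsilon> r)\<^sup>2 * theta3 1 2 3 x vs - (Rminus \<epsilon> r)\<^sup>2 * theta3 1 4 5 x vs)
     - r / 2 * (wedge 1 2 dr (theta2 2 5) x vs - wedge 1 2 dr (theta2 3 4) x vs))"

definition Omega2_cyl :: "real \<Rightarrow> (cyl, real) form" where
  "Omega2_cyl \<epsilon> x vs = (let r = fst x in
     r / 2 * (Rplus \<epsilon> r / Rminus \<epsilon> r * wedge 1 2 dr (theta2 2 3) x vs
              - Rminus \<epsilon> r / Rplus \<epsilon> r * wedge 1 2 dr (theta2 4 5) x vs)
     + Rplus \<epsilon> r * Rminus \<epsilon> r * (theta3 1 3 4 x vs - theta3 1 2 5 x vs))"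

definition agree_on_cyl :: "real \<Rightarrow> nat \<Rightarrow> (cyl, 'b) form \<Rightarrow> (cyl, 'b) form \<Rightarrow> bool" where
  "agree_on_cyl \<epsilon> k \<alpha> \<beta> \<longleftrightarrow>
     (\<forall>x\<in>cyl \<epsilon>. \<forall>vs. length vs = k \<and> set vs \<subseteq> T_cyl x \<longrightarrow> \<alpha> x vs = \<beta> x vs)"

text \<open>
  The forms of the structure on the whole of \<open>X\<^sub>\<epsilon>\<close>: the smooth extensions over the zero section of
  the forms above.  They are unique, since the complement of the zero section is dense.  For
  instance, \<open>\<Omega>\<^sub>1 + i \<Omega>\<^sub>2\<close> is \<open>(u, v, w) \<mapsto> det(z, u, v, w) / \<epsilon>\<^sup>2\<close>, and \<open>\<omega>\<close> is the exterior derivative of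
  \<open>F'(|z|\<^sup>2) \<Sum> (x\<^sub>i dy\<^sub>i - y\<^sub>i dx\<^sub>i) / 2\<close>, where \<open>F'(s)\<close> extends smoothly across \<open>s = \<epsilon>\<^sup>2\<close>.
\<close>

definition stenzel_structure ::
  "real \<Rightarrow> (complex^4, real) form \<Rightarrow> (complex^4, real) form \<Rightarrow> (complex^4, real) form \<Rightarrow> bool" where
  "stenzel_structure \<epsilon> \<omega> \<Omega>1 \<Omega>2 \<longleftrightarrow>
     smooth_form_near 2 (Xeps \<epsilon>) \<omega> \<and>
     smooth_form_near 3 (Xeps \<epsilon>) \<Omega>1 \<and>
     smooth_form_near 3 (Xeps \<epsilon>) \<Omega>2 \<and>
     agree_on_cyl \<epsilon> 2 (pullback (cyl_map \<epsilon>) \<omega>) (omega_cyl \<epsilon>) \<and>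
     agree_on_cyl \<epsilon> 3 (pullback (cyl_map \<epsilon>) \<Omega>1) (Omega1_cyl \<epsilon>) \<and>
     agree_on_cyl \<epsilon> 3 (pullback (cyl_map \<epsilon>) \<Omega>2) (Omega2_cyl \<epsilon>)"


section \<open>The bundle and its connections\<close>

text \<open>
  The bundle \<open>P\<^sub>1\<close> extends over the zero section because \<open>\<lambda>\<^sub>1\<close> extends from \<open>H\<close> to the stabiliser of
  \<open>(\<epsilon>, 0, 0, 0)\<close>, the diagonal \<open>SU(2)\<close> in \<open>Spin(4)\<close>.  The homomorphisms from \<open>SU(2)\<close> to \<open>SU(2)\<close>
  extending \<open>\<lambda>\<^sub>1\<close> are \<open>\<lambda>(h) = c h c\<^sup>-\<^sup>1\<close> with \<open>c\<close> as follows; they all yield isomorphic bundles.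
\<close>

definition extends_lambda1 :: "mat2 \<Rightarrow> bool" where
  "extends_lambda1 c \<longleftrightarrow> c \<in> SU2 \<and> (\<forall>t. c ** lambda1 t ** cadj c = lambda1 t)"

text \<open>
  The extended bundle is the pull back to \<open>X\<^sub>\<epsilon>\<close> of the homogeneous bundle \<open>Spin(4) \<times>\<^sub>\<lambda> SU(2)\<close> over
  the sphere \<open>Spin(4) / SU(2)\<close>.  As \<open>\<lambda>\<close> extends further to \<open>Spin(4)\<close> by \<open>(p, q) \<mapsto> \<lambda>(q)\<close>, that bundle
  is trivialised by \<open>[(p, q), g] \<mapsto> \<lambda>(q) g\<close>, so the total space is \<open>X\<^sub>\<epsilon> \<times> SU(2)\<close>.  Off the zero
  section this identifies the class of \<open>(r, p, q, g)\<close> in \<open>(\<epsilon>, \<infinity>) \<times> (Spin(4) \<times>\<^sub>H SU(2))\<close> with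
  \<open>bundle_map \<epsilon> c (r, p, q) g\<close>, and the canonical map from \<open>Spin(4)\<close> to \<open>P\<^sub>1\<close> is the case \<open>g = 1\<close>.
\<close>

definition bundle_map :: "real \<Rightarrow> mat2 \<Rightarrow> cyl \<Rightarrow> mat2 \<Rightarrow> (complex^4) \<times> mat2" where
  "bundle_map \<epsilon> c x g = (case x of (r, p, q) \<Rightarrow> (cyl_map \<epsilon> x, c ** q ** cadj c ** g))"

definition canonical_map :: "real \<Rightarrow> mat2 \<Rightarrow> cyl \<Rightarrow> (complex^4) \<times> mat2" where
  "canonical_map \<epsilon> c x = bundle_map \<epsilon> c x (mat 1)"

text \<open>
  A connection on \<open>X\<^sub>\<epsilon> \<times> SU(2)\<close> is given by its smooth \<open>su(2)\<close>-valued gauge potential \<open>a\<close> on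
  \<open>X\<^sub>\<epsilon>\<close>.  Its curvature \<open>da + [a \<and> a] / 2\<close> on \<open>X\<^sub>\<epsilon>\<close> does not depend on the ambient representative
  of \<open>a\<close>.  The connection form and the curvature form live on the total space.
\<close>

definition is_connection :: "real \<Rightarrow> (complex^4, mat2) form \<Rightarrow> bool" where
  "is_connection \<epsilon> a \<longleftrightarrow>
     smooth_form_near 1 (Xeps \<epsilon>) a \<and> (\<forall>z\<in>Xeps \<epsilon>. \<forall>u\<in>T_Xeps z. a z [u] \<in> su2)"

definition curvature :: "(complex^4, mat2) form \<Rightarrow> (complex^4, mat2) form" where
  "curvature a z vs = ext_deriv1 a z vs + bracket (a z [vs ! 0]) (a z [vs ! 1])"

definition connection_form ::
  "(complex^4, mat2) form \<Rightarrow> ((complex^4) \<times> mat2, mat2) form" where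
  "connection_form a y vs = (case y of (z, g) \<Rightarrow> case hd vs of (u, w) \<Rightarrow>
     cadj g ** a z [u] ** g + cadj g ** w)"

definition curvature_form ::
  "(complex^4, mat2) form \<Rightarrow> ((complex^4) \<times> mat2, mat2) form" where
  "curvature_form a y vs = (case y of (z, g) \<Rightarrow> cadj g ** curvature a z (map fst vs) ** g)"

text \<open>Holonomy group at the point \<open>(z, 1)\<close> of the total space.\<close>

definition horizontal_path ::
  "real \<Rightarrow> (complex^4, mat2) form \<Rightarrow> (real \<Rightarrow> (complex^4) \<times> mat2) \<Rightarrow> bool" where
  "horizontal_path \<epsilon> a \<Gamma> \<longleftrightarrow>
     valid_path \<Gamma> \<and> \<Gamma> ` {0..1} \<subseteq> Xeps \<epsilon> \<times> SU2 \<and>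
     (\<exists>S. finite S \<and>
        (\<forall>t\<in>{0..1} - S. connection_form a (\<Gamma> t) [vector_derivative \<Gamma> (at t)] = 0))"

definition holonomy_group :: "real \<Rightarrow> (complex^4, mat2) form \<Rightarrow> complex^4 \<Rightarrow> mat2 set" where
  "holonomy_group \<epsilon> a z =
     {g. \<exists>\<Gamma>. horizontal_path \<epsilon> a \<Gamma> \<and> \<Gamma> 0 = (z, mat 1) \<and> \<Gamma> 1 = (z, g)}"

definition irreducible_connection :: "real \<Rightarrow> (complex^4, mat2) form \<Rightarrow> bool" where
  "irreducible_connection \<epsilon> a \<longleftrightarrow> (\<forall>z\<in>Xeps \<epsilon>. holonomy_group \<epsilon> a z = SU2)"

text \<open>
  The Hodge star of a 6-form \<open>\<mu>\<close> is the function \<open>f\<close> with \<open>\<mu> = f vol\<close>, where \<open>vol = \<omega>\<^sup>3 / 3!\<close> is the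
  Riemannian volume form of the Kaehler metric.  It is evaluated on a basis \<open>vs\<close> of the tangent
  space, on whose choice it does not depend.
\<close>

definition kaehler_vol :: "('p, real) form \<Rightarrow> ('p, real) form" where
  "kaehler_vol \<omega> z vs = wedge 4 2 (wedge 2 2 \<omega> \<omega>) \<omega> z vs / 6"

definition star6 :: "('p, real) form \<Rightarrow> ('p, 'b::real_vector) form \<Rightarrow> ('p, 'b) form" where
  "star6 \<omega> \<mu> z vs = \<mu> z vs /\<^sub>R kaehler_vol \<omega> z vs"

definition Lambda_contr :: "('p, real) form \<Rightarrow> ('p, 'b::real_vector) form \<Rightarrow> ('p, 'b) form" where
  "Lambda_contr \<omega> F = star6 \<omega> (wedge 2 4 F (\<lambda>z vs. wedge 2 2 \<omega> \<omega> z vs / 2))"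

definition hermitian_yang_mills ::
  "real \<Rightarrow> (complex^4, real) form \<Rightarrow> (complex^4, real) form \<Rightarrow> (complex^4, mat2) form \<Rightarrow> bool" where
  "hermitian_yang_mills \<epsilon> \<omega> \<Omega>1 a \<longleftrightarrow>
     (\<forall>z\<in>Xeps \<epsilon>. \<forall>vs. length vs = 5 \<and> set vs \<subseteq> T_Xeps z \<longrightarrow>
        wedge 2 3 (curvature a) \<Omega>1 z vs = 0) \<and>
     (\<forall>z\<in>Xeps \<epsilon>. \<forall>vs. length vs = 6 \<and> set vs \<subseteq> T_Xeps z \<and> distinct vs \<and> independent (set vs) \<longrightarrow>
        Lambda_contr \<omega> (curvature a) z vs = 0)"


section \<open>The explicit connection and curvature off the zero section\<close>

definition A_can :: "mat2 \<Rightarrow> (cyl, mat2) form" where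
  "A_can T1 x vs = (- theta 6 x vs / 2) *\<^sub>R T1"

definition A_cyl :: "real \<Rightarrow> mat2 \<Rightarrow> mat2 \<Rightarrow> mat2 \<Rightarrow> (cyl, mat2) form" where
  "A_cyl \<epsilon> T1 T2 T3 x vs = (let r = fst x in
     A_can T1 x vs +
     (\<epsilon> / (2 * Rplus \<epsilon> r)) *\<^sub>R (theta 4 x vs *\<^sub>R T2 + theta 5 x vs *\<^sub>R T3))"

definition F_cyl :: "real \<Rightarrow> mat2 \<Rightarrow> mat2 \<Rightarrow> mat2 \<Rightarrow> (cyl, mat2) form" where
  "F_cyl \<epsilon> T1 T2 T3 x vs = (let r = fst x in
     (- 1 / 2 * (theta2 2 3 x vs + (Rminus \<epsilon> r)\<^sup>2 / (Rplus \<epsilon> r)\<^sup>2 * theta2 4 5 x vs)) *\<^sub>R T1 +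
     (\<epsilon> / (2 * Rplus \<epsilon> r)) *\<^sub>R (theta2 1 2 x vs *\<^sub>R T2 + theta2 1 3 x vs *\<^sub>R T3) -
     (\<epsilon> / 4 * (r / (Rplus \<epsilon> r) ^ 3)) *\<^sub>R
       (wedge 1 1 dr (theta 4) x vs *\<^sub>R T2 + wedge 1 1 dr (theta 5) x vs *\<^sub>R T3))"


section \<open>Consistency of the conventions\<close>

lemma vector_4_nth:
  "(vector [w, x, y, z] :: ('a::zero)^4) $ 1 = w" "(vector [w, x, y, z] :: 'a^4) $ 2 = x"
  "(vector [w, x, y, z] :: 'a^4) $ 3 = y" "(vector [w, x, y, z] :: 'a^4) $ 4 = z"
  by (simp_all add: vector_def)

lemma det_to_mat: "det (to_mat z) = (\<Sum>i\<in>UNIV. (z $ i)\<^sup>2)"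
  by (simp add: det_2 to_mat_def sum_4 power2_eq_square algebra_simps)

lemma of_mat_to_mat: "of_mat (to_mat z) = z"
  by (simp add: vec_eq_iff forall_4 of_mat_def to_mat_def vector_4_nth)

lemma su2_entries:
  assumes "a \<in> su2"
  shows "Re (a $ 1 $ 1) = 0" "Re (a $ 2 $ 2) = 0" "Im (a $ 2 $ 2) = - Im (a $ 1 $ 1)"
    "Re (a $ 2 $ 1) = - Re (a $ 1 $ 2)" "Im (a $ 2 $ 1) = Im (a $ 1 $ 2)"
proof -
  have h: "cnj (a $ j $ i) = - (a $ i $ j)" for i j
    using assms by (simp add: su2_def cadj_def vec_eq_iff)
  have t: "a $ 1 $ 1 + a $ 2 $ 2 = 0"
    using assms by (simp add: su2_def trace_def sum_2)
  show "Re (a $ 1 $ 1) = 0" "Re (a $ 2 $ 2) = 0"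
    using h[of 1 1] h[of 2 2] by (simp_all add: complex_eq_iff)
  show "Im (a $ 2 $ 2) = - Im (a $ 1 $ 1)"
    using t by (simp add: complex_eq_iff)
  show "Re (a $ 2 $ 1) = - Re (a $ 1 $ 2)" "Im (a $ 2 $ 1) = Im (a $ 1 $ 2)"
    using h[of 2 1] by (simp_all add: complex_eq_iff)
qed

lemma sum_1_6: "(\<Sum>i=1..6. f i) = f 1 + f 2 + f 3 + f 4 + f 5 + f (6::nat)"
  for f :: "nat \<Rightarrow> 'a::comm_monoid_add"
proof -
  have "{1..6} = {1, 2, 3, 4, 5, 6::nat}" by auto
  then show ?thesis by (simp add: add.assoc)
qed

text \<open>The coordinates used to define \<open>\<theta>\<^sup>i\<close> are dual to the basis \<open>X\<^sub>1, \<dots>, X\<^sub>6\<close>.\<close>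

lemma spin_to_so4_eq:
  assumes "a \<in> su2" "b \<in> su2"
  shows "spin_to_so4 a b = (\<Sum>i=1..6. X_coord i a b *\<^sub>R X_vec i)"
  unfolding sum_1_6
  by (simp add: vec_eq_iff forall_4 X_coord_def X_vec_def X_index_def C_mat_def spin_to_so4_def
      matrix_def of_mat_def to_mat_def vector_4_nth axis_def matrix_matrix_mult_def sum_2
      complex_eq_iff su2_entries[OF assms(1)] su2_entries[OF assms(2)])
    (simp add: field_simps)

lemma gamma_H_derivative:
  "gamma_H 0 = (mat 1, mat 1)"
  "(gamma_H has_vector_derivative (diag2 \<i> (- \<i>), diag2 \<i> (- \<i>))) (at 0)"
  "spin_to_so4 (diag2 \<i> (- \<i>)) (diag2 \<i> (- \<i>)) = (-2) *\<^sub>R X_vec 6"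
proof -
  show "gamma_H 0 = (mat 1, mat 1)"
    by (simp add: gamma_H_def lambda1_def diag2_def vec_eq_iff forall_2 mat_def)
  have "lambda1 = (\<lambda>t. cos t *\<^sub>R mat 1 + sin t *\<^sub>R diag2 \<i> (- \<i>))"
    by (simp add: fun_eq_iff lambda1_def diag2_def vec_eq_iff forall_2 mat_def complex_eq_iff)
  moreover have "((\<lambda>t. cos t *\<^sub>R mat 1 + sin t *\<^sub>R diag2 \<i> (- \<i>))
      has_vector_derivative diag2 \<i> (- \<i>)) (at 0)"
    by (auto intro!: derivative_eq_intros)
  ultimately have "(lambda1 has_vector_derivative diag2 \<i> (- \<i>)) (at 0)"
    by simp
  then show "(gamma_H has_vector_derivative (diag2 \<i> (- \<i>), diag2 \<i> (- \<i>))) (at 0)"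
    unfolding gamma_H_def by (intro has_vector_derivative_Pair)
  show "spin_to_so4 (diag2 \<i> (- \<i>)) (diag2 \<i> (- \<i>)) = (-2) *\<^sub>R X_vec 6"
    by (simp add: vec_eq_iff forall_4 X_vec_def X_index_def C_mat_def spin_to_so4_def diag2_def
        matrix_def of_mat_def to_mat_def vector_4_nth axis_def matrix_matrix_mult_def sum_2
        scaleR_conv_of_real)
qed

text \<open>The trivialisation is constant on the classes of the associated bundle.\<close>

lemma lambda1_inverse: "lambda1 t ** lambda1 (- t) = mat 1" "cadj (lambda1 t) = lambda1 (- t)"
  by (simp_all add: lambda1_def diag2_def vec_eq_iff forall_2 mat_def matrix_matrix_mult_def sum_2
      cadj_def cis_mult cis_cnj)

lemma cadj_mult: "cadj (a ** b) = cadj b ** cadj a"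
  by (simp add: cadj_def vec_eq_iff forall_2 matrix_matrix_mult_def sum_2 mult.commute)

lemma bundle_map_H_invariant:
  assumes "extends_lambda1 c"
  shows "bundle_map \<epsilon> c (r, p ** lambda1 t, q ** lambda1 t) (lambda1 (- t) ** g) =
         bundle_map \<epsilon> c (r, p, q) g"
proof -
  define z :: "complex^4" where
    "z = vector [of_real (Rplus \<epsilon> r), \<i> * of_real (Rminus \<epsilon> r), 0, 0]"
  have cc: "cadj c ** c = mat 1"
    using assms by (simp add: extends_lambda1_def SU2_def)
  have cl: "c ** lambda1 t ** cadj c = lambda1 t"
    using assms by (simp add: extends_lambda1_def)
  have "lambda1 t ** to_mat z ** lambda1 (- t) = to_mat z"
    by (simp add: z_def to_mat_def vector_4_nth lambda1_def diag2_def vec_eq_iff forall_2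
        matrix_matrix_mult_def sum_2 cis_mult mult.commute mult.left_commute)
  then have 1: "spin_act (p ** lambda1 t) (q ** lambda1 t) z = spin_act p q z"
    unfolding spin_act_def cadj_mult lambda1_inverse(2) by (metis matrix_mul_assoc)
  have "c ** (q ** lambda1 t) ** cadj c = c ** q ** cadj c ** (c ** lambda1 t ** cadj c)"
    using cc by (metis matrix_mul_assoc matrix_mul_lid)
  also have "\<dots> = c ** q ** cadj c ** lambda1 t"
    by (simp only: cl)
  finally have 2: "c ** (q ** lambda1 t) ** cadj c ** (lambda1 (- t) ** g) = c ** q ** cadj c ** g"
    by (metis lambda1_inverse(1) matrix_mul_assoc matrix_mul_lid)
  show ?thesis
    using 1 2 by (simp add: bundle_map_def cyl_map_def z_def)
qed

end

theory Submission
  imports Defs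
begin

text \<open>
  Write a point of \<open>X\<^sub>\<epsilon>\<close> as \<open>z = x + i y\<close> with \<open>x, y \<in> \<real>\<^sup>4\<close>, so that \<open>|x|\<^sup>2 - |y|\<^sup>2 = \<epsilon>\<^sup>2\<close> and \<open>x \<bottom> y\<close>, and read
  real 4-vectors as quaternions, that is, as real multiples of elements of \<open>SU(2)\<close>.  At the image of
  \<open>(r, p, q)\<close> one has \<open>x = R\<^sub>+ p q\<^sup>-\<^sup>1\<close> and \<open>y = R\<^sub>- p T\<^sub>1 q\<^sup>-\<^sup>1\<close>.  In the trivialisation of the bundle and for
  the standard choice of \<open>T\<^sub>2\<close>, \<open>T\<^sub>3\<close> (the others are conjugate to it), the prescribed connection takes the value \<open>q (A - \<beta>) q\<^sup>-\<^sup>1\<close> on the vector \<open>(\<rho>, p \<alpha>, q \<beta>)\<close>, where \<open>A\<close> is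
  half of \<open>\<alpha> + \<beta>\<close> with the part orthogonal to \<open>T\<^sub>1\<close> scaled by \<open>\<epsilon> / R\<^sub>+\<close>.  Each ingredient can be expressed
  through \<open>x\<close>, \<open>y\<close> and their differentials; because \<open>\<epsilon> / R\<^sub>+ - 1 = - R\<^sub>-\<^sup>2 / (R\<^sub>+ (R\<^sub>+ + \<epsilon>))\<close>, the factors
  \<open>R\<^sub>-\<close> cancel the singularity of \<open>q T\<^sub>1 q\<^sup>-\<^sup>1 = x\<^sup>-\<^sup>1 y R\<^sub>+ / R\<^sub>-\<close> along the zero section.  The result is a
  formula (\<open>conn_formula\<close>) that is smooth in \<open>z\<close>, and hence a connection on the whole bundle; that it
  restricts to the prescribed one is \<open>potential_cyl_field\<close>.

  The curvature is computed on left-invariant vector fields of the cylinder, where the potential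
  depends on the point only through \<open>r\<close> and the rotation by \<open>q\<close> (\<open>curvature_cyl_field\<close>).  Its wedge
  products with \<open>\<Omega>\<^sub>1\<close> and \<open>\<omega> \<and> \<omega>\<close> are sums of monomials in the \<open>\<theta>\<^sup>i\<close>, almost all of which contain a
  factor twice; the others cancel (\<open>F_cyl_wedge_Omega1\<close>, \<open>F_cyl_wedge_omega_omega\<close>).  This gives the
  Hermitian Yang-Mills equations off the zero section, since the cylinder maps onto its complement
  (\<open>cyl_map_surj\<close>) and its tangent spaces map onto those of \<open>X\<^sub>\<epsilon>\<close> (\<open>cyl_field_surj\<close>).  On the zero section
  they follow by continuity.

  For irreducibility the holonomy group is computed outright.  The rays \<open>y \<mapsto> l y\<close> have trivial parallel
  transport and reduce the question to base points \<open>\<epsilon> U\<close> of the zero section, where the connection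
  is one half of the Maurer-Cartan form \<open>U\<^sup>-\<^sup>1 dU\<close> of the 3-sphere.  Its transport along the half circle from \<open>\<epsilon> U\<close> to
  \<open>- \<epsilon> U\<close> in the direction of a unit imaginary quaternion \<open>\<xi>\<close> is \<open>- \<xi>\<close>.  Out along one half circle and
  back along another has holonomy \<open>\<eta> \<xi>\<close>, and every unit quaternion is such a product.
\<close>

section \<open>Quaternionic 2 by 2 matrices\<close>

lemma matrix_scaleR_left: "(r *\<^sub>R A) ** B = r *\<^sub>R (A ** B)" for A B :: mat2
  by (simp add: matrix_matrix_mult_def vec_eq_iff sum_2 algebra_simps)

lemma matrix_scaleR_right: "A ** (r *\<^sub>R B) = r *\<^sub>R (A ** B)" for A B :: mat2
  by (simp add: matrix_matrix_mult_def vec_eq_iff sum_2 algebra_simps)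

lemma matrix_add_rdistrib: "(A + B) ** C = A ** C + B ** C" for A B C :: mat2
  by (simp add: matrix_matrix_mult_def vec_eq_iff sum_2 algebra_simps)

lemma matrix_diff_left: "(A - B) ** C = A ** C - B ** C" for A B C :: mat2
  by (simp add: matrix_matrix_mult_def vec_eq_iff sum_2 algebra_simps)

lemma matrix_diff_right: "C ** (A - B) = C ** A - C ** B" for A B C :: mat2
  by (simp add: matrix_matrix_mult_def vec_eq_iff sum_2 algebra_simps)

lemma matrix_minus_left: "(- A) ** C = - (A ** C)" for A C :: mat2
  by (simp add: matrix_matrix_mult_def vec_eq_iff sum_2 algebra_simps)

lemma matrix_minus_right: "C ** (- A) = - (C ** A)" for A C :: mat2
  by (simp add: matrix_matrix_mult_def vec_eq_iff sum_2 algebra_simps)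

lemma matrix_zero: "0 ** A = (0 :: mat2)" "A ** 0 = (0 :: mat2)" for A :: mat2
  by (simp_all add: matrix_matrix_mult_def vec_eq_iff)

text \<open>
  Rewriting with the laws of the noncommutative ring of matrices, products being bracketed to the
  right.  Together with \<open>SU2_cancel\<close> this decides the identities between conjugates below.
\<close>

lemmas matrix_ring = matrix_mul_assoc[symmetric] matrix_add_ldistrib matrix_add_rdistrib
  matrix_diff_left matrix_diff_right matrix_minus_left matrix_minus_right
  matrix_scaleR_left matrix_scaleR_right matrix_zero matrix_mul_lid matrix_mul_rid

lemma cadj_simps:
  "cadj (A + B) = cadj A + cadj B" "cadj (A - B) = cadj A - cadj B" "cadj (- A) = - cadj A"
  "cadj (r *\<^sub>R A) = r *\<^sub>R cadj A" "cadj (cadj A) = A" "cadj (mat 1) = mat 1" "cadj 0 = 0"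
  by (simp_all add: cadj_def vec_eq_iff mat_def)

interpretation matrix_mult: bounded_bilinear "(**) :: mat2 \<Rightarrow> mat2 \<Rightarrow> mat2"
proof -
  have "bilinear ((**) :: mat2 \<Rightarrow> mat2 \<Rightarrow> mat2)"
    by (auto simp: bilinear_def linear_iff matrix_ring)
  then show "bounded_bilinear ((**) :: mat2 \<Rightarrow> mat2 \<Rightarrow> mat2)"
    by (simp add: bilinear_conv_bounded_bilinear)
qed

lemma bounded_linear_cadj: "bounded_linear cadj"
  by (simp add: linear_conv_bounded_linear[symmetric] linear_iff cadj_simps)

text \<open>
  The quaternions as the real multiples of elements of \<open>SU(2)\<close>.  The real inner product of two of them is
  twice the usual one, since each coordinate appears in two matrix entries; this is the source of the
  factors 2 below.
\<close>

definition quat :: "mat2 \<Rightarrow> bool" where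
  "quat m \<longleftrightarrow> m $ 2 $ 2 = cnj (m $ 1 $ 1) \<and> m $ 2 $ 1 = - cnj (m $ 1 $ 2)"

text \<open>
  The imaginary quaternion \<open>a i + b j + c k\<close>, with \<open>i\<close> represented by \<open>diag2 \<i> (- \<i>)\<close>.
\<close>

definition pure_quat :: "real \<Rightarrow> real \<Rightarrow> real \<Rightarrow> mat2" where
  "pure_quat a b c = vector [vector [Complex 0 a, Complex b c], vector [Complex (- b) c, Complex 0 (- a)]]"

abbreviation quat_i :: mat2 where "quat_i \<equiv> diag2 \<i> (- \<i>)"

lemma pure_quat_nth:
  "pure_quat a b c $ 1 $ 1 = Complex 0 a" "pure_quat a b c $ 1 $ 2 = Complex b c"
  "pure_quat a b c $ 2 $ 1 = Complex (- b) c" "pure_quat a b c $ 2 $ 2 = Complex 0 (- a)"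
  by (simp_all add: pure_quat_def)

lemma diag2_nth:
  "diag2 a b $ 1 $ 1 = a" "diag2 a b $ 1 $ 2 = 0" "diag2 a b $ 2 $ 1 = 0" "diag2 a b $ 2 $ 2 = b"
  by (simp_all add: diag2_def)

lemma mat2_eq_iff:
  "m = n \<longleftrightarrow> m $ 1 $ 1 = n $ 1 $ 1 \<and> m $ 1 $ 2 = n $ 1 $ 2 \<and> m $ 2 $ 1 = n $ 2 $ 1 \<and>
     m $ 2 $ 2 = n $ 2 $ 2" for m n :: mat2
  by (auto simp: vec_eq_iff forall_2)

lemma mat2_mult_nth: "(m ** n) $ i $ j = m $ i $ 1 * n $ 1 $ j + m $ i $ 2 * n $ 2 $ j" for m n :: mat2
  by (simp add: matrix_matrix_mult_def sum_2)

lemma mat_nth: "(mat a :: mat2) $ i $ j = (if i = j then a else 0)"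
  by (simp add: mat_def)

lemma cadj_nth: "cadj m $ i $ j = cnj (m $ j $ i)"
  by (simp add: cadj_def)

lemmas mat2_entries = mat2_eq_iff mat2_mult_nth mat_nth cadj_nth diag2_nth pure_quat_nth

lemma quat_i_eq: "quat_i = pure_quat 1 0 0"
  by (simp add: mat2_entries complex_eq_iff)

lemma quat_simps:
  "quat A \<Longrightarrow> quat B \<Longrightarrow> quat (A + B)" "quat A \<Longrightarrow> quat B \<Longrightarrow> quat (A - B)" "quat A \<Longrightarrow> quat (- A)"
  "quat A \<Longrightarrow> quat (r *\<^sub>R A)" "quat A \<Longrightarrow> quat B \<Longrightarrow> quat (A ** B)" "quat A \<Longrightarrow> quat (cadj A)"
  "quat (mat 1)" "quat (pure_quat a b c)" "quat 0"
  by (simp_all add: quat_def mat2_entries complex_eq_iff)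

lemma su2_iff: "m \<in> su2 \<longleftrightarrow> (\<exists>a b c. m = pure_quat a b c)"
proof
  assume m: "m \<in> su2"
  show "\<exists>a b c. m = pure_quat a b c"
    by (rule exI[of _ "Im (m$1$1)"], rule exI[of _ "Re (m$1$2)"], rule exI[of _ "Im (m$1$2)"])
      (use su2_entries[OF m] in \<open>simp add: mat2_entries complex_eq_iff\<close>)
next
  assume "\<exists>a b c. m = pure_quat a b c"
  then show "m \<in> su2"
    by (auto simp: su2_def mat2_entries trace_def sum_2 complex_eq_iff)
qed

lemma su2_quat: "m \<in> su2 \<Longrightarrow> quat m"
  by (auto simp: su2_iff quat_simps)

lemma cadj_su2: "m \<in> su2 \<Longrightarrow> cadj m = - m"
  by (simp add: su2_def)

lemma inner_mat2: "inner m n = Re (m$1$1) * Re (n$1$1) + Im (m$1$1) * Im (n$1$1)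
    + Re (m$1$2) * Re (n$1$2) + Im (m$1$2) * Im (n$1$2)
    + Re (m$2$1) * Re (n$2$1) + Im (m$2$1) * Im (n$2$1)
    + Re (m$2$2) * Re (n$2$2) + Im (m$2$2) * Im (n$2$2)" for m n :: mat2
  by (simp add: inner_vec_def sum_2 inner_complex_def)

lemma quat_cadj_mult: "quat m \<Longrightarrow> cadj m ** m = (inner m m / 2) *\<^sub>R mat 1"
  "quat m \<Longrightarrow> m ** cadj m = (inner m m / 2) *\<^sub>R mat 1"
  by (auto simp: quat_def mat2_entries complex_eq_iff inner_mat2 algebra_simps)

lemma det_quat: "quat m \<Longrightarrow> det m = of_real (inner m m / 2)"
  by (auto simp: quat_def det_2 complex_eq_iff inner_mat2 algebra_simps)

lemma SU2_iff: "m \<in> SU2 \<longleftrightarrow> quat m \<and> inner m m = 2"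
proof
  assume "m \<in> SU2"
  then have u: "cadj m ** m = mat 1" and d: "det m = 1"
    by (auto simp: SU2_def)
  \<comment> \<open>The adjugate and the adjoint are both left inverses of \<open>m\<close>.\<close>
  define n where "n = (vector [vector [m$2$2, - (m$1$2)], vector [- (m$2$1), m$1$1]] :: mat2)"
  have "m ** n = mat 1"
    using d by (simp add: n_def mat2_entries det_2 algebra_simps)
  then have "cadj m = n"
    using u by (metis matrix_mul_assoc matrix_mul_lid matrix_mul_rid)
  then have q: "quat m"
    by (auto simp: n_def mat2_entries quat_def)
  then show "quat m \<and> inner m m = 2"
    using d det_quat[OF q] by (simp add: complex_eq_iff)
next
  assume "quat m \<and> inner m m = 2"
  then show "m \<in> SU2"
    using quat_cadj_mult(1)[of m] det_quat[of m] by (simp add: SU2_def)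
qed

lemma SU2_quat: "p \<in> SU2 \<Longrightarrow> quat p"
  by (simp add: SU2_iff)

lemma SU2_cancel:
  assumes "p \<in> SU2"
  shows "cadj p ** p = mat 1" "p ** cadj p = mat 1"
    "cadj p ** (p ** A) = A" "p ** (cadj p ** A) = A"
proof -
  show 1: "cadj p ** p = mat 1" "p ** cadj p = mat 1"
    using assms quat_cadj_mult[of p] by (auto simp: SU2_iff)
  show "cadj p ** (p ** A) = A" "p ** (cadj p ** A) = A"
    using 1 by (simp_all add: matrix_mul_assoc)
qed

lemma SU2_mult:
  assumes "p \<in> SU2" "q \<in> SU2"
  shows "p ** q \<in> SU2"
  using assms(1)[unfolded SU2_def] assms(2)[unfolded SU2_def]
  by (simp add: SU2_def cadj_mult det_mul matrix_ring SU2_cancel[OF assms(1)])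

lemma SU2_cadj: "p \<in> SU2 \<Longrightarrow> cadj p \<in> SU2"
  using SU2_cancel(2)[of p] by (simp add: SU2_iff quat_simps) (simp add: inner_mat2 cadj_nth)

lemma SU2_one: "mat 1 \<in> SU2"
  by (simp add: SU2_def cadj_simps)

lemma inner_cadj: "inner m n = Re (trace (cadj m ** n))"
  by (simp add: inner_mat2 trace_def sum_2 mat2_mult_nth cadj_nth)

lemma inner_SU2_left: "p \<in> SU2 \<Longrightarrow> inner (p ** A) (p ** B) = inner A B" for A B :: mat2
  by (simp add: inner_cadj cadj_mult SU2_cancel matrix_ring)

lemma inner_SU2_right:
  fixes A B :: mat2
  assumes "q \<in> SU2"
  shows "inner (A ** q) (B ** q) = inner A B"
proof -
  have "trace (cadj (A ** q) ** (B ** q)) = trace ((cadj A ** B ** q) ** cadj q)"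
    by (metis cadj_mult matrix_mul_assoc trace_mul_sym)
  also have "(cadj A ** B ** q) ** cadj q = cadj A ** B"
    by (simp add: matrix_ring SU2_cancel[OF assms])
  finally show ?thesis
    by (simp add: inner_cadj)
qed

lemma inner_SU2_conj: "p \<in> SU2 \<Longrightarrow> q \<in> SU2 \<Longrightarrow> inner (p ** A ** cadj q) (p ** B ** cadj q) = inner A B"
  by (simp add: inner_SU2_right[OF SU2_cadj] inner_SU2_left)

lemma su2_conj:
  assumes "q \<in> SU2" "m \<in> su2"
  shows "q ** m ** cadj q \<in> su2"
proof -
  have "trace (q ** m ** cadj q) = trace (cadj q ** (q ** m))"
    by (rule trace_mul_sym)
  then show ?thesis
    using assms by (simp add: su2_def cadj_mult cadj_simps matrix_ring SU2_cancel[OF assms(1)])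
qed

text \<open>
  On quaternions this is the imaginary part.
\<close>

definition skew :: "mat2 \<Rightarrow> mat2" where
  "skew m = (1/2) *\<^sub>R (m - cadj m)"

lemma skew_conj: "skew (q ** m ** cadj q) = q ** skew m ** cadj q"
  by (simp add: skew_def cadj_mult cadj_simps matrix_ring)

lemma bounded_linear_skew: "bounded_linear skew"
  unfolding skew_def using bounded_linear_cadj
  by (intro bounded_linear_intros)

lemma skew_su2: "quat m \<Longrightarrow> skew m \<in> su2"
  unfolding su2_iff
  by (rule exI[of _ "Im (m$1$1)"], rule exI[of _ "Re (m$1$2)"], rule exI[of _ "Im (m$1$2)"])
    (simp add: quat_def skew_def mat2_entries complex_eq_iff)

lemma su2_lin: "m \<in> su2 \<Longrightarrow> n \<in> su2 \<Longrightarrow> m + n \<in> su2" "m \<in> su2 \<Longrightarrow> r *\<^sub>R m \<in> su2"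
  "0 \<in> su2" "quat_i \<in> su2"
  by (auto simp: su2_def cadj_simps trace_add trace_sub)
    (simp_all add: trace_def sum_2 mat2_entries scaleR_add_right[symmetric])

lemma su2_minus: "m \<in> su2 \<Longrightarrow> - m \<in> su2" "m \<in> su2 \<Longrightarrow> n \<in> su2 \<Longrightarrow> m - n \<in> su2"
  using su2_lin(2)[of m "-1"] su2_lin(2)[of n "-1"] su2_lin(1)[of m "- n"] by simp_all

lemma su2_bracket: "m \<in> su2 \<Longrightarrow> n \<in> su2 \<Longrightarrow> bracket m n \<in> su2"
  by (simp add: su2_def bracket_def cadj_mult cadj_simps matrix_ring trace_sub trace_mul_sym[of m n])


section \<open>Complex 4-vectors as pairs of quaternions\<close>

text \<open>
  The vector \<open>x + i y\<close> for real vectors \<open>x\<close>, \<open>y\<close> given as quaternions.  It is only used on quaternions,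
  where \<open>quat_Re\<close> and \<open>quat_Im\<close> recover the two components.
\<close>

definition of_quats :: "mat2 \<Rightarrow> mat2 \<Rightarrow> complex^4" where
  "of_quats A B = of_mat (A + mat \<i> ** B)"

definition quat_Re :: "complex^4 \<Rightarrow> mat2" where
  "quat_Re z = to_mat (\<chi> i. of_real (Re (z $ i)))"

definition quat_Im :: "complex^4 \<Rightarrow> mat2" where
  "quat_Im z = to_mat (\<chi> i. of_real (Im (z $ i)))"

lemma to_mat_nth: "to_mat z $ 1 $ 1 = z $ 1 + \<i> * z $ 2" "to_mat z $ 1 $ 2 = z $ 3 + \<i> * z $ 4"
  "to_mat z $ 2 $ 1 = - z $ 3 + \<i> * z $ 4" "to_mat z $ 2 $ 2 = z $ 1 - \<i> * z $ 2"
  by (simp_all add: to_mat_def)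

lemma quat_re_im: "quat (quat_Re z)" "quat (quat_Im z)"
  by (simp_all add: quat_def quat_Re_def quat_Im_def to_mat_nth complex_eq_iff)

lemma of_quats_re_im: "of_quats (quat_Re z) (quat_Im z) = z"
  by (simp add: of_quats_def of_mat_def quat_Re_def quat_Im_def to_mat_nth vec_eq_iff forall_4
      vector_4_nth mat2_mult_nth mat_nth complex_eq_iff)

lemma re_im_of_quats:
  assumes "quat A" "quat B"
  shows "quat_Re (of_quats A B) = A" "quat_Im (of_quats A B) = B"
  using assms
  by (simp_all add: of_quats_def of_mat_def quat_Re_def quat_Im_def to_mat_nth
      vector_4_nth mat2_entries quat_def complex_eq_iff)

lemma of_quats_linear:
  "of_quats (A + A') (B + B') = of_quats A B + of_quats A' B'"
  "of_quats (A - A') (B - B') = of_quats A B - of_quats A' B'"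
  "of_quats (r *\<^sub>R A) (r *\<^sub>R B) = r *\<^sub>R of_quats A B"
  by (simp_all add: of_quats_def of_mat_def vector_4_nth mat2_mult_nth mat_nth vec_eq_iff forall_4
      scaleR_conv_of_real[where 'a=complex] field_simps)

lemma re_im_linear:
  "quat_Re (u + v) = quat_Re u + quat_Re v" "quat_Im (u + v) = quat_Im u + quat_Im v"
  "quat_Re (r *\<^sub>R u) = r *\<^sub>R quat_Re u" "quat_Im (r *\<^sub>R u) = r *\<^sub>R quat_Im u"
  by (simp_all add: quat_Re_def quat_Im_def mat2_eq_iff to_mat_nth complex_eq_iff algebra_simps)

lemma bounded_linear_re_im: "bounded_linear quat_Re" "bounded_linear quat_Im"
  by (simp_all add: linear_conv_bounded_linear[symmetric] linear_iff re_im_linear)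

lemma bounded_linear_of_quats: "bounded_linear (\<lambda>(A, B). of_quats A B)"
  by (simp add: linear_conv_bounded_linear[symmetric] linear_iff of_quats_linear split_def)

lemma inner_C4: "inner z w = (inner (quat_Re z) (quat_Re w) + inner (quat_Im z) (quat_Im w)) / 2"
  for z w :: "complex^4"
  by (simp add: inner_vec_def[of z] sum_4 inner_complex_def inner_mat2 quat_Re_def quat_Im_def
      to_mat_nth algebra_simps)

lemma sum_mult_C4: "(\<Sum>i\<in>UNIV. z $ i * w $ i) = Complex
    ((inner (quat_Re z) (quat_Re w) - inner (quat_Im z) (quat_Im w)) / 2)
    ((inner (quat_Re z) (quat_Im w) + inner (quat_Im z) (quat_Re w)) / 2)"
  by (simp add: sum_4 inner_mat2 quat_Re_def quat_Im_def to_mat_nth complex_eq_iff algebra_simps)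

lemma Xeps_iff: "z \<in> Xeps \<epsilon> \<longleftrightarrow>
    inner (quat_Re z) (quat_Re z) - inner (quat_Im z) (quat_Im z) = 2 * \<epsilon>\<^sup>2 \<and>
    inner (quat_Re z) (quat_Im z) = 0"
  using sum_mult_C4[of z z]
  by (auto simp: Xeps_def power2_eq_square[of "z $ _"] complex_eq_iff inner_commute power2_eq_square)

lemma T_Xeps_iff: "u \<in> T_Xeps z \<longleftrightarrow>
    inner (quat_Re z) (quat_Re u) = inner (quat_Im z) (quat_Im u) \<and>
    inner (quat_Re z) (quat_Im u) + inner (quat_Im z) (quat_Re u) = 0"
  unfolding T_Xeps_def sum_mult_C4 by (auto simp: complex_eq_iff)

section \<open>Smooth functions\<close>

lemma times_differentiable_on_has_derivative:
  assumes "times_differentiable_on (Suc n) U f" "x \<in> U"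
  shows "(f has_derivative frechet_derivative f (at x)) (at x)"
  using assms frechet_derivative_works by auto

text \<open>
  The iterated derivative is defined through \<open>frechet_derivative\<close>, whose value on \<open>U\<close> only depends on the
  function near each point; so a function may be replaced by one that agrees with it on the open set.
\<close>

lemma times_differentiable_on_cong:
  assumes "open U" "times_differentiable_on n U f" "\<And>x. x \<in> U \<Longrightarrow> f x = g x"
  shows "times_differentiable_on n U g"
  using assms(2,3)
proof (induction n arbitrary: f g)
  case 0
  then show ?case using continuous_on_eq by auto
next
  case (Suc n)
  have d: "(g has_derivative frechet_derivative f (at x)) (at x)" if "x \<in> U" for x
    using has_derivative_transform_within_open[OF
        times_differentiable_on_has_derivative[OF Suc.prems(1) that] assms(1) that Suc.prems(2)] .
  have "times_differentiable_on n U (\<lambda>x. frechet_derivative g (at x) v)" for v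
  proof (rule Suc.IH)
    show "times_differentiable_on n U (\<lambda>x. frechet_derivative f (at x) v)"
      using Suc.prems(1) by simp
    show "frechet_derivative f (at x) v = frechet_derivative g (at x) v" if "x \<in> U" for x
      using frechet_derivative_at[OF d[OF that]] by simp
  qed
  moreover have "g differentiable (at x)" if "x \<in> U" for x
    using d[OF that] unfolding differentiable_def by blast
  ultimately show ?case by simp
qed

text \<open>
  The induction step for all closure properties: some explicit derivative is known, and its values in
  each direction are differentiable one time less.
\<close>

lemma times_differentiable_on_SucI:
  assumes "open U" and d: "\<And>x. x \<in> U \<Longrightarrow> (f has_derivative f' x) (at x)"
    and "\<And>v. times_differentiable_on n U (\<lambda>x. f' x v)"
  shows "times_differentiable_on (Suc n) U f"
proof -
  have "times_differentiable_on n U (\<lambda>x. frechet_derivative f (at x) v)" for v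
    by (rule times_differentiable_on_cong[OF assms(1) assms(3)[of v]])
      (use frechet_derivative_at[OF d] in simp)
  moreover have "f differentiable (at x)" if "x \<in> U" for x
    using d[OF that] unfolding differentiable_def by blast
  ultimately show ?thesis by simp
qed

lemma times_differentiable_on_SucD:
  "times_differentiable_on (Suc n) U f \<Longrightarrow> times_differentiable_on n U f"
proof (induction n arbitrary: f)
  case 0
  then show ?case
    by (simp add: continuous_at_imp_continuous_on differentiable_imp_continuous_within)
next
  case (Suc n)
  then show ?case
    using times_differentiable_on.simps(2) by metis
qed

lemma times_differentiable_on_const: "times_differentiable_on n U (\<lambda>x. c)"
  by (induction n arbitrary: c) (auto simp: frechet_derivative_const)

lemma times_differentiable_on_linear:
  assumes "open U" "bounded_linear L" "times_differentiable_on n U f"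
  shows "times_differentiable_on n U (\<lambda>x. L (f x))"
  using assms(3)
proof (induction n arbitrary: f)
  case 0
  then show ?case
    using bounded_linear.continuous_on[OF assms(2)] by simp
next
  case (Suc n)
  show ?case
    by (rule times_differentiable_on_SucI[OF assms(1)
          bounded_linear.has_derivative[OF assms(2)
            times_differentiable_on_has_derivative[OF Suc.prems]]])
      (use Suc in auto)
qed

lemma times_differentiable_on_id:
  assumes "open U"
  shows "times_differentiable_on n U (\<lambda>x. x)"
proof (cases n)
  case (Suc m)
  then show ?thesis
    by (auto intro!: times_differentiable_on_SucI[OF assms] derivative_eq_intros
        times_differentiable_on_const)
qed simp

lemma times_differentiable_on_add:
  assumes "open U" "times_differentiable_on n U f" "times_differentiable_on n U g"
  shows "times_differentiable_on n U (\<lambda>x. f x + g x)"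
  using assms(2,3)
proof (induction n arbitrary: f g)
  case 0
  then show ?case by (simp add: continuous_on_add)
next
  case (Suc n)
  show ?case
    by (rule times_differentiable_on_SucI[OF assms(1) has_derivative_add[OF
            times_differentiable_on_has_derivative[OF Suc.prems(1)]
            times_differentiable_on_has_derivative[OF Suc.prems(2)]]])
      (use Suc in auto)
qed

lemma times_differentiable_on_bilinear:
  assumes "open U" "bounded_bilinear B" "times_differentiable_on n U f" "times_differentiable_on n U g"
  shows "times_differentiable_on n U (\<lambda>x. B (f x) (g x))"
  using assms(3,4)
proof (induction n arbitrary: f g)
  case 0
  then show ?case by (simp add: bounded_bilinear.continuous_on[OF assms(2)])
next
  case (Suc n)
  have 1: "times_differentiable_on n U f" "times_differentiable_on n U g"
    using Suc.prems by (blast intro: times_differentiable_on_SucD)+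
  have 2: "times_differentiable_on n U (\<lambda>x. frechet_derivative f (at x) v)"
    "times_differentiable_on n U (\<lambda>x. frechet_derivative g (at x) v)" for v
    using Suc.prems by auto
  show ?case
    by (rule times_differentiable_on_SucI[OF assms(1) bounded_bilinear.FDERIV[OF assms(2)
            times_differentiable_on_has_derivative[OF Suc.prems(1)]
            times_differentiable_on_has_derivative[OF Suc.prems(2)]]])
      (auto intro!: times_differentiable_on_add[OF assms(1)] Suc.IH 1 2)
qed

lemma times_differentiable_on_inverse:
  fixes f :: "'a::real_normed_vector \<Rightarrow> real"
  assumes "open U" "times_differentiable_on n U f" "\<And>x. x \<in> U \<Longrightarrow> f x \<noteq> 0"
  shows "times_differentiable_on n U (\<lambda>x. inverse (f x))"
  using assms(2)
proof (induction n)
  case 0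
  then show ?case using assms(3) by (simp add: continuous_on_inverse)
next
  case (Suc n)
  have i: "times_differentiable_on n U (\<lambda>x. inverse (f x))"
    using Suc times_differentiable_on_SucD by blast
  have m: "times_differentiable_on n U (\<lambda>x. - h x)" if "times_differentiable_on n U h"
    for h :: "'a \<Rightarrow> real"
    using times_differentiable_on_linear[OF assms(1) bounded_linear_minus[OF bounded_linear_ident] that] .
  show ?case
    by (rule times_differentiable_on_SucI[OF assms(1) Deriv.has_derivative_inverse[OF assms(3)
            times_differentiable_on_has_derivative[OF Suc.prems]]])
      (use Suc.prems in \<open>auto intro!: m i times_differentiable_on_bilinear[OF assms(1) bounded_bilinear_mult]\<close>)
qed

lemma times_differentiable_on_sqrt:
  fixes f :: "'a::real_normed_vector \<Rightarrow> real"
  assumes "open U" "times_differentiable_on n U f" "\<And>x. x \<in> U \<Longrightarrow> f x > 0"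
  shows "times_differentiable_on n U (\<lambda>x. sqrt (f x))"
  using assms(2)
proof (induction n)
  case 0
  then show ?case by (simp add: continuous_on_real_sqrt)
next
  case (Suc n)
  have s: "times_differentiable_on n U (\<lambda>x. sqrt (f x))"
    using Suc times_differentiable_on_SucD by blast
  show ?case
  proof (rule times_differentiable_on_SucI[OF assms(1)])
    show "((\<lambda>x. sqrt (f x)) has_derivative
        (\<lambda>v. frechet_derivative f (at x) v * (1/2 * inverse (sqrt (f x))))) (at x)" if "x \<in> U" for x
      using has_derivative_real_sqrt[OF assms(3)[OF that]
          times_differentiable_on_has_derivative[OF Suc.prems that]]
      by (rule has_derivative_eq_rhs) (simp add: field_simps)
    show "times_differentiable_on n U (\<lambda>x. frechet_derivative f (at x) v * (1/2 * inverse (sqrt (f x))))" for v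
      using Suc.prems assms(3)
      by (intro times_differentiable_on_bilinear[OF assms(1) bounded_bilinear_mult]
          times_differentiable_on_const times_differentiable_on_inverse[OF assms(1) s]) force+
  qed
qed

lemma smooth_on_intros:
  assumes "open U"
  shows "smooth_on U (\<lambda>x. c)"
    and "smooth_on U (\<lambda>x. x)"
    and "bounded_linear L \<Longrightarrow> smooth_on U f \<Longrightarrow> smooth_on U (\<lambda>x. L (f x))"
    and "smooth_on U f \<Longrightarrow> smooth_on U g \<Longrightarrow> smooth_on U (\<lambda>x. f x + g x)"
    and "bounded_bilinear B \<Longrightarrow> smooth_on U h \<Longrightarrow> smooth_on U k \<Longrightarrow> smooth_on U (\<lambda>x. B (h x) (k x))"
    and "smooth_on U s \<Longrightarrow> (\<And>x. x \<in> U \<Longrightarrow> s x \<noteq> 0) \<Longrightarrow> smooth_on U (\<lambda>x. inverse (s x) :: real)"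
    and "smooth_on U s \<Longrightarrow> (\<And>x. x \<in> U \<Longrightarrow> s x > 0) \<Longrightarrow> smooth_on U (\<lambda>x. sqrt (s x))"
  unfolding smooth_on_def
  by (auto simp del: times_differentiable_on.simps intro: times_differentiable_on_const times_differentiable_on_id[OF assms]
    times_differentiable_on_linear[OF assms] times_differentiable_on_add[OF assms]
    times_differentiable_on_bilinear[OF assms] times_differentiable_on_inverse[OF assms]
    times_differentiable_on_sqrt[OF assms])

lemma smooth_on_continuous_on: "smooth_on U f \<Longrightarrow> continuous_on U f"
  by (metis smooth_on_def times_differentiable_on.simps(1))

lemma smooth_on_has_derivative:
  "smooth_on U f \<Longrightarrow> x \<in> U \<Longrightarrow> (f has_derivative frechet_derivative f (at x)) (at x)"
  using times_differentiable_on_has_derivative[of 0 U f x] by (simp add: smooth_on_def del: times_differentiable_on.simps)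

lemma smooth_on_frechet_derivative:
  "smooth_on U f \<Longrightarrow> smooth_on U (\<lambda>x. frechet_derivative f (at x) v)"
  by (simp only: smooth_on_def) (metis times_differentiable_on.simps(2))


section \<open>Families of multilinear maps\<close>

lemma linear_euclidean_expansion:
  fixes f :: "'e::euclidean_space \<Rightarrow> 'b::real_vector"
  assumes "linear f"
  shows "f u = (\<Sum>b\<in>Basis. inner u b *\<^sub>R f b)"
  using linear_sum[OF assms, of "\<lambda>b. inner u b *\<^sub>R b" Basis]
  by (simp add: euclidean_representation linear_scale[OF assms])

text \<open>
  The product rule for \<open>f (z t) (u t)\<close> with \<open>f\<close> linear in the second argument.  Differentiability is only
  known for each fixed second argument; expanding \<open>u t\<close> in a basis reduces to that case.
\<close>

lemma linear_family_has_vector_derivative: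
  fixes f :: "'p::real_normed_vector \<Rightarrow> 'e::euclidean_space \<Rightarrow> 'b::real_normed_vector"
  assumes lin: "\<And>z. linear (f z)"
    and df: "\<And>u. ((\<lambda>z. f z u) has_derivative frechet_derivative (\<lambda>z. f z u) (at (z t0))) (at (z t0))"
    and z: "(z has_vector_derivative z') (at t0)" and u: "(u has_vector_derivative u') (at t0)"
  shows "((\<lambda>t. f (z t) (u t)) has_vector_derivative
    frechet_derivative (\<lambda>z. f z (u t0)) (at (z t0)) z' + f (z t0) u') (at t0)"
proof -
  define D where "D w = frechet_derivative (\<lambda>z. f z w) (at (z t0))" for w
  have zc: "((\<lambda>t. f (z t) w) has_vector_derivative D w z') (at t0)" for w
    using has_derivative_compose[OF z[unfolded has_vector_derivative_def] df[of w]]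
    unfolding has_vector_derivative_def D_def
    by (rule has_derivative_eq_rhs)
      (simp add: fun_eq_iff linear_scale[OF has_derivative_linear[OF df]])
  have uc: "((\<lambda>t. inner (u t) b) has_vector_derivative inner u' b) (at t0)" for b
    using u bounded_linear.has_vector_derivative bounded_linear_inner_left by blast
  have "((\<lambda>t. \<Sum>b\<in>Basis. inner (u t) b *\<^sub>R f (z t) b) has_vector_derivative
      (\<Sum>b\<in>Basis. inner (u t0) b *\<^sub>R D b z' + inner u' b *\<^sub>R f (z t0) b)) (at t0)"
    by (intro has_vector_derivative_sum has_vector_derivative_scaleR zc
        uc[folded has_real_derivative_iff_has_vector_derivative])
  moreover have "f (z t) (u t) = (\<Sum>b\<in>Basis. inner (u t) b *\<^sub>R f (z t) b)" for t
    using linear_euclidean_expansion[OF lin] .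
  moreover have "f (z t0) u' = (\<Sum>b\<in>Basis. inner u' b *\<^sub>R f (z t0) b)"
    using linear_euclidean_expansion[OF lin] .
  moreover have "D (u t0) z' = (\<Sum>b\<in>Basis. inner (u t0) b *\<^sub>R D b z')"
  proof (rule vector_derivative_unique_at[OF zc])
    show "((\<lambda>t. f (z t) (u t0)) has_vector_derivative (\<Sum>b\<in>Basis. inner (u t0) b *\<^sub>R D b z')) (at t0)"
      unfolding linear_euclidean_expansion[OF lin, of _ "u t0"]
      by (intro derivative_intros has_vector_derivative_sum bounded_linear.has_vector_derivative
          [OF bounded_linear_scaleR_right] zc)
  qed
  ultimately show ?thesis
    by (simp add: D_def sum.distrib)
qed

text \<open>
  The part of \<open>alternating_multilinear\<close> that limits need; it has to be shown for the curvature, too.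
\<close>

definition multilinear_on_lists :: "nat \<Rightarrow> ('p::real_vector list \<Rightarrow> 'b::real_vector) \<Rightarrow> bool" where
  "multilinear_on_lists k m \<longleftrightarrow>
     (\<forall>vs i. length vs = k \<longrightarrow> i < k \<longrightarrow> linear (\<lambda>u. m (vs[i := u])))"

text \<open>
  Pointwise convergence of multilinear maps on a finite-dimensional space is locally uniform, so the
  arguments may converge at the same time.  The arguments are made variable one after the other.
\<close>

lemma multilinear_tendsto:
  fixes f :: "'s \<Rightarrow> 'e::euclidean_space list \<Rightarrow> 'b::real_normed_vector"
    and P :: "'s \<Rightarrow> 'w \<Rightarrow> 'e"
  assumes lin: "\<forall>\<^sub>F s in F. multilinear_on_lists k (f s)" and lin0: "multilinear_on_lists k l"
    and f: "\<And>us. length us = k \<Longrightarrow> ((\<lambda>s. f s us) \<longlongrightarrow> l us) F"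
    and P: "\<And>w. w \<in> set ws \<Longrightarrow> ((\<lambda>s. P s w) \<longlongrightarrow> Q w) F" and "length ws = k"
  shows "((\<lambda>s. f s (map (P s) ws)) \<longlongrightarrow> l (map Q ws)) F"
proof -
  have "((\<lambda>s. f s (map (P s) (take j ws) @ drop j us)) \<longlongrightarrow> l (map Q (take j ws) @ drop j us)) F"
    if "j \<le> k" "length us = k" for j us
    using that
  proof (induction j arbitrary: us)
    case 0
    then show ?case by (simp add: f)
  next
    case (Suc j)
    have j: "j < k" "j < length ws" using Suc.prems \<open>length ws = k\<close> by auto
    \<comment> \<open>Only the argument in position \<open>j\<close> changes; it is expanded in a basis.\<close>
    have e: "map R (take (Suc j) ws) @ drop (Suc j) us
        = (map R (take j ws) @ drop j us)[j := R (ws ! j)]" for R :: "'w \<Rightarrow> 'e"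
      using j Suc.prems by (simp add: take_Suc_conv_app_nth list_update_append Cons_nth_drop_Suc[symmetric])
    have e': "(map R (take j ws) @ drop j us)[j := b] = map R (take j ws) @ drop j (us[j := b])"
      for R :: "'w \<Rightarrow> 'e" and b
      using j Suc.prems by (simp add: list_update_append drop_update_swap)
    have x: "m (map R (take (Suc j) ws) @ drop (Suc j) us) =
        (\<Sum>b\<in>Basis. inner (R (ws ! j)) b *\<^sub>R m (map R (take j ws) @ drop j (us[j := b])))"
      if "multilinear_on_lists k m" for m :: "'e list \<Rightarrow> 'b" and R
    proof -
      have "linear (\<lambda>u. m ((map R (take j ws) @ drop j us)[j := u]))"
        using that j Suc.prems \<open>length ws = k\<close> by (auto simp: multilinear_on_lists_def)
      then show ?thesis
        using linear_euclidean_expansion[of "\<lambda>u. m ((map R (take j ws) @ drop j us)[j := u])" "R (ws ! j)"]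
        unfolding e by (simp add: e')
    qed
    have "((\<lambda>s. \<Sum>b\<in>Basis. inner (P s (ws ! j)) b *\<^sub>R f s (map (P s) (take j ws) @ drop j (us[j := b])))
        \<longlongrightarrow> (\<Sum>b\<in>Basis. inner (Q (ws ! j)) b *\<^sub>R l (map Q (take j ws) @ drop j (us[j := b])))) F"
      using j Suc.prems by (intro tendsto_intros P Suc.IH) auto
    moreover have "\<forall>\<^sub>F s in F. (\<Sum>b\<in>Basis. inner (P s (ws ! j)) b *\<^sub>R
          f s (map (P s) (take j ws) @ drop j (us[j := b])))
        = f s (map (P s) (take (Suc j) ws) @ drop (Suc j) us)"
      using lin by eventually_elim (simp only: x)
    ultimately show ?case
      unfolding x[OF lin0] using Lim_transform_eventually by fastforce
  qed
  from this[of k "map Q ws"] show ?thesis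
    using \<open>length ws = k\<close> by simp
qed

section \<open>The wedge product\<close>

text \<open>
  A shuffle sends the first vector either to \<open>\<alpha>\<close>, without inversions, or to \<open>\<beta>\<close>, and then it forms an
  inversion with each of the \<open>p + 1\<close> arguments of \<open>\<alpha>\<close>.  This recursion evaluates wedge products of
  small degree as polynomials in the values of the factors.
\<close>

lemma wedge_Cons:
  fixes \<alpha> :: "('p, 'b::real_vector) form" and \<beta> :: "('p, real) form"
  shows "wedge (Suc p) (Suc q) \<alpha> \<beta> x (v # vs) =
    wedge p (Suc q) (\<lambda>x us. \<alpha> x (v # us)) \<beta> x vs +
    (- 1) ^ Suc p *\<^sub>R wedge (Suc p) q \<alpha> (\<lambda>x us. \<beta> x (v # us)) x vs"
proof -
  define n where "n = Suc (p + q)"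
  define inv where "inv m S = {(i, j). i \<in> S \<and> j \<in> {..<m} - S \<and> j < i}" for m and S :: "nat set"
  define Sh where "Sh m k = {S. S \<subseteq> {..<m} \<and> card S = k}" for m k :: nat
  define t where "t m S vs = ((- 1) ^ card (inv m S) * \<beta> x (nths vs (- S))) *\<^sub>R \<alpha> x (nths vs S)" for m S vs
  have fin: "finite (Sh m k)" for m k
    unfolding Sh_def by (rule finite_subset[of _ "Pow {..<m}"]) auto
  have w: "wedge (Suc p) (Suc q) \<alpha> \<beta> x (v # vs) = (\<Sum>S\<in>Sh (Suc n) (Suc p). t (Suc n) S (v # vs))"
    unfolding wedge_def Sh_def t_def inv_def n_def by simp
  have split: "Sh (Suc n) (Suc p) = (\<lambda>S. insert 0 (Suc ` S)) ` Sh n p \<union> (`) Suc ` Sh n (Suc p)"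
  proof (intro subset_antisym subsetI)
    fix S assume S: "S \<in> Sh (Suc n) (Suc p)"
    define S' where "S' = {i. Suc i \<in> S}"
    have "finite S" using S by (auto simp: Sh_def intro: finite_subset)
    have eq: "S = (if 0 \<in> S then insert 0 (Suc ` S') else Suc ` S')"
    proof (rule set_eqI)
      fix i show "i \<in> S \<longleftrightarrow> i \<in> (if 0 \<in> S then insert 0 (Suc ` S') else Suc ` S')"
        by (cases i) (auto simp: S'_def)
    qed
    have sub: "S' \<subseteq> {..<n}" using S by (auto simp: Sh_def S'_def)
    then have "finite S'" by (rule finite_subset) simp
    then have "card S = (if 0 \<in> S then Suc (card S') else card S')"
      by (subst eq) (auto simp: card_image card_insert_if)
    then have "if 0 \<in> S then S' \<in> Sh n p else S' \<in> Sh n (Suc p)"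
      using S sub by (auto simp: Sh_def)
    then show "S \<in> (\<lambda>S. insert 0 (Suc ` S)) ` Sh n p \<union> (`) Suc ` Sh n (Suc p)"
      using eq by (auto split: if_splits)
  next
    fix S assume "S \<in> (\<lambda>S. insert 0 (Suc ` S)) ` Sh n p \<union> (`) Suc ` Sh n (Suc p)"
    then show "S \<in> Sh (Suc n) (Suc p)"
    proof (elim UnE imageE)
      fix R assume "S = insert 0 (Suc ` R)" "R \<in> Sh n p"
      moreover from this have "finite R" by (auto simp: Sh_def intro: finite_subset)
      ultimately show ?thesis by (auto simp: Sh_def card_image card_insert_if)
    qed (auto simp: Sh_def card_image)
  qed
  have inj: "inj_on (map_prod Suc Suc) R" for R
    by (auto simp: inj_on_def)
  have inj2: "inj_on (\<lambda>S. insert 0 (Suc ` S)) (Sh n p)" "inj_on ((`) Suc) (Sh n (Suc p))"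
    by (auto simp: inj_on_def)
  have disj: "(\<lambda>S. insert 0 (Suc ` S)) ` Sh n p \<inter> (`) Suc ` Sh n (Suc p) = {}"
    by auto
  have t1: "t (Suc n) (insert 0 (Suc ` S)) (v # vs) =
      ((- 1) ^ card (inv n S) * \<beta> x (nths vs (- S))) *\<^sub>R \<alpha> x (v # nths vs S)" for S
  proof -
    have "inv (Suc n) (insert 0 (Suc ` S)) = map_prod Suc Suc ` inv n S"
      by (auto simp: inv_def image_iff gr0_conv_Suc)
    then have "card (inv (Suc n) (insert 0 (Suc ` S))) = card (inv n S)"
      by (simp add: card_image inj)
    moreover have "{j. Suc j \<in> insert 0 (Suc ` S)} = S" "{j. Suc j \<notin> insert 0 (Suc ` S)} = - S"
      by auto
    ultimately show ?thesis
      by (simp add: t_def nths_Cons)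
  qed
  have t2: "t (Suc n) (Suc ` S) (v # vs) =
      ((- 1) ^ Suc p * ((- 1) ^ card (inv n S) * \<beta> x (v # nths vs (- S)))) *\<^sub>R \<alpha> x (nths vs S)"
    if "S \<in> Sh n (Suc p)" for S
  proof -
    have "finite S" "card S = Suc p"
      using that by (auto simp: Sh_def intro: finite_subset)
    have "finite (inv n S)"
      unfolding inv_def by (rule finite_subset[of _ "S \<times> {..<n}"]) (auto simp: \<open>finite S\<close>)
    have "inv (Suc n) (Suc ` S) = map_prod Suc Suc ` inv n S \<union> (\<lambda>i. (Suc i, 0)) ` S"
    proof (rule set_eqI, clarify)
      fix i j show "(i, j) \<in> inv (Suc n) (Suc ` S) \<longleftrightarrow>
          (i, j) \<in> map_prod Suc Suc ` inv n S \<union> (\<lambda>i. (Suc i, 0)) ` S"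
        by (cases i; cases j) (auto simp: inv_def image_iff)
    qed
    moreover have "card (map_prod Suc Suc ` inv n S \<union> (\<lambda>i. (Suc i, 0)) ` S) = card (inv n S) + card S"
      using \<open>finite S\<close> \<open>finite (inv n S)\<close>
      by (subst card_Un_disjoint)
        (auto simp: card_image inj inj_on_def[of "\<lambda>i. (Suc i, 0)"])
    ultimately have "card (inv (Suc n) (Suc ` S)) = card (inv n S) + Suc p"
      using \<open>card S = Suc p\<close> by simp
    moreover have "{j. Suc j \<in> Suc ` S} = S" "{j. Suc j \<notin> Suc ` S} = - S"
      by auto
    ultimately show ?thesis
      by (simp add: t_def nths_Cons power_add mult_ac)
  qed
  have n: "n = p + Suc q" "n = Suc p + q" by (auto simp: n_def)
  have "(\<Sum>S\<in>Sh (Suc n) (Suc p). t (Suc n) S (v # vs)) =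
      (\<Sum>S\<in>Sh n p. t (Suc n) (insert 0 (Suc ` S)) (v # vs)) +
      (\<Sum>S\<in>Sh n (Suc p). t (Suc n) (Suc ` S) (v # vs))"
    unfolding split by (simp add: sum.union_disjoint fin disj sum.reindex[OF inj2(1)] sum.reindex[OF inj2(2)])
  also have "(\<Sum>S\<in>Sh n p. t (Suc n) (insert 0 (Suc ` S)) (v # vs)) =
      wedge p (Suc q) (\<lambda>x us. \<alpha> x (v # us)) \<beta> x vs"
    unfolding wedge_def n(1)[symmetric] by (rule sum.cong) (simp_all add: t1 Sh_def inv_def)
  also have "(\<Sum>S\<in>Sh n (Suc p). t (Suc n) (Suc ` S) (v # vs)) =
      (- 1) ^ Suc p *\<^sub>R wedge (Suc p) q \<alpha> (\<lambda>x us. \<beta> x (v # us)) x vs"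
    unfolding wedge_def scaleR_sum_right n(2)[symmetric]
    by (rule sum.cong) (simp_all add: t2 Sh_def inv_def)
  finally show ?thesis
    using w by simp
qed

lemma wedge_0_left:
  assumes "length vs = q"
  shows "wedge 0 q \<alpha> \<beta> x vs = \<beta> x vs *\<^sub>R \<alpha> x []"
proof -
  have "{S. S \<subseteq> {..<q} \<and> card S = 0} = {{}}"
    by (auto simp: card_eq_0_iff dest: finite_subset)
  then show ?thesis
    by (simp add: wedge_def nths_all)
qed

lemma wedge_0_right:
  assumes "length vs = p"
  shows "wedge p 0 \<alpha> \<beta> x vs = \<beta> x [] *\<^sub>R \<alpha> x vs"
proof -
  have "{S. S \<subseteq> {..<p} \<and> card S = p} = {{..<p}}"
    by (auto dest: card_subset_eq[OF finite_lessThan])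
  moreover have "{i. i < p \<and> i \<in> - {..<p}} = {}"
    by auto
  then have "nths vs (- {..<p}) = []" "nths vs {..<p} = vs"
    using assms nths_all[of vs "{..<p}"] length_nths[of vs "- {..<p}"]
    by (simp_all only: card.empty length_0_conv lessThan_iff simp_thms)
  ultimately show ?thesis
    by (simp add: wedge_def)
qed

lemma length_nths_shuffle:
  assumes "length vs = p + q" "S \<subseteq> {..<p + q}" "card S = p"
  shows "length (nths vs S) = p" "length (nths vs (- S)) = q"
proof -
  have "{i. i < p + q \<and> i \<in> S} = S" "{i. i < p + q \<and> i \<in> - S} = {..<p + q} - S"
    using assms(2) by auto
  moreover have "card ({..<p + q} - S) = q"
    using assms(2,3) by (simp add: card_Diff_subset finite_subset)
  ultimately show "length (nths vs S) = p" "length (nths vs (- S)) = q"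
    using assms by (simp_all add: length_nths)
qed

lemma wedge_cong:
  assumes "length vs = p + q"
    and "\<And>us. length us = p \<Longrightarrow> set us \<subseteq> set vs \<Longrightarrow> \<alpha> x us = \<alpha>' x us"
    and "\<And>us. length us = q \<Longrightarrow> set us \<subseteq> set vs \<Longrightarrow> \<beta> x us = \<beta>' x us"
  shows "wedge p q \<alpha> \<beta> x vs = wedge p q \<alpha>' \<beta>' x vs"
proof -
  have "\<alpha> x (nths vs S) = \<alpha>' x (nths vs S)" "\<beta> x (nths vs (- S)) = \<beta>' x (nths vs (- S))"
    if S: "S \<subseteq> {..<p + q}" "card S = p" for S
    using assms(2)[of "nths vs S"] assms(3)[of "nths vs (- S)"] length_nths_shuffle[OF assms(1) S]
    by (simp_all add: set_nths_subset)
  then show ?thesis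
    unfolding wedge_def by (intro sum.cong refl) (elim CollectE conjE, simp only:)
qed

lemma wedge_linear:
  shows "wedge p q (\<lambda>x vs. \<alpha> x vs + \<alpha>' x vs) \<beta> x vs = wedge p q \<alpha> \<beta> x vs + wedge p q \<alpha>' \<beta> x vs"
    and "wedge p q (\<lambda>x vs. \<alpha> x vs - \<alpha>' x vs) \<beta> x vs = wedge p q \<alpha> \<beta> x vs - wedge p q \<alpha>' \<beta> x vs"
    and "wedge p q (\<lambda>x vs. c x *\<^sub>R \<alpha> x vs) \<beta> x vs = c x *\<^sub>R wedge p q \<alpha> \<beta> x vs"
    and "wedge p q (\<lambda>x vs. f x vs *\<^sub>R T) \<beta> x vs = wedge p q f \<beta> x vs *\<^sub>R T"
    and "wedge p q \<alpha> (\<lambda>x vs. \<beta> x vs + \<beta>' x vs) x vs = wedge p q \<alpha> \<beta> x vs + wedge p q \<alpha> \<beta>' x vs"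
    and "wedge p q \<alpha> (\<lambda>x vs. \<beta> x vs - \<beta>' x vs) x vs = wedge p q \<alpha> \<beta> x vs - wedge p q \<alpha> \<beta>' x vs"
    and "wedge p q \<alpha> (\<lambda>x vs. c x * \<beta> x vs) x vs = c x *\<^sub>R wedge p q \<alpha> \<beta> x vs"
  by (simp_all add: wedge_def scaleR_sum_left scaleR_sum_right sum.distrib sum_subtractf
      algebra_simps)

lemma wedge_scale_left: "wedge p q (\<lambda>x vs. c x * \<alpha> x vs) \<beta> x vs = c x * wedge p q \<alpha> \<beta> x vs"
  for \<alpha> :: "('p, real) form"
  using wedge_linear(3)[of p q c \<alpha>] by simp

lemma wedge_linear_map:
  assumes "linear L"
  shows "wedge p q (\<lambda>x vs. L (\<alpha> x vs)) \<beta> x vs = L (wedge p q \<alpha> \<beta> x vs)"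
  unfolding wedge_def by (simp add: linear_sum[OF assms] linear_scale[OF assms])

lemmas wedge_eval = wedge_Cons wedge_0_left wedge_0_right numeral_eq_Suc

lemma wedge_1_1: "wedge 1 1 \<alpha> \<beta> x [a, b] = \<beta> x [b] *\<^sub>R \<alpha> x [a] - \<beta> x [a] *\<^sub>R \<alpha> x [b]"
  by (simp add: wedge_eval)

lemma length_eq_numeral:
  "length vs = 2 \<Longrightarrow> \<exists>a b. vs = [a, b]" "length vs = 3 \<Longrightarrow> \<exists>a b c. vs = [a, b, c]"
  "length vs = 4 \<Longrightarrow> \<exists>a b c d. vs = [a, b, c, d]"
  "length vs = 5 \<Longrightarrow> \<exists>a b c d e. vs = [a, b, c, d, e]"
  "length vs = 6 \<Longrightarrow> \<exists>a b c d e f. vs = [a, b, c, d, e, f]"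
  by (auto simp: numeral_eq_Suc length_Suc_conv)


text \<open>
  The identities from here to \<open>wedge_2_2_commute\<close> are instances of associativity and graded commutativity
  of the wedge product.  In these degrees both sides are small enough to be compared as polynomials.
\<close>

lemma wedge_2_2_common_factor:
  fixes \<alpha> \<beta> \<gamma> :: "('p, real) form"
  assumes "length vs = 4"
  shows "wedge 2 2 (wedge 1 1 \<alpha> \<beta>) (wedge 1 1 \<alpha> \<gamma>) x vs = 0"
    "wedge 2 2 (wedge 1 1 \<alpha> \<beta>) (wedge 1 1 \<gamma> \<alpha>) x vs = 0"
    "wedge 2 2 (wedge 1 1 \<beta> \<alpha>) (wedge 1 1 \<alpha> \<gamma>) x vs = 0"
    "wedge 2 2 (wedge 1 1 \<beta> \<alpha>) (wedge 1 1 \<gamma> \<alpha>) x vs = 0"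
  using length_eq_numeral(3)[OF assms] by (auto simp: wedge_eval algebra_simps)

lemma wedge_2_3_common_factor:
  fixes \<alpha> \<beta> \<gamma> \<delta> :: "('p, real) form"
  assumes "length vs = 5"
  shows "wedge 2 3 (wedge 1 1 \<alpha> \<beta>) (wedge 1 2 \<alpha> (wedge 1 1 \<gamma> \<delta>)) x vs = 0"
    "wedge 2 3 (wedge 1 1 \<alpha> \<beta>) (wedge 1 2 \<gamma> (wedge 1 1 \<alpha> \<delta>)) x vs = 0"
    "wedge 2 3 (wedge 1 1 \<alpha> \<beta>) (wedge 1 2 \<gamma> (wedge 1 1 \<delta> \<alpha>)) x vs = 0"
    "wedge 2 3 (wedge 1 1 \<beta> \<alpha>) (wedge 1 2 \<gamma> (wedge 1 1 \<alpha> \<delta>)) x vs = 0"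
    "wedge 2 3 (wedge 1 1 \<beta> \<alpha>) (wedge 1 2 \<gamma> (wedge 1 1 \<delta> \<alpha>)) x vs = 0"
  using length_eq_numeral(4)[OF assms] by (auto simp: wedge_eval algebra_simps)

lemma wedge_2_3_exchange:
  fixes F G \<alpha> :: "('p, real) form"
  assumes "length vs = 5"
  shows "wedge 2 3 F (wedge 1 2 \<alpha> G) x vs = wedge 2 3 G (wedge 1 2 \<alpha> F) x vs"
  using length_eq_numeral(4)[OF assms] by (auto simp: wedge_eval algebra_simps)

lemma wedge_2_3_permute:
  fixes \<alpha> \<beta> \<gamma> \<delta> \<eta> :: "('p, real) form"
  assumes "length vs = 5"
  shows "wedge 2 3 (wedge 1 1 \<alpha> \<beta>) (wedge 1 2 \<gamma> (wedge 1 1 \<delta> \<eta>)) x vs =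
      - wedge 2 3 (wedge 1 1 \<gamma> \<eta>) (wedge 1 2 \<alpha> (wedge 1 1 \<beta> \<delta>)) x vs"
    "wedge 2 3 (wedge 1 1 \<alpha> \<beta>) (wedge 1 2 \<gamma> (wedge 1 1 \<delta> \<eta>)) x vs =
      wedge 2 3 (wedge 1 1 \<gamma> \<eta>) (wedge 1 2 \<alpha> (wedge 1 1 \<delta> \<beta>)) x vs"
  using length_eq_numeral(4)[OF assms] by (auto simp: wedge_eval algebra_simps)

lemma wedge_2_4_rotate:
  fixes F G H :: "('p, real) form"
  assumes "length vs = 6"
  shows "wedge 2 4 F (wedge 2 2 G H) x vs = wedge 2 4 H (wedge 2 2 F G) x vs"
  using length_eq_numeral(5)[OF assms] by (auto simp: wedge_eval algebra_simps)

lemma wedge_2_2_commute: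
  fixes F G :: "('p, real) form"
  assumes "length vs = 4"
  shows "wedge 2 2 F G x vs = wedge 2 2 G F x vs"
  using length_eq_numeral(3)[OF assms] by (auto simp: wedge_eval algebra_simps)

text \<open>
  The product \<open>F \<and> G \<and> H\<close> vanishes as soon as two of the three 2-forms have product zero, because
  2-forms may be permuted.
\<close>

lemma wedge_2_4_zero:
  fixes F G H :: "('p, real) form"
  assumes "length vs = 6"
    and "(\<forall>us. length us = 4 \<longrightarrow> wedge 2 2 G H x us = 0) \<or> (\<forall>us. length us = 4 \<longrightarrow> wedge 2 2 F G x us = 0)
      \<or> (\<forall>us. length us = 4 \<longrightarrow> wedge 2 2 F H x us = 0)"
  shows "wedge 2 4 F (wedge 2 2 G H) x vs = 0"
proof -
  have z: "wedge 2 4 F' \<beta> x vs = 0" if "\<forall>us. length us = 4 \<longrightarrow> \<beta> x us = 0"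
    for F' \<beta> :: "('p, real) form"
  proof -
    have "wedge 2 4 F' \<beta> x vs = wedge 2 4 F' (\<lambda>x us. 0) x vs"
      by (rule wedge_cong) (use assms(1) that in auto)
    then show ?thesis by (simp add: wedge_def)
  qed
  have "wedge 2 4 F (wedge 2 2 G H) x vs = wedge 2 4 G (wedge 2 2 H F) x vs"
    using wedge_2_4_rotate[OF assms(1)] by metis
  then show ?thesis
    using assms(2) z[of "wedge 2 2 G H" F] z[of "wedge 2 2 F G" H] z[of "wedge 2 2 H F" G]
      wedge_2_4_rotate[OF assms(1), of F G H x] wedge_2_2_commute[of _ H F x]
    by metis
qed


section \<open>Products of the curvature with the Calabi-Yau forms\<close>

lemma F_cyl_alt: "F_cyl \<epsilon> T1 T2 T3 = (\<lambda>x vs.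
    (- 1 / 2 * theta2 2 3 x vs - (Rminus \<epsilon> (fst x))\<^sup>2 / (Rplus \<epsilon> (fst x))\<^sup>2 / 2 * theta2 4 5 x vs) *\<^sub>R T1 +
    (\<epsilon> / (2 * Rplus \<epsilon> (fst x)) * theta2 1 2 x vs
      - \<epsilon> / 4 * (fst x / (Rplus \<epsilon> (fst x)) ^ 3) * wedge 1 1 dr (theta 4) x vs) *\<^sub>R T2 +
    (\<epsilon> / (2 * Rplus \<epsilon> (fst x)) * theta2 1 3 x vs
      - \<epsilon> / 4 * (fst x / (Rplus \<epsilon> (fst x)) ^ 3) * wedge 1 1 dr (theta 5) x vs) *\<^sub>R T3)"
  by (simp add: F_cyl_def Let_def fun_eq_iff algebra_simps)

lemma Omega1_cyl_alt: "Omega1_cyl \<epsilon> = (\<lambda>x vs.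
    (Rminus \<epsilon> (fst x))\<^sup>2 * theta3 1 4 5 x vs - (Rplus \<epsilon> (fst x))\<^sup>2 * theta3 1 2 3 x vs
    - fst x / 2 * wedge 1 2 dr (theta2 2 5) x vs + fst x / 2 * wedge 1 2 dr (theta2 3 4) x vs)"
  by (simp add: Omega1_cyl_def Let_def fun_eq_iff algebra_simps)

lemma omega_cyl_alt: "omega_cyl \<epsilon> = (\<lambda>x vs. deriv (G_fun \<epsilon>) (fst x) * wedge 1 1 dr (theta 1) x vs
    + G_fun \<epsilon> (fst x) * theta2 2 4 x vs + G_fun \<epsilon> (fst x) * theta2 3 5 x vs)"
  by (simp add: omega_cyl_def Let_def fun_eq_iff algebra_simps)

text \<open>
  Most products of a monomial of the curvature with one of \<open>\<Omega>\<^sub>1\<close> have a repeated factor.  In the component of \<open>T\<^sub>1\<close>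
  the remaining two, both multiples of \<open>\<theta>\<^sup>1\<^sup>2\<^sup>3\<^sup>4\<^sup>5\<close>, cancel because the coefficients of
  \<open>\<theta>\<^sup>2\<^sup>3\<close>, \<open>\<theta>\<^sup>4\<^sup>5\<close> and those of \<open>\<theta>\<^sup>1\<^sup>2\<^sup>3\<close>, \<open>\<theta>\<^sup>1\<^sup>4\<^sup>5\<close> have opposite ratios.  In the other two components a term from
  \<open>dr \<and> \<theta>\<^sup>4\<close> or \<open>dr \<and> \<theta>\<^sup>5\<close>, that is, from the derivative of \<open>\<epsilon> / R\<^sub>+\<close>, cancels one from \<open>\<theta>\<^sup>1\<^sup>2\<close> or \<open>\<theta>\<^sup>1\<^sup>3\<close>.
\<close>

lemma F_cyl_wedge_Omega1:
  assumes "length vs = 5" "Rplus \<epsilon> (fst x) \<noteq> 0"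
  shows "wedge 2 3 (F_cyl \<epsilon> T1 T2 T3) (Omega1_cyl \<epsilon>) x vs = 0"
proof -
  note zero = wedge_2_3_common_factor[OF assms(1)]
  have 1: "wedge 2 3 (theta2 4 5) (theta3 1 2 3) x vs = wedge 2 3 (theta2 2 3) (theta3 1 4 5) x vs"
    unfolding theta3_def using wedge_2_3_exchange[OF assms(1)] .
  have 2: "wedge 2 3 (wedge 1 1 dr (theta 4)) (theta3 1 2 3) x vs =
      - wedge 2 3 (theta2 1 2) (wedge 1 2 dr (theta2 3 4)) x vs"
    unfolding theta3_def theta2_def wedge_2_3_permute(1)[OF assms(1), of "theta 1"] by simp
  have 3: "wedge 2 3 (wedge 1 1 dr (theta 5)) (theta3 1 2 3) x vs =
      wedge 2 3 (theta2 1 3) (wedge 1 2 dr (theta2 2 5)) x vs"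
    unfolding theta3_def theta2_def wedge_2_3_permute(2)[OF assms(1), of "theta 1"] by simp
  show ?thesis
    unfolding F_cyl_alt Omega1_cyl_alt
    by (simp only: wedge_linear wedge_scale_left real_scaleR_def 1 2 3)
      (simp only: theta3_def theta2_def zero,
        simp add: field_simps power2_eq_square power3_eq_cube assms(2))
qed

text \<open>
  Every monomial of the curvature has a factor in common with two of the three monomials \<open>dr \<and> \<theta>\<^sup>1\<close>,
  \<open>\<theta>\<^sup>2\<^sup>4\<close>, \<open>\<theta>\<^sup>3\<^sup>5\<close> of \<open>\<omega>\<close>, and the third one squares to zero.  So no term survives, whatever the
  coefficients of \<open>\<omega>\<close> are.
\<close>

lemma F_cyl_wedge_omega_omega:
  assumes "length vs = 6"
  shows "wedge 2 4 (F_cyl \<epsilon> T1 T2 T3) (\<lambda>x vs. wedge 2 2 (omega_cyl \<epsilon>) (omega_cyl \<epsilon>) x vs / 2) x vs = 0"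
proof -
  have half: "(\<lambda>x vs. wedge 2 2 \<omega> \<omega> x vs / 2) = (\<lambda>x vs. 1 / 2 * wedge 2 2 \<omega> \<omega> x vs)"
    for \<omega> :: "(cyl, real) form" by simp
  note zero = wedge_2_4_zero[OF assms] wedge_2_2_common_factor
  show ?thesis
    unfolding half F_cyl_alt omega_cyl_alt
    by (simp only: wedge_linear wedge_scale_left real_scaleR_def)
      (simp add: theta2_def zero del: One_nat_def)
qed

section \<open>The connection on the quadric\<close>

text \<open>
  The potential in quaternionic terms: \<open>X\<close>, \<open>Y\<close> are the real and imaginary parts of the point, \<open>X'\<close>, \<open>Y'\<close>
  those of the tangent vector, and \<open>R\<close> is the norm of the vector \<open>x\<close>, that is, \<open>R\<^sub>+\<close>.  With \<open>U = X / R\<close>, the first term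
  is half of \<open>U\<^sup>-\<^sup>1 dU\<close>.  The other two are the correction by \<open>(\<epsilon> / R - 1) / 2\<close> times the part of
  \<open>\<alpha> + \<beta>\<close> orthogonal to the direction of \<open>U\<^sup>-\<^sup>1 Y\<close>, with the denominators \<open>R\<^sub>-\<close> cancelled: the second term yields that part
  and a multiple of \<open>U\<^sup>-\<^sup>1 Y\<close>, which the third one removes.
\<close>

definition conn_formula :: "real \<Rightarrow> real \<Rightarrow> mat2 \<Rightarrow> mat2 \<Rightarrow> mat2 \<Rightarrow> mat2 \<Rightarrow> mat2" where
  "conn_formula \<epsilon> R X Y X' Y' =
     (inverse (2 * R\<^sup>2)) *\<^sub>R skew (cadj X ** X') +
     (inverse (2 * R * (R + \<epsilon>))) *\<^sub>R skew (cadj Y ** Y') -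
     (inverse (2 * R ^ 3 * (R + \<epsilon>)) * (inner X' Y / 2)) *\<^sub>R skew (cadj X ** Y)"

text \<open>
  On the quadric \<open>|x| = R\<^sub>+(|z|)\<close>.  The right-hand side is used everywhere, as it is smooth and positive on all of \<open>\<complex>\<^sup>4\<close>.
\<close>

definition potential :: "real \<Rightarrow> complex^4 \<Rightarrow> complex^4 \<Rightarrow> mat2" where
  "potential \<epsilon> z u =
     conn_formula \<epsilon> (Rplus \<epsilon> (norm z)) (quat_Re z) (quat_Im z) (quat_Re u) (quat_Im u)"

text \<open>
  The potential above belongs to one particular choice of \<open>T\<^sub>2\<close> and \<open>T\<^sub>3\<close>; conjugation by \<open>c\<close> adapts it to the others.
\<close>

definition gauge_potential :: "real \<Rightarrow> mat2 \<Rightarrow> (complex^4, mat2) form" where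
  "gauge_potential \<epsilon> c z vs = c ** potential \<epsilon> z (hd vs) ** cadj c"

lemma cadj_conj_mult:
  assumes "p \<in> SU2"
  shows "cadj (p ** X ** cadj q) ** (p ** Y ** cadj q) = q ** (cadj X ** Y) ** cadj q"
  by (simp add: cadj_mult cadj_simps matrix_ring SU2_cancel[OF assms])

text \<open>
  Equivariance: the left factor \<open>p\<close> disappears and the right factor acts by conjugation.  It reduces the
  identification of the potential to \<open>p = q = 1\<close>.
\<close>

lemma conn_formula_conj:
  assumes "p \<in> SU2" "q \<in> SU2"
  shows "conn_formula \<epsilon> R (p ** X ** cadj q) (p ** Y ** cadj q) (p ** X' ** cadj q) (p ** Y' ** cadj q)
    = q ** conn_formula \<epsilon> R X Y X' Y' ** cadj q"
  unfolding conn_formula_def cadj_conj_mult[OF assms(1)] skew_conj inner_SU2_conj[OF assms]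
  by (simp only: matrix_ring)

lemma linear_potential: "linear (potential \<epsilon> z)"
  by (rule bounded_linear.linear)
    (simp add: potential_def[abs_def] conn_formula_def linear_iff re_im_linear matrix_ring
        linear_add[OF bounded_linear.linear[OF bounded_linear_skew]]
        linear_scale[OF bounded_linear.linear[OF bounded_linear_skew]]
        inner_add_left algebra_simps add_divide_distrib linear_conv_bounded_linear[symmetric])

lemma potential_su2: "potential \<epsilon> z u \<in> su2"
  unfolding potential_def conn_formula_def
  by (intro su2_lin su2_minus skew_su2 quat_simps quat_re_im)

lemma Rplus_norm: "Rplus \<epsilon> (norm z) = sqrt ((inner z z + \<epsilon>\<^sup>2) / 2)"
  by (simp add: Rplus_def power2_norm_eq_inner)

lemma Rplus_pos: "\<epsilon> > 0 \<Longrightarrow> Rplus \<epsilon> r > 0"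
  unfolding Rplus_def by (simp add: add_nonneg_pos)

lemma Rminus_pos: "\<epsilon> > 0 \<Longrightarrow> r > \<epsilon> \<Longrightarrow> Rminus \<epsilon> r > 0"
  unfolding Rminus_def by (simp add: power_strict_mono)

lemma R_squares:
  assumes "\<epsilon> > 0" "r \<ge> \<epsilon>"
  shows "(Rplus \<epsilon> r)\<^sup>2 = (r\<^sup>2 + \<epsilon>\<^sup>2) / 2" "(Rminus \<epsilon> r)\<^sup>2 = (r\<^sup>2 - \<epsilon>\<^sup>2) / 2"
    "(Rplus \<epsilon> r)\<^sup>2 + (Rminus \<epsilon> r)\<^sup>2 = r\<^sup>2" "(Rplus \<epsilon> r)\<^sup>2 - (Rminus \<epsilon> r)\<^sup>2 = \<epsilon>\<^sup>2"
proof -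
  have "r\<^sup>2 \<ge> \<epsilon>\<^sup>2" using assms by (simp add: power_mono)
  then show "(Rplus \<epsilon> r)\<^sup>2 = (r\<^sup>2 + \<epsilon>\<^sup>2) / 2" "(Rminus \<epsilon> r)\<^sup>2 = (r\<^sup>2 - \<epsilon>\<^sup>2) / 2"
    by (simp_all add: Rplus_def Rminus_def)
  then show "(Rplus \<epsilon> r)\<^sup>2 + (Rminus \<epsilon> r)\<^sup>2 = r\<^sup>2" "(Rplus \<epsilon> r)\<^sup>2 - (Rminus \<epsilon> r)\<^sup>2 = \<epsilon>\<^sup>2"
    by (simp_all add: field_simps)
qed

lemma smooth_potential:
  assumes "\<epsilon> > 0"
  shows "smooth_on UNIV (\<lambda>z. potential \<epsilon> z u)"
proof -
  note lin = smooth_on_intros(3)[OF open_UNIV]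
  note add = smooth_on_intros(4)[OF open_UNIV]
  note mult = smooth_on_intros(5)[OF open_UNIV bounded_bilinear_mult]
  note scale = smooth_on_intros(5)[OF open_UNIV bounded_bilinear_scaleR]
  note mat = smooth_on_intros(5)[OF open_UNIV matrix_mult.bounded_bilinear_axioms]
  have id: "smooth_on UNIV (\<lambda>z :: complex^4. z)" by (rule smooth_on_intros) simp
  have const: "smooth_on UNIV (\<lambda>z :: complex^4. b)" for b :: "'z::real_normed_vector"
    by (rule smooth_on_intros) simp
  have R: "smooth_on UNIV (\<lambda>z :: complex^4. Rplus \<epsilon> (norm z))"
    unfolding Rplus_norm
  proof (rule smooth_on_intros(7)[OF open_UNIV])
    show "smooth_on UNIV (\<lambda>z :: complex^4. (inner z z + \<epsilon>\<^sup>2) / 2)"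
      unfolding divide_inverse
      by (intro mult add const smooth_on_intros(5)[OF open_UNIV bounded_bilinear_inner] id)
    show "(inner z z + \<epsilon>\<^sup>2) / 2 > 0" for z :: "complex^4"
      using assms by (simp add: add_nonneg_pos)
  qed
  have inv: "smooth_on UNIV (\<lambda>z :: complex^4. inverse (f z))"
    if "smooth_on UNIV f" "\<And>z. f z > 0" for f :: "complex^4 \<Rightarrow> real"
    by (rule smooth_on_intros(6)[OF open_UNIV that(1)]) (metis that(2) less_irrefl)
  have Rp: "Rplus \<epsilon> (norm z) > 0" for z :: "complex^4"
    using Rplus_pos[OF assms] .
  have X: "smooth_on UNIV quat_Re" "smooth_on UNIV quat_Im"
    using lin[OF bounded_linear_re_im(1) id] lin[OF bounded_linear_re_im(2) id] by auto
  have sk: "smooth_on UNIV (\<lambda>z. skew (cadj (f z) ** g z))" if "smooth_on UNIV f" "smooth_on UNIV g"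
    for f g :: "complex^4 \<Rightarrow> mat2"
    by (intro lin[OF bounded_linear_skew] mat lin[OF bounded_linear_cadj] that)
  have sub: "smooth_on UNIV (\<lambda>z. f z - g z)" if "smooth_on UNIV f" "smooth_on UNIV g"
    for f g :: "complex^4 \<Rightarrow> mat2"
    using add[OF that(1) lin[OF bounded_linear_minus[OF bounded_linear_ident] that(2)]] by simp
  show ?thesis
    unfolding potential_def conn_formula_def power2_eq_square power3_eq_cube divide_inverse
    by (intro sub add scale inv mult R const sk X smooth_on_intros(5)[OF open_UNIV bounded_bilinear_inner])
      (auto intro!: mult_pos_pos add_pos_pos Rp assms)
qed

lemma is_connection_gauge_potential:
  assumes "\<epsilon> > 0" "c \<in> SU2"
  shows "is_connection \<epsilon> (gauge_potential \<epsilon> c)"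
proof -
  have bl: "bounded_linear (\<lambda>m. c ** m ** cadj c)"
    by (rule bounded_linear_compose[OF matrix_mult.bounded_linear_left matrix_mult.bounded_linear_right])
  have "alternating_multilinear 1 (gauge_potential \<epsilon> c z)" for z
  proof -
    have "linear (\<lambda>u. gauge_potential \<epsilon> c z (vs[i := u]))" if "length vs = 1" "i < 1" for vs i
    proof -
      have "gauge_potential \<epsilon> c z (vs[i := u]) = c ** potential \<epsilon> z u ** cadj c" for u
        using that by (cases vs) (auto simp: gauge_potential_def)
      then show ?thesis
        using linear_compose[OF linear_potential bounded_linear.linear[OF bl]] by (simp add: o_def)
    qed
    then show ?thesis
      by (auto simp: alternating_multilinear_def)
  qed
  moreover have "smooth_on UNIV (\<lambda>z. gauge_potential \<epsilon> c z vs)" for vs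
    unfolding gauge_potential_def using smooth_on_intros(3)[OF open_UNIV bl smooth_potential[OF assms(1)]] .
  ultimately have "smooth_form_near 1 (Xeps \<epsilon>) (gauge_potential \<epsilon> c)"
    unfolding smooth_form_near_def by (intro exI[of _ UNIV]) auto
  then show ?thesis
    using su2_conj[OF assms(2) potential_su2]
    by (simp add: is_connection_def gauge_potential_def)
qed


section \<open>Left-invariant vector fields on the cylinder\<close>

lemma mat_i_commute: "p ** (mat \<i> ** B) = mat \<i> ** (p ** B)" for p B :: mat2
  by (simp add: mat2_entries algebra_simps)

lemma of_quats_conj:
  "of_mat (p ** (A + mat \<i> ** B) ** cadj q) = of_quats (p ** A ** cadj q) (p ** B ** cadj q)"
  for p q A B :: mat2
  by (simp add: of_quats_def matrix_ring mat_i_commute)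

lemma cyl_map_eq:
  "cyl_map \<epsilon> (r, p, q) = of_quats (p ** (Rplus \<epsilon> r *\<^sub>R mat 1) ** cadj q) (p ** (Rminus \<epsilon> r *\<^sub>R quat_i) ** cadj q)"
proof -
  have "to_mat (vector [of_real (Rplus \<epsilon> r), \<i> * of_real (Rminus \<epsilon> r), 0, 0]) =
      Rplus \<epsilon> r *\<^sub>R mat 1 + mat \<i> ** (Rminus \<epsilon> r *\<^sub>R quat_i)"
    by (simp add: mat2_entries to_mat_nth vector_4_nth scaleR_conv_of_real[where 'a=complex] algebra_simps)
  then show ?thesis
    by (simp add: cyl_map_def spin_act_def of_quats_conj)
qed

text \<open>
  The derivative of \<open>cyl_map\<close> in the direction \<open>(s, p \<alpha>, q \<beta>)\<close> is \<open>p (cyl_re + i cyl_im) q\<^sup>-\<^sup>1\<close>; the two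
  components come from \<open>x = R\<^sub>+ p q\<^sup>-\<^sup>1\<close> and \<open>y = R\<^sub>- p T\<^sub>1 q\<^sup>-\<^sup>1\<close>.
\<close>

definition cyl_re :: "real \<Rightarrow> real \<Rightarrow> mat2 \<Rightarrow> mat2 \<Rightarrow> real \<Rightarrow> mat2" where
  "cyl_re \<epsilon> s \<alpha> \<beta> r = (s * (r / (2 * Rplus \<epsilon> r))) *\<^sub>R mat 1 + Rplus \<epsilon> r *\<^sub>R (\<alpha> - \<beta>)"

definition cyl_im :: "real \<Rightarrow> real \<Rightarrow> mat2 \<Rightarrow> mat2 \<Rightarrow> real \<Rightarrow> mat2" where
  "cyl_im \<epsilon> s \<alpha> \<beta> r = (s * (r / (2 * Rminus \<epsilon> r))) *\<^sub>R quat_i + Rminus \<epsilon> r *\<^sub>R (\<alpha> ** quat_i - quat_i ** \<beta>)"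

text \<open>
  The image under \<open>cyl_map\<close> of the left-invariant vector field given by \<open>(s, \<alpha>, \<beta>)\<close>.
\<close>

definition cyl_field :: "real \<Rightarrow> real \<Rightarrow> mat2 \<Rightarrow> mat2 \<Rightarrow> cyl \<Rightarrow> complex^4" where
  "cyl_field \<epsilon> s \<alpha> \<beta> x = (case x of (r, p, q) \<Rightarrow>
     of_quats (p ** cyl_re \<epsilon> s \<alpha> \<beta> r ** cadj q) (p ** cyl_im \<epsilon> s \<alpha> \<beta> r ** cadj q))"

lemma has_derivative_conj_family:
  fixes p q :: mat2
  assumes "(M has_vector_derivative M') (at r)"
  shows "((\<lambda>(r, p, q). p ** M r ** cadj q) has_derivative
    (\<lambda>(s, P, Q). P ** M r ** cadj q + p ** M r ** cadj Q + s *\<^sub>R (p ** M' ** cadj q))) (at (r, p, q))"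
proof -
  have M: "((\<lambda>x :: cyl. M (fst x)) has_derivative (\<lambda>v. fst v *\<^sub>R M')) (at (r, p, q))"
    by (rule has_derivative_compose[OF has_derivative_fst[OF has_derivative_ident]])
      (use assms in \<open>simp add: has_vector_derivative_def\<close>)
  have p: "((\<lambda>x :: cyl. fst (snd x)) has_derivative (\<lambda>v. fst (snd v))) (at (r, p, q))"
    by (auto intro!: derivative_eq_intros)
  have "((\<lambda>x :: cyl. snd (snd x)) has_derivative (\<lambda>v. snd (snd v))) (at (r, p, q))"
    by (auto intro!: derivative_eq_intros)
  from bounded_linear.has_derivative[OF bounded_linear_cadj this]
  have q: "((\<lambda>x :: cyl. cadj (snd (snd x))) has_derivative (\<lambda>v. cadj (snd (snd v)))) (at (r, p, q))" .
  show ?thesis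
    unfolding split_def
    by (rule has_derivative_eq_rhs[OF matrix_mult.FDERIV[OF matrix_mult.FDERIV[OF p M] q]])
      (simp add: fun_eq_iff matrix_ring)
qed

lemma conj_family_left_invariant:
  fixes p q M M' \<alpha> \<beta> :: mat2
  assumes "\<beta> \<in> su2"
  shows "(p ** \<alpha>) ** M ** cadj q + p ** M ** cadj (q ** \<beta>) + s *\<^sub>R (p ** M' ** cadj q) =
    p ** (\<alpha> ** M - M ** \<beta> + s *\<^sub>R M') ** cadj q"
  by (simp add: cadj_mult cadj_su2[OF assms] matrix_ring)

lemma R_has_derivative:
  assumes "\<epsilon> > 0" "r > \<epsilon>"
  shows "(Rplus \<epsilon> has_real_derivative r / (2 * Rplus \<epsilon> r)) (at r)"
    "(Rminus \<epsilon> has_real_derivative r / (2 * Rminus \<epsilon> r)) (at r)"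
proof -
  have "(r\<^sup>2 + \<epsilon>\<^sup>2) / 2 > 0" "(r\<^sup>2 - \<epsilon>\<^sup>2) / 2 > 0"
    using assms by (simp_all add: add_nonneg_pos power_strict_mono)
  then show "(Rplus \<epsilon> has_real_derivative r / (2 * Rplus \<epsilon> r)) (at r)"
    "(Rminus \<epsilon> has_real_derivative r / (2 * Rminus \<epsilon> r)) (at r)"
    unfolding Rplus_def[abs_def] Rminus_def[abs_def]
    by (auto intro!: derivative_eq_intros simp: field_simps)
qed

lemma R_scaled_has_derivative:
  assumes "\<epsilon> > 0" "r > \<epsilon>"
  shows "((\<lambda>r. Rplus \<epsilon> r *\<^sub>R m) has_vector_derivative (r / (2 * Rplus \<epsilon> r)) *\<^sub>R m) (at r)"
    "((\<lambda>r. Rminus \<epsilon> r *\<^sub>R m) has_vector_derivative (r / (2 * Rminus \<epsilon> r)) *\<^sub>R m) (at r)"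
  using has_vector_derivative_scaleR[OF R_has_derivative(1)[OF assms] has_vector_derivative_const[of m]]
    has_vector_derivative_scaleR[OF R_has_derivative(2)[OF assms] has_vector_derivative_const[of m]]
  by simp_all

lemma has_derivative_of_quats:
  assumes "(A has_derivative A') (at x within S)" "(B has_derivative B') (at x within S)"
  shows "((\<lambda>x. of_quats (A x) (B x)) has_derivative (\<lambda>v. of_quats (A' v) (B' v))) (at x within S)"
  using bounded_linear.has_derivative[OF bounded_linear_of_quats has_derivative_Pair[OF assms]] by simp

lemma cyl_map_has_derivative:
  assumes "\<epsilon> > 0" "r > \<epsilon>"
  shows "(cyl_map \<epsilon> has_derivative frechet_derivative (cyl_map \<epsilon>) (at (r, p, q))) (at (r, p, q))"
    and "\<beta> \<in> su2 \<Longrightarrow> frechet_derivative (cyl_map \<epsilon>) (at (r, p, q)) (s, p ** \<alpha>, q ** \<beta>)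
      = cyl_field \<epsilon> s \<alpha> \<beta> (r, p, q)"
proof -
  have eq: "cyl_map \<epsilon> = (\<lambda>x. of_quats
      ((\<lambda>(r, p, q). p ** (Rplus \<epsilon> r *\<^sub>R mat 1) ** cadj q) x) ((\<lambda>(r, p, q). p ** (Rminus \<epsilon> r *\<^sub>R quat_i) ** cadj q) x))"
    by (auto simp: fun_eq_iff cyl_map_eq)
  note d = has_derivative_of_quats[OF
      has_derivative_conj_family[OF R_scaled_has_derivative(1)[OF assms, of "mat 1"], where p=p and q=q]
      has_derivative_conj_family[OF R_scaled_has_derivative(2)[OF assms, of quat_i], where p=p and q=q], folded eq]
  then show "(cyl_map \<epsilon> has_derivative frechet_derivative (cyl_map \<epsilon>) (at (r, p, q))) (at (r, p, q))"
    using differentiableI[OF d] by (simp only: frechet_derivative_works)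
  assume \<beta>: "\<beta> \<in> su2"
  show "frechet_derivative (cyl_map \<epsilon>) (at (r, p, q)) (s, p ** \<alpha>, q ** \<beta>)
      = cyl_field \<epsilon> s \<alpha> \<beta> (r, p, q)"
    unfolding frechet_derivative_at[OF d, symmetric] cyl_field_def split_beta fst_conv snd_conv
      conj_family_left_invariant[OF \<beta>]
    by (simp add: cyl_re_def cyl_im_def matrix_ring algebra_simps)
qed

lemma T_cyl_E:
  assumes "(r, p, q) \<in> cyl \<epsilon>" "v \<in> T_cyl (r, p, q)"
  obtains s \<alpha> \<beta> where "v = (s, p ** \<alpha>, q ** \<beta>)" "\<alpha> \<in> su2" "\<beta> \<in> su2"
proof -
  obtain s P Q where v: "v = (s, P, Q)" by (cases v)
  have "p \<in> SU2" "q \<in> SU2" using assms(1) by (auto simp: cyl_def)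
  then show thesis
    using that[of s "cadj p ** P" "cadj q ** Q"] assms(2)
    by (simp add: v T_cyl_def SU2_cancel)
qed

lemma theta_left_invariant:
  assumes "(r, p, q) \<in> cyl \<epsilon>"
  shows "theta i (r, p, q) [(s, p ** \<alpha>, q ** \<beta>)] = X_coord i \<alpha> \<beta>"
  using assms by (simp add: theta_def cyl_def SU2_cancel)

lemma X_coord_pure_quat:
  "X_coord 1 (pure_quat a1 a2 a3) (pure_quat b1 b2 b3) = b1 - a1"
  "X_coord 2 (pure_quat a1 a2 a3) (pure_quat b1 b2 b3) = b2 - a2"
  "X_coord 3 (pure_quat a1 a2 a3) (pure_quat b1 b2 b3) = b3 - a3"
  "X_coord 4 (pure_quat a1 a2 a3) (pure_quat b1 b2 b3) = - (a3 + b3)"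
  "X_coord 5 (pure_quat a1 a2 a3) (pure_quat b1 b2 b3) = a2 + b2"
  "X_coord 6 (pure_quat a1 a2 a3) (pure_quat b1 b2 b3) = - (a1 + b1)"
  by (simp_all add: X_coord_def X_index_def spin_to_so4_def matrix_def of_mat_def
      to_mat_nth vector_4_nth axis_def mat2_mult_nth pure_quat_nth complex_eq_iff)
    (simp_all add: field_simps)

text \<open>
  The prescribed connection on a left-invariant field, for the standard frame.  The map \<open>m \<mapsto> T\<^sub>1 m T\<^sub>1\<close> is
  \<open>- 1\<close> on multiples of \<open>T\<^sub>1\<close> and \<open>+ 1\<close> on their complement, so the two summands are the projections of
  half of \<open>\<alpha> + \<beta>\<close>, the second one scaled by \<open>\<epsilon> / R\<^sub>+\<close>.
\<close>

definition inv_potential :: "real \<Rightarrow> real \<Rightarrow> mat2 \<Rightarrow> mat2 \<Rightarrow> mat2" where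
  "inv_potential \<epsilon> r \<alpha> \<beta> = (1/4) *\<^sub>R ((\<alpha> + \<beta>) - quat_i ** (\<alpha> + \<beta>) ** quat_i) +
     (\<epsilon> / Rplus \<epsilon> r) *\<^sub>R ((1/4) *\<^sub>R ((\<alpha> + \<beta>) + quat_i ** (\<alpha> + \<beta>) ** quat_i))"

lemma inv_potential_pure_quat:
  "inv_potential \<epsilon> r (pure_quat a1 a2 a3) (pure_quat b1 b2 b3) =
    pure_quat ((a1 + b1) / 2) (\<epsilon> / Rplus \<epsilon> r * ((a2 + b2) / 2)) (\<epsilon> / Rplus \<epsilon> r * ((a3 + b3) / 2))"
  by (simp add: inv_potential_def mat2_entries complex_eq_iff algebra_simps add_divide_distrib)

text \<open>
  The heart of the extension over the zero section, a computation in coordinates at \<open>p = q = 1\<close>.  The identity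
  \<open>R\<^sub>-\<^sup>2 = (R\<^sub>+ - \<epsilon>) (R\<^sub>+ + \<epsilon>)\<close> turns the coefficients of \<open>conn_formula\<close> into \<open>(1 - \<epsilon> / R\<^sub>+) / 2\<close>.
\<close>

lemma conn_formula_at_identity:
  assumes "\<epsilon> > 0" "r > \<epsilon>" "\<alpha> \<in> su2" "\<beta> \<in> su2"
  shows "conn_formula \<epsilon> (Rplus \<epsilon> r) (Rplus \<epsilon> r *\<^sub>R mat 1) (Rminus \<epsilon> r *\<^sub>R quat_i)
    (cyl_re \<epsilon> s \<alpha> \<beta> r) (cyl_im \<epsilon> s \<alpha> \<beta> r) = inv_potential \<epsilon> r \<alpha> \<beta> - \<beta>"
proof -
  obtain a1 a2 a3 b1 b2 b3 where ab: "\<alpha> = pure_quat a1 a2 a3" "\<beta> = pure_quat b1 b2 b3"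
    using assms(3,4) unfolding su2_iff by blast
  define R S k where "R = Rplus \<epsilon> r" and "S = Rminus \<epsilon> r" and "k = \<epsilon> / R"
  have R: "R > 0" and S: "S > 0" and SR: "S\<^sup>2 = (R - \<epsilon>) * (R + \<epsilon>)"
    using Rplus_pos[OF assms(1)] Rminus_pos[OF assms(1,2)] R_squares(4)[OF assms(1), of r] assms(2)
    by (simp_all add: R_def S_def power2_eq_square algebra_simps)
  have 1: "skew (cadj (R *\<^sub>R mat 1) ** cyl_re \<epsilon> s \<alpha> \<beta> r) = R\<^sup>2 *\<^sub>R pure_quat (a1 - b1) (a2 - b2) (a3 - b3)"
    by (simp add: skew_def cyl_re_def ab R_def[symmetric] mat2_entries complex_eq_iff power2_eq_square algebra_simps)
  have 2: "skew (cadj (S *\<^sub>R quat_i) ** cyl_im \<epsilon> s \<alpha> \<beta> r) = - (S\<^sup>2 *\<^sub>R pure_quat (b1 - a1) (a2 + b2) (a3 + b3))"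
    by (simp add: skew_def cyl_im_def ab S_def[symmetric] mat2_entries complex_eq_iff power2_eq_square algebra_simps)
  have 3: "skew (cadj (R *\<^sub>R mat 1) ** (S *\<^sub>R quat_i)) = (R * S) *\<^sub>R pure_quat 1 0 0"
    by (simp add: skew_def mat2_entries complex_eq_iff)
  have 4: "inner (cyl_re \<epsilon> s \<alpha> \<beta> r) (S *\<^sub>R quat_i) / 2 = R * S * (a1 - b1)"
    by (simp add: cyl_re_def ab R_def[symmetric] inner_mat2 diag2_nth pure_quat_nth mat_nth field_simps)
  have 5: "inverse (2 * R\<^sup>2) * R\<^sup>2 = 1 / 2" using R by simp
  have 6: "inverse (2 * R * (R + \<epsilon>)) * S\<^sup>2 = (1 - \<epsilon> / R) / 2"
  proof -
    have "R \<noteq> 0" "R + \<epsilon> \<noteq> 0" using R assms(1) by auto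
    then show ?thesis
      unfolding SR by (simp add: divide_simps)
  qed
  have 7: "inverse (2 * R ^ 3 * (R + \<epsilon>)) * (R * S * (a1 - b1)) * (R * S) = (1 - \<epsilon> / R) / 2 * (a1 - b1)"
  proof -
    define N where "N = R + \<epsilon>"
    have "N \<noteq> 0" using R assms(1) by (simp add: N_def)
    then show ?thesis
      unfolding 6[symmetric] N_def[symmetric] using R by (simp add: field_simps power2_eq_square power3_eq_cube)
  qed
  show ?thesis
    unfolding conn_formula_def R_def[symmetric] S_def[symmetric] 1 2 3 4 scaleR_minus_right scaleR_scaleR 5 6 7
    unfolding ab inv_potential_pure_quat R_def[symmetric] k_def[symmetric]
    by (simp add: mat2_entries complex_eq_iff field_simps)
qed

lemma norm_cyl_map:
  assumes "(r, p, q) \<in> cyl \<epsilon>" "\<epsilon> > 0"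
  shows "norm (cyl_map \<epsilon> (r, p, q)) = r"
proof -
  have pq: "p \<in> SU2" "q \<in> SU2" and r: "r > \<epsilon>" using assms(1) by (auto simp: cyl_def)
  have qq: "quat (p ** (a *\<^sub>R mat 1) ** cadj q)" "quat (p ** (b *\<^sub>R quat_i) ** cadj q)" for a b
    by (intro quat_simps SU2_quat[OF pq(1)] SU2_quat[OF pq(2)] su2_quat[OF su2_lin(4)])+
  have "inner (cyl_map \<epsilon> (r, p, q)) (cyl_map \<epsilon> (r, p, q)) = r\<^sup>2"
    unfolding cyl_map_eq inner_C4 re_im_of_quats[OF qq] inner_SU2_conj[OF pq]
    using R_squares(3)[OF assms(2), of r] r
    by (simp add: inner_mat2 mat_nth diag2_nth power2_eq_square)
  then show ?thesis
    using r assms(2) by (simp add: norm_eq_sqrt_inner)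
qed

text \<open>
  Apart from the rotation by \<open>q\<close>, the potential on a left-invariant field only depends on \<open>r\<close>.  The
  subtracted \<open>\<beta>\<close> is the Maurer-Cartan term of the trivialisation.
\<close>

lemma potential_cyl_field:
  assumes "(r, p, q) \<in> cyl \<epsilon>" "\<epsilon> > 0" "\<alpha> \<in> su2" "\<beta> \<in> su2"
  shows "potential \<epsilon> (cyl_map \<epsilon> (r, p, q)) (cyl_field \<epsilon> s \<alpha> \<beta> (r, p, q)) =
    q ** (inv_potential \<epsilon> r \<alpha> \<beta> - \<beta>) ** cadj q"
proof -
  have pq: "p \<in> SU2" "q \<in> SU2" and r: "r > \<epsilon>" using assms(1) by (auto simp: cyl_def)
  have qq: "quat (p ** (a *\<^sub>R mat 1) ** cadj q)" "quat (p ** (b *\<^sub>R quat_i) ** cadj q)"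
    "quat (p ** cyl_re \<epsilon> s \<alpha> \<beta> r ** cadj q)" "quat (p ** cyl_im \<epsilon> s \<alpha> \<beta> r ** cadj q)" for a b
    unfolding cyl_re_def cyl_im_def
    by (intro quat_simps SU2_quat[OF pq(1)] SU2_quat[OF pq(2)] su2_quat[OF su2_lin(4)]
        su2_quat[OF assms(3)] su2_quat[OF assms(4)])+
  show ?thesis
    unfolding potential_def norm_cyl_map[OF assms(1,2)]
    by (simp add: cyl_map_eq cyl_field_def re_im_of_quats qq conn_formula_conj[OF pq]
        conn_formula_at_identity[OF assms(2) r assms(3,4)])
qed

section \<open>The curvature on the cylinder\<close>

lemma curvature_conj:
  assumes d: "\<And>v. (\<lambda>y. a y [v]) differentiable (at z)" and c: "c \<in> SU2"
  shows "curvature (\<lambda>z vs. c ** a z vs ** cadj c) z [u, v] = c ** curvature a z [u, v] ** cadj c"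
proof -
  have bl: "bounded_linear (\<lambda>m. c ** m ** cadj c)"
    by (rule bounded_linear_compose[OF matrix_mult.bounded_linear_left matrix_mult.bounded_linear_right])
  have "frechet_derivative (\<lambda>y. c ** a y [v] ** cadj c) (at z) =
      (\<lambda>h. c ** frechet_derivative (\<lambda>y. a y [v]) (at z) h ** cadj c)" for v
    using frechet_derivative_at[OF bounded_linear.has_derivative[OF bl
          frechet_derivative_works[THEN iffD1, OF d]]] by simp
  then show ?thesis
    by (simp add: curvature_def ext_deriv1_def bracket_def matrix_ring SU2_cancel[OF c])
qed

text \<open>
  A curve in the group with tangent vector \<open>p \<alpha>\<close> at \<open>p\<close>.  Normalising \<open>1 + t \<alpha>\<close> replaces the exponential map, as
  only the first derivative matters.
\<close>

definition su2_curve :: "mat2 \<Rightarrow> mat2 \<Rightarrow> real \<Rightarrow> mat2" where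
  "su2_curve p \<alpha> t = inverse (sqrt (1 + t\<^sup>2 * (inner \<alpha> \<alpha> / 2))) *\<^sub>R (p ** (mat 1 + t *\<^sub>R \<alpha>))"

lemma su2_curve_SU2:
  assumes "p \<in> SU2" "\<alpha> \<in> su2"
  shows "su2_curve p \<alpha> t \<in> SU2"
proof -
  obtain a b c where \<alpha>: "\<alpha> = pure_quat a b c" using assms(2) su2_iff by blast
  define n where "n = 1 + t\<^sup>2 * (inner \<alpha> \<alpha> / 2)"
  have n: "n > 0" unfolding n_def by (simp add: add_pos_nonneg)
  have "inner (mat 1 + t *\<^sub>R \<alpha>) (mat 1 + t *\<^sub>R \<alpha>) = 2 * n"
    by (simp add: n_def \<alpha> inner_mat2 mat_nth pure_quat_nth power2_eq_square algebra_simps)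
  moreover have "inverse (sqrt n) * inverse (sqrt n) * n = 1"
    using n by (simp flip: inverse_mult_distrib)
  ultimately have "inner (su2_curve p \<alpha> t) (su2_curve p \<alpha> t) = 2"
    unfolding su2_curve_def n_def[symmetric] inner_scaleR_left inner_scaleR_right
      inner_SU2_left[OF assms(1)] by (simp add: mult.assoc mult.left_commute)
  moreover have "quat (su2_curve p \<alpha> t)"
    unfolding su2_curve_def by (intro quat_simps SU2_quat[OF assms(1)] su2_quat[OF assms(2)])
  ultimately show ?thesis by (simp add: SU2_iff)
qed

lemma su2_curve_has_derivative:
  "su2_curve p \<alpha> 0 = p" "(su2_curve p \<alpha> has_vector_derivative p ** \<alpha>) (at 0)"
proof -
  show "su2_curve p \<alpha> 0 = p" by (simp add: su2_curve_def)
  define m where "m = inner \<alpha> \<alpha> / 2"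
  have 1: "((\<lambda>t. inverse (sqrt (1 + t\<^sup>2 * m))) has_real_derivative 0) (at 0)"
    by (rule derivative_eq_intros refl | simp)+
  have "((\<lambda>t. p ** mat 1 + t *\<^sub>R (p ** \<alpha>)) has_vector_derivative p ** \<alpha>) (at 0)"
    by (auto intro!: derivative_eq_intros)
  from has_vector_derivative_scaleR[OF 1 this]
  show "(su2_curve p \<alpha> has_vector_derivative p ** \<alpha>) (at 0)"
    unfolding su2_curve_def[abs_def] m_def[symmetric] by (simp add: matrix_ring)
qed

lemma conj_family_along_curve:
  assumes "(M has_vector_derivative M') (at r)" "\<beta> \<in> su2"
  shows "((\<lambda>t. su2_curve p \<alpha> t ** M (r + t * s) ** cadj (su2_curve q \<beta> t)) has_vector_derivative
    p ** (\<alpha> ** M r - M r ** \<beta> + s *\<^sub>R M') ** cadj q) (at 0)"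
proof -
  have 1: "((\<lambda>t. (r + t * s, su2_curve p \<alpha> t, su2_curve q \<beta> t)) has_vector_derivative
      (s, p ** \<alpha>, q ** \<beta>)) (at 0)"
    by (intro has_vector_derivative_Pair su2_curve_has_derivative)
      (auto intro!: derivative_eq_intros simp: has_real_derivative_iff_has_vector_derivative[symmetric])
  have 0: "(r + 0 * s, su2_curve p \<alpha> 0, su2_curve q \<beta> 0) = (r, p, q)"
    by (simp add: su2_curve_has_derivative)
  have "((\<lambda>t. su2_curve p \<alpha> t ** M (r + t * s) ** cadj (su2_curve q \<beta> t)) has_derivative
    (\<lambda>t. (t *\<^sub>R (p ** \<alpha>)) ** M r ** cadj q + p ** M r ** cadj (t *\<^sub>R (q ** \<beta>)) + (t * s) *\<^sub>R (p ** M' ** cadj q))) (at 0)"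
    using has_derivative_compose[OF 1[unfolded has_vector_derivative_def]
        has_derivative_conj_family[OF assms(1), where p=p and q=q, folded 0]]
    by (simp add: su2_curve_has_derivative)
  then show ?thesis
    unfolding has_vector_derivative_def
    by (rule has_derivative_eq_rhs)
      (simp add: fun_eq_iff cadj_mult cadj_simps cadj_su2[OF assms(2)] matrix_ring algebra_simps)
qed

text \<open>
  The derivatives of \<open>cyl_re\<close> and \<open>cyl_im\<close> in \<open>r\<close>.  The second derivatives of \<open>R\<^sub>+\<close> and \<open>R\<^sub>-\<close> stay implicit, for they cancel
  in \<open>cyl_field_bracket\<close>.
\<close>

definition cyl_re_deriv :: "real \<Rightarrow> real \<Rightarrow> mat2 \<Rightarrow> mat2 \<Rightarrow> real \<Rightarrow> mat2" where
  "cyl_re_deriv \<epsilon> s \<alpha> \<beta> r = (s * deriv (\<lambda>r. r / (2 * Rplus \<epsilon> r)) r) *\<^sub>R mat 1 + (r / (2 * Rplus \<epsilon> r)) *\<^sub>R (\<alpha> - \<beta>)"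

definition cyl_im_deriv :: "real \<Rightarrow> real \<Rightarrow> mat2 \<Rightarrow> mat2 \<Rightarrow> real \<Rightarrow> mat2" where
  "cyl_im_deriv \<epsilon> s \<alpha> \<beta> r = (s * deriv (\<lambda>r. r / (2 * Rminus \<epsilon> r)) r) *\<^sub>R quat_i +
     (r / (2 * Rminus \<epsilon> r)) *\<^sub>R (\<alpha> ** quat_i - quat_i ** \<beta>)"

lemma cyl_re_im_has_derivative:
  assumes "\<epsilon> > 0" "r > \<epsilon>"
  shows "(cyl_re \<epsilon> s \<alpha> \<beta> has_vector_derivative cyl_re_deriv \<epsilon> s \<alpha> \<beta> r) (at r)"
    "(cyl_im \<epsilon> s \<alpha> \<beta> has_vector_derivative cyl_im_deriv \<epsilon> s \<alpha> \<beta> r) (at r)"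
proof -
  have f: "Rplus \<epsilon> field_differentiable (at r)" "Rminus \<epsilon> field_differentiable (at r)"
    using R_has_derivative[OF assms] unfolding field_differentiable_def by blast+
  have "(\<lambda>r. r / (2 * Rplus \<epsilon> r)) field_differentiable (at r)"
    "(\<lambda>r. r / (2 * Rminus \<epsilon> r)) field_differentiable (at r)"
    using Rplus_pos[OF assms(1), of r] Rminus_pos[OF assms]
    by (auto intro!: field_differentiable_divide field_differentiable_mult field_differentiable_ident
        field_differentiable_const f)
  then have d: "((\<lambda>r. s * (r / (2 * Rplus \<epsilon> r))) has_real_derivative s * deriv (\<lambda>r. r / (2 * Rplus \<epsilon> r)) r) (at r)"
    "((\<lambda>r. s * (r / (2 * Rminus \<epsilon> r))) has_real_derivative s * deriv (\<lambda>r. r / (2 * Rminus \<epsilon> r)) r) (at r)"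
    by (simp_all only: DERIV_cmult DERIV_deriv_iff_field_differentiable)
  show "(cyl_re \<epsilon> s \<alpha> \<beta> has_vector_derivative cyl_re_deriv \<epsilon> s \<alpha> \<beta> r) (at r)"
    using has_vector_derivative_add[OF has_vector_derivative_scaleR[OF d(1) has_vector_derivative_const[of "mat 1"]]
        R_scaled_has_derivative(1)[OF assms, of "\<alpha> - \<beta>"]]
    by (simp add: cyl_re_def[abs_def] cyl_re_deriv_def)
  show "(cyl_im \<epsilon> s \<alpha> \<beta> has_vector_derivative cyl_im_deriv \<epsilon> s \<alpha> \<beta> r) (at r)"
    using has_vector_derivative_add[OF has_vector_derivative_scaleR[OF d(2) has_vector_derivative_const[of quat_i]]
        R_scaled_has_derivative(2)[OF assms, of "\<alpha> ** quat_i - quat_i ** \<beta>"]]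
    by (simp add: cyl_im_def[abs_def] cyl_im_deriv_def)
qed

definition inv_potential_deriv :: "real \<Rightarrow> real \<Rightarrow> mat2 \<Rightarrow> mat2 \<Rightarrow> mat2" where
  "inv_potential_deriv \<epsilon> r \<alpha> \<beta> = - (\<epsilon> * r / (2 * Rplus \<epsilon> r ^ 3)) *\<^sub>R
     ((1/4) *\<^sub>R ((\<alpha> + \<beta>) + quat_i ** (\<alpha> + \<beta>) ** quat_i))"

lemma inv_potential_has_derivative:
  assumes "\<epsilon> > 0" "r > \<epsilon>"
  shows "((\<lambda>r. inv_potential \<epsilon> r \<alpha> \<beta>) has_vector_derivative inv_potential_deriv \<epsilon> r \<alpha> \<beta>) (at r)"
proof -
  have "((\<lambda>r. \<epsilon> / Rplus \<epsilon> r) has_real_derivative - (\<epsilon> * r / (2 * Rplus \<epsilon> r ^ 3))) (at r)"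
    by (rule derivative_eq_intros R_has_derivative[OF assms] refl)+
      (use Rplus_pos[OF assms(1), of r] in \<open>auto simp: field_simps power3_eq_cube\<close>)
  note d = has_vector_derivative_add[OF has_vector_derivative_const
      has_vector_derivative_scaleR[OF this has_vector_derivative_const]]
  show ?thesis
    unfolding inv_potential_def inv_potential_deriv_def
    by (rule has_vector_derivative_eq_rhs[OF d]) simp
qed

text \<open>
  The derivative of the second of two left-invariant fields along the first.
\<close>

definition cyl_field_deriv ::
  "real \<Rightarrow> real \<Rightarrow> mat2 \<Rightarrow> mat2 \<Rightarrow> real \<Rightarrow> mat2 \<Rightarrow> mat2 \<Rightarrow> cyl \<Rightarrow> complex^4" where
  "cyl_field_deriv \<epsilon> s1 \<alpha>1 \<beta>1 s2 \<alpha>2 \<beta>2 x = (case x of (r, p, q) \<Rightarrow> of_quats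
     (p ** (\<alpha>1 ** cyl_re \<epsilon> s2 \<alpha>2 \<beta>2 r - cyl_re \<epsilon> s2 \<alpha>2 \<beta>2 r ** \<beta>1 + s1 *\<^sub>R cyl_re_deriv \<epsilon> s2 \<alpha>2 \<beta>2 r) ** cadj q)
     (p ** (\<alpha>1 ** cyl_im \<epsilon> s2 \<alpha>2 \<beta>2 r - cyl_im \<epsilon> s2 \<alpha>2 \<beta>2 r ** \<beta>1 + s1 *\<^sub>R cyl_im_deriv \<epsilon> s2 \<alpha>2 \<beta>2 r) ** cadj q))"

lemma has_vector_derivative_of_quats:
  assumes "(A has_vector_derivative A') (at t)" "(B has_vector_derivative B') (at t)"
  shows "((\<lambda>x. of_quats (A x) (B x)) has_vector_derivative of_quats A' B') (at t)"
  using has_derivative_of_quats[OF assms[unfolded has_vector_derivative_def]]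
  by (simp add: has_vector_derivative_def of_quats_linear)

text \<open>
  The commutator of the images of two left-invariant fields is the image of their commutator.
\<close>

lemma cyl_field_bracket:
  "cyl_field_deriv \<epsilon> s1 \<alpha>1 \<beta>1 s2 \<alpha>2 \<beta>2 x - cyl_field_deriv \<epsilon> s2 \<alpha>2 \<beta>2 s1 \<alpha>1 \<beta>1 x =
     cyl_field \<epsilon> 0 (bracket \<alpha>1 \<alpha>2) (bracket \<beta>1 \<beta>2) x"
proof -
  obtain r p q where x: "x = (r, p, q)" by (cases x)
  have d: "p ** A ** cadj q - p ** B ** cadj q = p ** (A - B) ** cadj q" for A B :: mat2
    by (simp add: matrix_ring)
  show ?thesis
    unfolding x cyl_field_deriv_def cyl_field_def split_beta fst_conv snd_conv of_quats_linear(2)[symmetric] d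
    by (rule arg_cong2[where f = of_quats]; rule arg_cong[where f = "\<lambda>m. p ** m ** cadj q"];
        simp add: cyl_re_def cyl_re_deriv_def cyl_im_def cyl_im_deriv_def bracket_def matrix_ring algebra_simps)
qed

text \<open>
  The potential on the second field is known at every point of the cylinder, in particular along a curve in the
  direction of the first field.  The derivative along that curve is computed once by the product rule in the ambient space
  and once from the known values.
\<close>

lemma potential_derivative:
  assumes x: "(r, p, q) \<in> cyl \<epsilon>" and \<epsilon>: "\<epsilon> > 0"
    and su2: "\<alpha>1 \<in> su2" "\<beta>1 \<in> su2" "\<alpha>2 \<in> su2" "\<beta>2 \<in> su2"
  defines "z \<equiv> cyl_map \<epsilon> (r, p, q)" and "A \<equiv> inv_potential \<epsilon> r \<alpha>2 \<beta>2"
  shows "frechet_derivative (\<lambda>y. potential \<epsilon> y (cyl_field \<epsilon> s2 \<alpha>2 \<beta>2 (r, p, q))) (at z)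
      (cyl_field \<epsilon> s1 \<alpha>1 \<beta>1 (r, p, q)) +
      potential \<epsilon> z (cyl_field_deriv \<epsilon> s1 \<alpha>1 \<beta>1 s2 \<alpha>2 \<beta>2 (r, p, q)) =
    q ** (\<beta>1 ** (A - \<beta>2) - (A - \<beta>2) ** \<beta>1 + s1 *\<^sub>R inv_potential_deriv \<epsilon> r \<alpha>2 \<beta>2) ** cadj q"
proof -
  have pq: "p \<in> SU2" "q \<in> SU2" and r: "r > \<epsilon>" using x by (auto simp: cyl_def)
  \<comment> \<open>The curve stays in the cylinder as long as its first component exceeds \<open>\<epsilon>\<close>.\<close>
  define \<gamma> where "\<gamma> t = (r + t * s1, su2_curve p \<alpha>1 t, su2_curve q \<beta>1 t)" for t
  have \<gamma>0: "\<gamma> 0 = (r, p, q)"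
    by (simp add: \<gamma>_def su2_curve_has_derivative)
  note curve = conj_family_along_curve[where p=p and q=q and r=r and s=s1 and \<alpha>=\<alpha>1, OF _ su2(2)]
  have zt: "((\<lambda>t. cyl_map \<epsilon> (\<gamma> t)) has_vector_derivative cyl_field \<epsilon> s1 \<alpha>1 \<beta>1 (r, p, q)) (at 0)"
    unfolding \<gamma>_def cyl_map_eq cyl_field_def split_beta fst_conv snd_conv
    using has_vector_derivative_of_quats[OF
        curve[OF R_scaled_has_derivative(1)[OF \<epsilon> r, of "mat 1"]]
        curve[OF R_scaled_has_derivative(2)[OF \<epsilon> r, of quat_i]]]
    by (simp add: cyl_re_def cyl_im_def matrix_ring algebra_simps)
  have ut: "((\<lambda>t. cyl_field \<epsilon> s2 \<alpha>2 \<beta>2 (\<gamma> t)) has_vector_derivative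
      cyl_field_deriv \<epsilon> s1 \<alpha>1 \<beta>1 s2 \<alpha>2 \<beta>2 (r, p, q)) (at 0)"
    unfolding \<gamma>_def cyl_field_def cyl_field_deriv_def split_beta fst_conv snd_conv
    by (intro has_vector_derivative_of_quats curve cyl_re_im_has_derivative \<epsilon> r)
  have df: "((\<lambda>z. potential \<epsilon> z u) has_derivative frechet_derivative (\<lambda>z. potential \<epsilon> z u) (at y)) (at y)" for u y
    using smooth_on_has_derivative[OF smooth_potential[OF \<epsilon>]] by simp
  note 1 = linear_family_has_vector_derivative[OF linear_potential df zt ut]
  have "((\<lambda>r. inv_potential \<epsilon> r \<alpha>2 \<beta>2 - \<beta>2) has_vector_derivative inv_potential_deriv \<epsilon> r \<alpha>2 \<beta>2) (at r)"
    using has_vector_derivative_diff[OF inv_potential_has_derivative[OF \<epsilon> r] has_vector_derivative_const]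
    by simp
  note 2 = conj_family_along_curve[OF this su2(2), of q \<beta>1 s1 q]
  have 3: "((\<lambda>t. potential \<epsilon> (cyl_map \<epsilon> (\<gamma> t)) (cyl_field \<epsilon> s2 \<alpha>2 \<beta>2 (\<gamma> t))) has_vector_derivative
      q ** (\<beta>1 ** (A - \<beta>2) - (A - \<beta>2) ** \<beta>1 + s1 *\<^sub>R inv_potential_deriv \<epsilon> r \<alpha>2 \<beta>2) ** cadj q) (at 0)"
    unfolding A_def
  proof (rule has_vector_derivative_transform_within_open[OF 2])
    show "open {t. \<epsilon> < r + t * s1}"
      by (intro open_Collect_less continuous_intros)
    fix t assume "t \<in> {t. \<epsilon> < r + t * s1}"
    then have "\<gamma> t \<in> cyl \<epsilon>"
      using su2_curve_SU2 pq su2 by (simp add: \<gamma>_def cyl_def)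
    then show "su2_curve q \<beta>1 t ** (inv_potential \<epsilon> (r + t * s1) \<alpha>2 \<beta>2 - \<beta>2) ** cadj (su2_curve q \<beta>1 t) =
        potential \<epsilon> (cyl_map \<epsilon> (\<gamma> t)) (cyl_field \<epsilon> s2 \<alpha>2 \<beta>2 (\<gamma> t))"
      unfolding \<gamma>_def by (rule potential_cyl_field[OF _ \<epsilon> su2(3,4), symmetric])
  qed (use r in simp)
  show ?thesis
    using vector_derivative_unique_at[OF 1 3] unfolding \<gamma>0 z_def .
qed

text \<open>The curvature evaluated on two left-invariant fields, before the rotation by \<open>q\<close>.\<close>

definition inv_curvature ::
  "real \<Rightarrow> real \<Rightarrow> real \<Rightarrow> mat2 \<Rightarrow> mat2 \<Rightarrow> real \<Rightarrow> mat2 \<Rightarrow> mat2 \<Rightarrow> mat2" where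
  "inv_curvature \<epsilon> r s1 \<alpha>1 \<beta>1 s2 \<alpha>2 \<beta>2 =
     s1 *\<^sub>R inv_potential_deriv \<epsilon> r \<alpha>2 \<beta>2 - s2 *\<^sub>R inv_potential_deriv \<epsilon> r \<alpha>1 \<beta>1
     - inv_potential \<epsilon> r (bracket \<alpha>1 \<alpha>2) (bracket \<beta>1 \<beta>2)
     + bracket (inv_potential \<epsilon> r \<alpha>1 \<beta>1) (inv_potential \<epsilon> r \<alpha>2 \<beta>2)"

text \<open>
  By the formula \<open>da(V, W) = V a(W) - W a(V) - a([V, W])\<close>, with the Lie derivatives of the values given by
  \<open>potential_derivative\<close>.  The Maurer-Cartan terms \<open>\<beta>\<^sub>1\<close>, \<open>\<beta>\<^sub>2\<close> cancel, as for a gauge transformation.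
\<close>

lemma curvature_cyl_field:
  assumes x: "(r, p, q) \<in> cyl \<epsilon>" and \<epsilon>: "\<epsilon> > 0"
    and su2: "\<alpha>1 \<in> su2" "\<beta>1 \<in> su2" "\<alpha>2 \<in> su2" "\<beta>2 \<in> su2"
  shows "curvature (\<lambda>z vs. potential \<epsilon> z (hd vs)) (cyl_map \<epsilon> (r, p, q))
      [cyl_field \<epsilon> s1 \<alpha>1 \<beta>1 (r, p, q), cyl_field \<epsilon> s2 \<alpha>2 \<beta>2 (r, p, q)] =
    q ** inv_curvature \<epsilon> r s1 \<alpha>1 \<beta>1 s2 \<alpha>2 \<beta>2 ** cadj q"
proof -
  have q: "q \<in> SU2" using x by (auto simp: cyl_def)
  define z where "z = cyl_map \<epsilon> (r, p, q)"
  define W1 W2 where "W1 = cyl_field \<epsilon> s1 \<alpha>1 \<beta>1 (r, p, q)" and "W2 = cyl_field \<epsilon> s2 \<alpha>2 \<beta>2 (r, p, q)"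
  define S12 S21 where "S12 = cyl_field_deriv \<epsilon> s1 \<alpha>1 \<beta>1 s2 \<alpha>2 \<beta>2 (r, p, q)"
    and "S21 = cyl_field_deriv \<epsilon> s2 \<alpha>2 \<beta>2 s1 \<alpha>1 \<beta>1 (r, p, q)"
  define A1 A2 where "A1 = inv_potential \<epsilon> r \<alpha>1 \<beta>1" and "A2 = inv_potential \<epsilon> r \<alpha>2 \<beta>2"
  define D where "D u v = frechet_derivative (\<lambda>y. potential \<epsilon> y v) (at z) u" for u v
  have 1: "D W1 W2 = q ** (\<beta>1 ** (A2 - \<beta>2) - (A2 - \<beta>2) ** \<beta>1 + s1 *\<^sub>R inv_potential_deriv \<epsilon> r \<alpha>2 \<beta>2) ** cadj q
      - potential \<epsilon> z S12"
    using potential_derivative[OF x \<epsilon> su2, of s2 s1]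
    by (simp add: D_def W1_def W2_def S12_def A2_def z_def eq_diff_eq)
  have 2: "D W2 W1 = q ** (\<beta>2 ** (A1 - \<beta>1) - (A1 - \<beta>1) ** \<beta>2 + s2 *\<^sub>R inv_potential_deriv \<epsilon> r \<alpha>1 \<beta>1) ** cadj q
      - potential \<epsilon> z S21"
    using potential_derivative[OF x \<epsilon> su2(3,4,1,2), of s1 s2]
    by (simp add: D_def W1_def W2_def S21_def A1_def z_def eq_diff_eq)
  have 3: "potential \<epsilon> z S12 - potential \<epsilon> z S21 =
      q ** (inv_potential \<epsilon> r (bracket \<alpha>1 \<alpha>2) (bracket \<beta>1 \<beta>2) - bracket \<beta>1 \<beta>2) ** cadj q"
    unfolding linear_diff[OF linear_potential, symmetric] S12_def S21_def cyl_field_bracket z_def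
    by (rule potential_cyl_field[OF x \<epsilon> su2_bracket[OF su2(1,3)] su2_bracket[OF su2(2,4)]])
  have 4: "potential \<epsilon> z W1 = q ** (A1 - \<beta>1) ** cadj q" "potential \<epsilon> z W2 = q ** (A2 - \<beta>2) ** cadj q"
    unfolding z_def W1_def W2_def A1_def A2_def by (rule potential_cyl_field[OF x \<epsilon>] su2)+
  have "curvature (\<lambda>z vs. potential \<epsilon> z (hd vs)) z [W1, W2] =
      D W1 W2 - D W2 W1 + bracket (potential \<epsilon> z W1) (potential \<epsilon> z W2)"
    by (simp add: curvature_def ext_deriv1_def D_def)
  also have "\<dots> = q ** inv_curvature \<epsilon> r s1 \<alpha>1 \<beta>1 s2 \<alpha>2 \<beta>2 ** cadj q"
    using 3 unfolding 1 2 4 inv_curvature_def A1_def[symmetric] A2_def[symmetric]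
    by (simp add: bracket_def matrix_ring SU2_cancel[OF q] algebra_simps)
  finally show ?thesis
    unfolding z_def W1_def W2_def .
qed

text \<open>
  The three components are those of the claimed curvature.  For the first one,
  \<open>a \<times> a' + b \<times> b' = ((a + b) \<times> (a' + b') + (b - a) \<times> (b' - a')) / 2\<close> separates \<open>\<theta>\<^sup>2\<^sup>3\<close> from \<open>\<theta>\<^sup>4\<^sup>5\<close>, and
  \<open>\<epsilon>\<^sup>2 / R\<^sub>+\<^sup>2 - 1 = - R\<^sub>-\<^sup>2 / R\<^sub>+\<^sup>2\<close> gives the coefficient of \<open>\<theta>\<^sup>4\<^sup>5\<close>.
\<close>

lemma inv_curvature_pure_quat:
  assumes "\<epsilon> > 0" "r > \<epsilon>"
    and "\<alpha>1 = pure_quat a1 a2 a3" "\<beta>1 = pure_quat b1 b2 b3" "\<alpha>2 = pure_quat a1' a2' a3'" "\<beta>2 = pure_quat b1' b2' b3'"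
  shows "inv_curvature \<epsilon> r s1 \<alpha>1 \<beta>1 s2 \<alpha>2 \<beta>2 = pure_quat
    (- 1 / 2 * (((b2 - a2) * (b3' - a3') - (b2' - a2') * (b3 - a3)) + (Rminus \<epsilon> r)\<^sup>2 / (Rplus \<epsilon> r)\<^sup>2 *
      ((a2 + b2) * (a3' + b3') - (a2' + b2') * (a3 + b3))))
    (\<epsilon> / (2 * Rplus \<epsilon> r) * ((b1 - a1) * (b3' - a3') - (b1' - a1') * (b3 - a3))
      - \<epsilon> / 4 * (r / (Rplus \<epsilon> r) ^ 3) * (s1 * (a2' + b2') - s2 * (a2 + b2)))
    (- (\<epsilon> / (2 * Rplus \<epsilon> r) * ((b1 - a1) * (b2' - a2') - (b1' - a1') * (b2 - a2))
      - \<epsilon> / 4 * (r / (Rplus \<epsilon> r) ^ 3) * (s2 * (a3 + b3) - s1 * (a3' + b3'))))"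
proof -
  define R S k l where "R = Rplus \<epsilon> r" and "S = Rminus \<epsilon> r" and "k = \<epsilon> / R" and "l = r / R\<^sup>2"
  have R: "R > 0" using Rplus_pos[OF assms(1)] by (simp add: R_def)
  have "S\<^sup>2 = R\<^sup>2 - \<epsilon>\<^sup>2"
    using R_squares(4)[OF assms(1), of r] assms(2) by (simp add: R_def S_def)
  then have S: "S\<^sup>2 / R\<^sup>2 = 1 - k\<^sup>2"
    using R by (simp add: k_def field_simps power2_eq_square)
  have k: "\<epsilon> / (2 * R) = k / 2" "\<epsilon> / 4 * (r / R ^ 3) = k / 4 * l" "\<epsilon> * r / (2 * R ^ 3) = k / 2 * l"
    using R by (simp_all add: k_def l_def field_simps power2_eq_square power3_eq_cube)
  show ?thesis
    unfolding inv_curvature_def inv_potential_deriv_def inv_potential_def R_def[symmetric] S_def[symmetric]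
      S k k_def[symmetric] assms(3-6)
    by (simp add: mat2_entries bracket_def complex_eq_iff) (simp add: field_simps power2_eq_square)
qed

section \<open>The frame and the pullback to the cylinder\<close>

text \<open>
  The commutation relations force \<open>T\<^sub>2\<close> and \<open>T\<^sub>3\<close> to be an orthonormal basis of the complement of \<open>T\<^sub>1\<close>, positively
  oriented.  The standard one is \<open>- k, j\<close>, since \<open>\<theta>\<^sup>4\<close> and \<open>\<theta>\<^sup>5\<close> are \<open>- (\<alpha>\<^sub>3 + \<beta>\<^sub>3)\<close> and \<open>\<alpha>\<^sub>2 + \<beta>\<^sub>2\<close>, and any other
  is obtained from it by a rotation fixing \<open>T\<^sub>1\<close>.
\<close>

lemma su2_basis_frame:
  assumes "su2_basis T1 T2 T3"
  obtains c where "extends_lambda1 c"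
    "\<And>x y w. c ** pure_quat x y w ** cadj c = x *\<^sub>R T1 + y *\<^sub>R T3 - w *\<^sub>R T2"
proof -
  note b = assms[unfolded su2_basis_def bracket_def]
  obtain x y w where T2: "T2 = pure_quat x y w" using b su2_iff by blast
  have T1: "T1 = quat_i" using b by simp
  have "T1 ** T2 - T2 ** T1 = 2 *\<^sub>R T3" using b by blast
  then have T3: "T3 = (1/2) *\<^sub>R (T1 ** T2 - T2 ** T1)" by simp
  have T3': "T3 = pure_quat 0 (- w) y"
    unfolding T3 T1 T2 by (simp add: mat2_entries complex_eq_iff)
  have "T3 ** T1 - T1 ** T3 = 2 *\<^sub>R T2" using b by blast
  then have x: "x = 0"
    unfolding T1 T2 T3' by (simp add: mat2_entries complex_eq_iff)
  have "T2 ** T3 - T3 ** T2 = 2 *\<^sub>R T1" using b by blast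
  then have yw: "y\<^sup>2 + w\<^sup>2 = 1"
    unfolding T1 T2 T3' by (simp add: mat2_entries complex_eq_iff power2_eq_square)
  \<comment> \<open>Conjugation by \<open>diag2 u (cnj u)\<close> rotates the plane of \<open>T2\<close> and \<open>T3\<close> by the angle of \<open>u\<^sup>2\<close>.\<close>
  define u where "u = csqrt (Complex (- w) y)"
  have u2: "u * u = Complex (- w) y"
    by (simp add: u_def power2_eq_square[symmetric])
  have "norm u * norm u = 1"
    unfolding norm_mult[symmetric] u2 using yw by (simp add: norm_complex_def add.commute)
  then have "norm u = 1"
    by (metis abs_norm_cancel power2_eq_1_iff power2_eq_square real_sqrt_abs real_sqrt_one)
  then have uu: "u * cnj u = 1" by (simp add: complex_norm_square[symmetric])
  define c where "c = diag2 u (cnj u)"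
  have "c \<in> SU2"
    using uu by (simp add: c_def SU2_def mat2_entries det_2 mult.commute)
  moreover have "c ** lambda1 t ** cadj c = lambda1 t" for t
    using uu by (simp add: c_def lambda1_def mat2_entries mult.commute mult.left_commute)
  ultimately have "extends_lambda1 c" by (simp add: extends_lambda1_def)
  moreover have "c ** pure_quat x' y' w' ** cadj c = x' *\<^sub>R T1 + y' *\<^sub>R T3 - w' *\<^sub>R T2" for x' y' w'
  proof -
    have 1: "u * Complex y' w' * u = Complex (- w) y * Complex y' w'"
      "u * Complex 0 x' * cnj u = Complex 0 x'" "cnj u * Complex 0 (- x') * u = Complex 0 (- x')"
      "cnj u * Complex (- y') w' * cnj u = cnj (Complex (- w) y) * Complex (- y') w'"
      using uu u2 by (metis mult.assoc mult.commute mult.right_neutral, metis mult.assoc mult.commute mult.right_neutral,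
        metis mult.assoc mult.commute mult.right_neutral, metis complex_cnj_mult mult.assoc mult.commute)
    show ?thesis
      unfolding T1 T2 T3' x c_def
      by (simp add: mat2_entries 1) (simp add: complex_eq_iff algebra_simps)
  qed
  ultimately show thesis using that by blast
qed

lemma canonical_map_derivative:
  assumes "(r, p, q) \<in> cyl \<epsilon>" "\<epsilon> > 0" "\<beta> \<in> su2"
  shows "frechet_derivative (canonical_map \<epsilon> c) (at (r, p, q)) (s, p ** \<alpha>, q ** \<beta>) =
    (cyl_field \<epsilon> s \<alpha> \<beta> (r, p, q), c ** (q ** \<beta>) ** cadj c)"
proof -
  have r: "r > \<epsilon>" using assms(1) by (simp add: cyl_def)
  have bl: "bounded_linear (\<lambda>m. c ** m ** cadj c)"
    by (rule bounded_linear_compose[OF matrix_mult.bounded_linear_left matrix_mult.bounded_linear_right])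
  have "((\<lambda>x :: cyl. snd (snd x)) has_derivative (\<lambda>v. snd (snd v))) (at (r, p, q))"
    by (auto intro!: derivative_eq_intros)
  note d = has_derivative_Pair[OF cyl_map_has_derivative(1)[OF assms(2) r, of p q]
      bounded_linear.has_derivative[OF bl this]]
  have "canonical_map \<epsilon> c = (\<lambda>x. (cyl_map \<epsilon> x, c ** snd (snd x) ** cadj c))"
    by (auto simp: fun_eq_iff canonical_map_def bundle_map_def matrix_mul_rid)
  then show ?thesis
    by (simp only: frechet_derivative_at[OF d, symmetric] snd_conv
        cyl_map_has_derivative(2)[OF assms(2) r assms(3)])
qed

lemma canonical_map_eq: "canonical_map \<epsilon> c (r, p, q) = (cyl_map \<epsilon> (r, p, q), c ** q ** cadj c)"
  by (simp add: canonical_map_def bundle_map_def matrix_mul_rid)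

lemma agree_A_cyl:
  assumes \<epsilon>: "\<epsilon> > 0" and c: "c \<in> SU2"
    and frame: "\<And>x y w. c ** pure_quat x y w ** cadj c = x *\<^sub>R T1 + y *\<^sub>R T3 - w *\<^sub>R T2"
  shows "agree_on_cyl \<epsilon> 1 (pullback (canonical_map \<epsilon> c) (connection_form (gauge_potential \<epsilon> c)))
    (A_cyl \<epsilon> T1 T2 T3)"
  unfolding agree_on_cyl_def
proof (intro ballI allI impI, elim conjE)
  fix x :: cyl and vs assume x: "x \<in> cyl \<epsilon>" and vs: "length vs = 1" "set vs \<subseteq> T_cyl x"
  obtain r p q where xe: "x = (r, p, q)" by (cases x)
  note x' = x[unfolded xe]
  have q: "q \<in> SU2" using x' by (simp add: cyl_def)
  obtain v where v: "vs = [v]" using vs(1) by (auto simp: length_Suc_conv)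
  obtain s \<alpha> \<beta> where ve: "v = (s, p ** \<alpha>, q ** \<beta>)" and ab: "\<alpha> \<in> su2" "\<beta> \<in> su2"
    using T_cyl_E[OF x', of v] vs(2) unfolding v xe by auto
  obtain a1 a2 a3 b1 b2 b3 where im: "\<alpha> = pure_quat a1 a2 a3" "\<beta> = pure_quat b1 b2 b3"
    using ab unfolding su2_iff by blast
  have "pullback (canonical_map \<epsilon> c) (connection_form (gauge_potential \<epsilon> c)) x vs =
      cadj (c ** q ** cadj c) ** (c ** (q ** (inv_potential \<epsilon> r \<alpha> \<beta> - \<beta>) ** cadj q) ** cadj c) ** (c ** q ** cadj c)
      + cadj (c ** q ** cadj c) ** (c ** (q ** \<beta>) ** cadj c)"
    unfolding pullback_def xe v ve list.map canonical_map_derivative[OF x' \<epsilon> ab(2)] canonical_map_eq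
      connection_form_def gauge_potential_def
    by (simp add: potential_cyl_field[OF x' \<epsilon> ab])
  also have "\<dots> = c ** inv_potential \<epsilon> r \<alpha> \<beta> ** cadj c"
    by (simp add: cadj_mult cadj_simps matrix_ring SU2_cancel[OF q] SU2_cancel[OF c])
  also have "\<dots> = A_cyl \<epsilon> T1 T2 T3 x vs"
    unfolding im inv_potential_pure_quat frame
    by (simp add: A_cyl_def A_can_def xe v ve theta_left_invariant[OF x'] im X_coord_pure_quat
        Let_def algebra_simps add_divide_distrib)
  finally show "pullback (canonical_map \<epsilon> c) (connection_form (gauge_potential \<epsilon> c)) x vs =
      A_cyl \<epsilon> T1 T2 T3 x vs" .
qed

lemma frame_inv_curvature:
  assumes x: "(r, p, q) \<in> cyl \<epsilon>" and \<epsilon>: "\<epsilon> > 0"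
    and frame: "\<And>x y w. c ** pure_quat x y w ** cadj c = x *\<^sub>R T1 + y *\<^sub>R T3 - w *\<^sub>R T2"
    and su2: "\<alpha>1 \<in> su2" "\<beta>1 \<in> su2" "\<alpha>2 \<in> su2" "\<beta>2 \<in> su2"
  shows "c ** inv_curvature \<epsilon> r s1 \<alpha>1 \<beta>1 s2 \<alpha>2 \<beta>2 ** cadj c =
    F_cyl \<epsilon> T1 T2 T3 (r, p, q) [(s1, p ** \<alpha>1, q ** \<beta>1), (s2, p ** \<alpha>2, q ** \<beta>2)]"
proof -
  have r: "r > \<epsilon>" using x by (simp add: cyl_def)
  obtain a1 a2 a3 b1 b2 b3 where im1: "\<alpha>1 = pure_quat a1 a2 a3" "\<beta>1 = pure_quat b1 b2 b3"
    using su2 unfolding su2_iff by blast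
  obtain a1' a2' a3' b1' b2' b3' where im2: "\<alpha>2 = pure_quat a1' a2' a3'" "\<beta>2 = pure_quat b1' b2' b3'"
    using su2 unfolding su2_iff by blast
  define k l m where "k = (Rminus \<epsilon> r)\<^sup>2 / (Rplus \<epsilon> r)\<^sup>2" and "l = \<epsilon> / (2 * Rplus \<epsilon> r)"
    and "m = \<epsilon> / 4 * (r / Rplus \<epsilon> r ^ 3)"
  show ?thesis
    unfolding inv_curvature_pure_quat[OF \<epsilon> r im1 im2] frame
    unfolding F_cyl_def theta2_def wedge_1_1
      theta_left_invariant[OF x] im1 im2 X_coord_pure_quat Let_def dr_def list.sel fst_conv real_scaleR_def
      k_def[symmetric] l_def[symmetric] m_def[symmetric]
    by (simp add: algebra_simps)
qed

lemma curvature_gauge_potential: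
  assumes "\<epsilon> > 0" "c \<in> SU2"
  shows "curvature (gauge_potential \<epsilon> c) z [u, v] =
    c ** curvature (\<lambda>z vs. potential \<epsilon> z (hd vs)) z [u, v] ** cadj c"
proof -
  have "(\<lambda>z. potential \<epsilon> z v) differentiable (at z)" for v
    using smooth_on_has_derivative[OF smooth_potential[OF assms(1)]] differentiableI by blast
  then show ?thesis
    unfolding gauge_potential_def[abs_def]
    using curvature_conj[of "\<lambda>z vs. potential \<epsilon> z (hd vs)", OF _ assms(2)] by simp
qed

lemma curvature_gauge_cyl_field:
  assumes x: "(r, p, q) \<in> cyl \<epsilon>" and \<epsilon>: "\<epsilon> > 0" and c: "c \<in> SU2"
    and frame: "\<And>x y w. c ** pure_quat x y w ** cadj c = x *\<^sub>R T1 + y *\<^sub>R T3 - w *\<^sub>R T2"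
    and su2: "\<alpha>1 \<in> su2" "\<beta>1 \<in> su2" "\<alpha>2 \<in> su2" "\<beta>2 \<in> su2"
  shows "curvature (gauge_potential \<epsilon> c) (cyl_map \<epsilon> (r, p, q))
      [cyl_field \<epsilon> s1 \<alpha>1 \<beta>1 (r, p, q), cyl_field \<epsilon> s2 \<alpha>2 \<beta>2 (r, p, q)] =
    (c ** q ** cadj c) ** F_cyl \<epsilon> T1 T2 T3 (r, p, q) [(s1, p ** \<alpha>1, q ** \<beta>1), (s2, p ** \<alpha>2, q ** \<beta>2)]
      ** cadj (c ** q ** cadj c)"
  unfolding curvature_gauge_potential[OF \<epsilon> c] curvature_cyl_field[OF x \<epsilon> su2]
    frame_inv_curvature[OF x \<epsilon> frame su2, symmetric]
  by (simp add: cadj_mult cadj_simps matrix_ring SU2_cancel[OF c])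

lemma agree_F_cyl:
  assumes \<epsilon>: "\<epsilon> > 0" and c: "c \<in> SU2"
    and frame: "\<And>x y w. c ** pure_quat x y w ** cadj c = x *\<^sub>R T1 + y *\<^sub>R T3 - w *\<^sub>R T2"
  shows "agree_on_cyl \<epsilon> 2 (pullback (canonical_map \<epsilon> c) (curvature_form (gauge_potential \<epsilon> c)))
    (F_cyl \<epsilon> T1 T2 T3)"
  unfolding agree_on_cyl_def
proof (intro ballI allI impI, elim conjE)
  fix x :: cyl and vs assume x: "x \<in> cyl \<epsilon>" and vs: "length vs = 2" "set vs \<subseteq> T_cyl x"
  obtain r p q where xe: "x = (r, p, q)" by (cases x)
  note x' = x[unfolded xe]
  have q: "q \<in> SU2" using x' by (simp add: cyl_def)
  obtain v1 v2 where v: "vs = [v1, v2]" using length_eq_numeral(1)[OF vs(1)] by blast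
  obtain s1 \<alpha>1 \<beta>1 where v1: "v1 = (s1, p ** \<alpha>1, q ** \<beta>1)" and ab1: "\<alpha>1 \<in> su2" "\<beta>1 \<in> su2"
    using T_cyl_E[OF x', of v1] vs(2) unfolding v xe by auto
  obtain s2 \<alpha>2 \<beta>2 where v2: "v2 = (s2, p ** \<alpha>2, q ** \<beta>2)" and ab2: "\<alpha>2 \<in> su2" "\<beta>2 \<in> su2"
    using T_cyl_E[OF x', of v2] vs(2) unfolding v xe by auto
  show "pullback (canonical_map \<epsilon> c) (curvature_form (gauge_potential \<epsilon> c)) x vs = F_cyl \<epsilon> T1 T2 T3 x vs"
    unfolding pullback_def xe v v1 v2 list.map canonical_map_derivative[OF x' \<epsilon> ab1(2)]
      canonical_map_derivative[OF x' \<epsilon> ab2(2)] canonical_map_eq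
      curvature_form_def split_beta fst_conv snd_conv curvature_gauge_cyl_field[OF x' \<epsilon> c frame ab1 ab2]
    by (simp add: cadj_mult cadj_simps matrix_ring SU2_cancel[OF c] SU2_cancel[OF q])
qed

section \<open>The cylinder covers the complement of the zero section\<close>

lemma su2_rotate:
  assumes "n \<in> su2" "inner n n = 2"
  obtains q where "q \<in> SU2" "q ** quat_i ** cadj q = n"
proof -
  obtain a b c where n: "n = pure_quat a b c" using assms(1) su2_iff by blast
  have abc: "a * a + b * b + c * c = 1"
    using assms(2) by (simp add: n inner_mat2 pure_quat_nth)
  show thesis
  proof (cases "1 + a = 0")
    case True
    then have "a = -1" by simp
    moreover from this have "b * b + c * c = 0" using abc by simp
    then have "b = 0" "c = 0" by (simp_all add: sum_squares_eq_zero_iff)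
    ultimately have "pure_quat 0 1 0 ** quat_i ** cadj (pure_quat 0 1 0) = n"
      by (simp add: n mat2_entries complex_eq_iff)
    moreover have "pure_quat 0 1 0 \<in> SU2"
      by (simp add: SU2_iff quat_simps inner_mat2 pure_quat_nth)
    ultimately show thesis using that by blast
  next
    case False
    have "a * a \<le> 1 * 1" using abc by (smt (verit) mult_1 zero_le_square)
    then have "\<bar>a\<bar> \<le> 1" by (metis abs_le_square_iff abs_one power2_eq_square)
    then have a: "1 + a > 0" using False by linarith
    \<comment> \<open>The bisector of \<open>n\<close> and the first imaginary unit.\<close>
    define m where "m = mat 1 - n ** quat_i"
    define y where "y = inverse (sqrt (2 * (1 + a)))"
    have y: "y * y * (2 * (1 + a)) = 1"
      unfolding y_def inverse_mult_distrib[symmetric] using a by simp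
    have m: "m ** quat_i ** cadj m = (2 * (1 + a)) *\<^sub>R n"
    proof -
      have 0: "a * a = 1 - b * b - c * c"
        using abc by simp
      have 1: "a * (a * w) = w - b * (b * w) - c * (c * w)" for w
        unfolding mult.assoc[symmetric] 0 by (simp add: algebra_simps)
      show ?thesis
        by (simp add: m_def n mat2_entries complex_eq_iff algebra_simps 0 1)
    qed
    have "inner m m = 2 * (2 * (1 + a))"
      using abc by (simp add: m_def n inner_mat2 mat2_mult_nth mat_nth pure_quat_nth diag2_nth algebra_simps)
    then have "inner (y *\<^sub>R m) (y *\<^sub>R m) = 2 * (y * y * (2 * (1 + a)))" by simp
    then have "inner (y *\<^sub>R m) (y *\<^sub>R m) = 2" unfolding y by simp
    moreover have "quat (y *\<^sub>R m)"
      unfolding m_def n quat_i_eq by (intro quat_simps)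
    moreover have "(y *\<^sub>R m) ** quat_i ** cadj (y *\<^sub>R m) = (y * y) *\<^sub>R (m ** quat_i ** cadj m)"
      by (simp add: cadj_simps matrix_ring)
    then have "(y *\<^sub>R m) ** quat_i ** cadj (y *\<^sub>R m) = n"
      unfolding m scaleR_scaleR y by simp
    ultimately show thesis using that unfolding SU2_iff by blast
  qed
qed

lemma quat_inner_zero_su2: "quat m \<Longrightarrow> inner (mat 1) m = 0 \<Longrightarrow> m \<in> su2"
  unfolding su2_iff
  by (rule exI[of _ "Im (m$1$1)"], rule exI[of _ "Re (m$1$2)"], rule exI[of _ "Im (m$1$2)"])
    (simp add: quat_def mat2_entries complex_eq_iff inner_mat2)

text \<open>
  Polar decomposition: \<open>x = R\<^sub>+ U\<close> and \<open>y = R\<^sub>- U n\<close> with unit quaternions \<open>U\<close>, \<open>n\<close>, and \<open>n\<close> is imaginary since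
  \<open>x \<bottom> y\<close>.  A \<open>q\<close> that rotates \<open>T\<^sub>1\<close> to \<open>n\<close> and \<open>p = U q\<close> do the job.
\<close>

lemma cyl_map_surj:
  assumes \<epsilon>: "\<epsilon> > 0" and z: "z \<in> Xeps \<epsilon>" and nz: "quat_Im z \<noteq> 0"
  obtains r p q where "(r, p, q) \<in> cyl \<epsilon>" "cyl_map \<epsilon> (r, p, q) = z"
proof -
  define X Y where "X = quat_Re z" and "Y = quat_Im z"
  define R S where "R = sqrt (inner X X / 2)" and "S = sqrt (inner Y Y / 2)"
  define r where "r = norm z"
  have XY: "inner X X - inner Y Y = 2 * \<epsilon>\<^sup>2" "inner X Y = 0"
    using z unfolding Xeps_iff X_def Y_def by auto
  have Y: "inner Y Y > 0" using nz by (simp add: Y_def)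
  have \<epsilon>2: "\<epsilon>\<^sup>2 > 0" using \<epsilon> by simp
  then have X: "inner X X > 0" using XY Y by linarith
  have R: "R > 0" "R\<^sup>2 = inner X X / 2" and S: "S > 0" "S\<^sup>2 = inner Y Y / 2"
    using X Y by (simp_all add: R_def S_def)
  have r2: "r\<^sup>2 = R\<^sup>2 + S\<^sup>2"
    by (simp add: r_def power2_norm_eq_inner inner_C4 X_def[symmetric] Y_def[symmetric] R S)
  have RS: "R\<^sup>2 = S\<^sup>2 + \<epsilon>\<^sup>2" using XY R S by simp
  have "r\<^sup>2 > \<epsilon>\<^sup>2" using r2 RS S(1) by simp
  then have r: "r > \<epsilon>" using power2_less_imp_less[of \<epsilon> r] by (simp add: r_def)
  have Rp: "Rplus \<epsilon> r = R" "Rminus \<epsilon> r = S"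
    unfolding Rplus_def Rminus_def r2 using RS R(1) S(1)
    by (auto intro: real_sqrt_unique)
  define U where "U = inverse R *\<^sub>R X"
  have U: "U \<in> SU2"
    using R by (simp add: U_def SU2_iff quat_simps quat_re_im X_def[symmetric])
      (simp add: field_simps power2_eq_square quat_simps quat_re_im X_def)
  define n where "n = inverse S *\<^sub>R (cadj U ** Y)"
  have UY: "U ** n = inverse S *\<^sub>R Y"
    by (simp add: n_def matrix_ring SU2_cancel[OF U])
  have "inner n n = inner (U ** n) (U ** n)" using inner_SU2_left[OF U] by simp
  also have "\<dots> = 2" unfolding UY using S by (simp add: field_simps power2_eq_square)
  finally have nn: "inner n n = 2" .
  have "inner (mat 1) n = inner (U ** mat 1) (U ** n)" using inner_SU2_left[OF U] by metis
  also have "\<dots> = 0" unfolding UY using XY(2) by (simp add: matrix_ring U_def)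
  finally have "n \<in> su2"
    by (intro quat_inner_zero_su2) (auto simp: n_def Y_def intro!: quat_simps quat_re_im SU2_quat[OF U])
  then obtain q where q: "q \<in> SU2" "q ** quat_i ** cadj q = n"
    using su2_rotate nn by blast
  define p where "p = U ** q"
  have "p ** (R *\<^sub>R mat 1) ** cadj q = X"
    using R by (simp add: p_def matrix_ring SU2_cancel[OF q(1)] U_def)
  moreover have "p ** (S *\<^sub>R quat_i) ** cadj q = S *\<^sub>R (U ** (q ** quat_i ** cadj q))"
    by (simp add: p_def matrix_ring)
  then have "p ** (S *\<^sub>R quat_i) ** cadj q = Y"
    unfolding q(2) UY using S by simp
  ultimately have "cyl_map \<epsilon> (r, p, q) = z"
    by (simp add: cyl_map_eq Rp X_def Y_def of_quats_re_im)
  moreover have "(r, p, q) \<in> cyl \<epsilon>"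
    using r q(1) SU2_mult[OF U q(1)] by (simp add: cyl_def p_def)
  ultimately show thesis using that by blast
qed

lemma quat_decompose:
  assumes "quat m"
  obtains t d where "m = t *\<^sub>R mat 1 + pure_quat (fst d) (fst (snd d)) (snd (snd d))"
  using assms
  by (intro that[of "Re (m$1$1)" "(Im (m$1$1), Re (m$1$2), Im (m$1$2))"])
    (simp add: quat_def mat2_entries complex_eq_iff)

text \<open>
  The tangent vector, moved to \<open>p = q = 1\<close>, has two quaternionic components \<open>A\<close>, \<open>B\<close> which determine \<open>s\<close>, \<open>\<alpha> - \<beta>\<close> and the
  part of \<open>\<alpha> + \<beta>\<close> orthogonal to \<open>T\<^sub>1\<close>.  The \<open>T\<^sub>1\<close>-component of \<open>\<alpha> + \<beta>\<close> is tangent to the orbits of \<open>H\<close>; it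
  is taken to be zero.
\<close>

lemma cyl_field_surj:
  assumes x: "(r, p, q) \<in> cyl \<epsilon>" and \<epsilon>: "\<epsilon> > 0" and u: "u \<in> T_Xeps (cyl_map \<epsilon> (r, p, q))"
  obtains s \<alpha> \<beta> where "\<alpha> \<in> su2" "\<beta> \<in> su2" "u = cyl_field \<epsilon> s \<alpha> \<beta> (r, p, q)"
proof -
  have pq: "p \<in> SU2" "q \<in> SU2" and r: "r > \<epsilon>" using x by (auto simp: cyl_def)
  define R S where "R = Rplus \<epsilon> r" and "S = Rminus \<epsilon> r"
  have RS: "R > 0" "S > 0" "r > 0"
    using Rplus_pos[OF \<epsilon>] Rminus_pos[OF \<epsilon> r] r \<epsilon> by (simp_all add: R_def S_def)
  define A B where "A = cadj p ** quat_Re u ** q" and "B = cadj p ** quat_Im u ** q"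
  have AB: "quat_Re u = p ** A ** cadj q" "quat_Im u = p ** B ** cadj q"
    by (simp_all add: A_def B_def matrix_ring SU2_cancel[OF pq(1)] SU2_cancel[OF pq(2)])
  have "quat A" "quat B"
    unfolding A_def B_def by (intro quat_simps quat_re_im SU2_quat pq)+
  then obtain t d m e where A: "A = t *\<^sub>R mat 1 + pure_quat (fst d) (fst (snd d)) (snd (snd d))"
    and B: "B = m *\<^sub>R mat 1 + pure_quat (fst e) (fst (snd e)) (snd (snd e))"
    using quat_decompose by metis
  obtain d1 d2 d3 e1 e2 e3 where de: "d = (d1, d2, d3)" "e = (e1, e2, e3)"
    by (metis prod_cases3)
  have qq: "quat (p ** (a *\<^sub>R mat 1) ** cadj q)" "quat (p ** (b *\<^sub>R quat_i) ** cadj q)" for a b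
    by (intro quat_simps SU2_quat[OF pq(1)] SU2_quat[OF pq(2)] su2_quat[OF su2_lin(4)])+
  have "inner (R *\<^sub>R mat 1) A = inner (S *\<^sub>R quat_i) B \<and> inner (R *\<^sub>R mat 1) B + inner (S *\<^sub>R quat_i) A = 0"
    using u unfolding T_Xeps_iff cyl_map_eq re_im_of_quats[OF qq] AB inner_SU2_conj[OF pq] R_def S_def .
  then have c: "R * t = S * e1" "R * m + S * d1 = 0"
    unfolding A B de by (simp_all add: inner_mat2 mat_nth diag2_nth pure_quat_nth)
  define \<alpha> where "\<alpha> = pure_quat (d1 / (2 * R)) ((d2 / R - e3 / S) / 2) ((d3 / R + e2 / S) / 2)"
  define \<beta> where "\<beta> = pure_quat (- d1 / (2 * R)) ((- d2 / R - e3 / S) / 2) ((- d3 / R + e2 / S) / 2)"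
  define s where "s = t * (2 * R) / r"
  have m: "m = - S * d1 / R" and e1: "e1 = R * t / S"
    using c RS by (simp_all add: field_simps)
  have "cyl_re \<epsilon> s \<alpha> \<beta> r = A"
    unfolding cyl_re_def R_def[symmetric] A de \<alpha>_def \<beta>_def s_def
    using RS by (simp add: mat2_entries complex_eq_iff field_simps)
  moreover have "cyl_im \<epsilon> s \<alpha> \<beta> r = B"
    unfolding cyl_im_def S_def[symmetric] B de \<alpha>_def \<beta>_def s_def m e1
    using RS by (simp add: mat2_entries complex_eq_iff field_simps)
  ultimately have "cyl_field \<epsilon> s \<alpha> \<beta> (r, p, q) = u"
    by (simp add: cyl_field_def AB[symmetric] of_quats_re_im)
  moreover have "\<alpha> \<in> su2" "\<beta> \<in> su2"
    unfolding \<alpha>_def \<beta>_def su2_iff by blast+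
  ultimately show thesis using that by blast
qed


section \<open>The Hermitian Yang-Mills equations\<close>

lemma wedge_pullback:
  "wedge k l \<alpha> \<beta> (f x) (map D ws) = wedge k l (\<lambda>x vs. \<alpha> (f x) (map D vs)) (\<lambda>x vs. \<beta> (f x) (map D vs)) x ws"
  by (simp add: wedge_def nths_map)

text \<open>
  The orthogonal projection onto the tangent space of the quadric through \<open>z\<close>; its kernel is spanned by the
  conjugate of \<open>z\<close>.  It moves tangent vectors at the zero section to nearby points.
\<close>

definition tangent_proj :: "complex^4 \<Rightarrow> complex^4 \<Rightarrow> complex^4" where
  "tangent_proj z w = (\<chi> i. w $ i - (\<Sum>j\<in>UNIV. z $ j * w $ j) / of_real ((norm z)\<^sup>2) * cnj (z $ i))"

lemma tangent_proj:
  assumes "z \<noteq> 0"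
  shows "tangent_proj z w \<in> T_Xeps z" "w \<in> T_Xeps z \<Longrightarrow> tangent_proj z w = w"
proof -
  have n: "(\<Sum>i\<in>UNIV. z $ i * cnj (z $ i)) = of_real ((norm z)\<^sup>2)"
    by (simp add: norm_vec_def L2_set_def sum_nonneg complex_norm_square[symmetric])
  define k where "k = (\<Sum>j\<in>UNIV. z $ j * w $ j) / of_real ((norm z)\<^sup>2)"
  have "(\<Sum>i\<in>UNIV. z $ i * tangent_proj z w $ i) =
      (\<Sum>i\<in>UNIV. z $ i * w $ i) - k * (\<Sum>i\<in>UNIV. z $ i * cnj (z $ i))"
    unfolding tangent_proj_def k_def[symmetric]
    by (simp add: right_diff_distrib sum_subtractf sum_distrib_left mult_ac)
  also have "\<dots> = 0"
    unfolding n k_def using assms by simp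
  finally show "tangent_proj z w \<in> T_Xeps z" by (simp add: T_Xeps_def)
  show "w \<in> T_Xeps z \<Longrightarrow> tangent_proj z w = w"
    by (simp add: tangent_proj_def T_Xeps_def vec_eq_iff)
qed

lemma tangent_proj_tendsto:
  assumes "(z \<longlongrightarrow> z0) F" "z0 \<noteq> 0"
  shows "((\<lambda>s. tangent_proj (z s) w) \<longlongrightarrow> tangent_proj z0 w) F"
  unfolding tangent_proj_def
  by (intro tendsto_vec_lambda tendsto_intros assms(1)) (use assms(2) in auto)

text \<open>
  Off the zero section \<open>y\<close> has to be orthogonal to \<open>x\<close>, and \<open>x\<close> times an imaginary unit is.
\<close>

lemma zero_section_limit:
  assumes \<epsilon>: "\<epsilon> > 0" and z0: "z0 \<in> Xeps \<epsilon>" "quat_Im z0 = 0"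
  obtains z where "(z \<longlongrightarrow> z0) (at_right (0 :: real))"
    "\<And>s. s > 0 \<Longrightarrow> z s \<in> Xeps \<epsilon> \<and> quat_Im (z s) \<noteq> 0"
proof -
  define X where "X = quat_Re z0"
  have X: "inner X X = 2 * \<epsilon>\<^sup>2" "quat X"
    using z0 by (simp_all add: Xeps_iff X_def quat_re_im)
  have XI: "quat (X ** quat_i)" unfolding quat_i_eq by (intro quat_simps X)
  have i: "inner X (X ** quat_i) = 0" "inner (X ** quat_i) (X ** quat_i) = inner X X"
    using X(2) by (simp_all add: quat_def inner_mat2 mat2_mult_nth diag2_nth)
  define z where "z s = of_quats ((sqrt (\<epsilon>\<^sup>2 + s\<^sup>2) / \<epsilon>) *\<^sub>R X) ((s / \<epsilon>) *\<^sub>R (X ** quat_i))" for s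
  have re_im: "quat_Re (z s) = (sqrt (\<epsilon>\<^sup>2 + s\<^sup>2) / \<epsilon>) *\<^sub>R X" "quat_Im (z s) = (s / \<epsilon>) *\<^sub>R (X ** quat_i)" for s
    unfolding z_def by (rule re_im_of_quats; intro quat_simps X XI)+
  have "z s \<in> Xeps \<epsilon> \<and> quat_Im (z s) \<noteq> 0" if "s > 0" for s
  proof
    have "sqrt (\<epsilon>\<^sup>2 + s\<^sup>2) * sqrt (\<epsilon>\<^sup>2 + s\<^sup>2) = \<epsilon>\<^sup>2 + s\<^sup>2" by simp
    then show "z s \<in> Xeps \<epsilon>"
      unfolding Xeps_iff re_im using i X \<epsilon>
      by (simp add: field_simps power2_eq_square)
    have "inner (X ** quat_i) (X ** quat_i) > 0" using i X \<epsilon> by simp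
    then show "quat_Im (z s) \<noteq> 0"
      unfolding re_im using that \<epsilon> by auto
  qed
  moreover have "((\<lambda>s. ((sqrt (\<epsilon>\<^sup>2 + s\<^sup>2) / \<epsilon>) *\<^sub>R X, (s / \<epsilon>) *\<^sub>R (X ** quat_i))) \<longlongrightarrow>
      ((sqrt (\<epsilon>\<^sup>2 + 0\<^sup>2) / \<epsilon>) *\<^sub>R X, (0 / \<epsilon>) *\<^sub>R (X ** quat_i))) (at_right 0)"
    using \<epsilon> by (intro tendsto_intros) auto
  then have "(z \<longlongrightarrow> of_quats X 0) (at_right 0)"
    using bounded_linear.tendsto[OF bounded_linear_of_quats] \<epsilon> by (force simp: z_def[abs_def])
  then have "(z \<longlongrightarrow> z0) (at_right 0)"
    using of_quats_re_im[of z0] z0(2) by (simp add: X_def)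
  ultimately show thesis using that by blast
qed

lemma wedge_tendsto:
  fixes \<alpha> :: "('p, 'b::real_normed_vector) form" and \<beta> :: "('p, real) form"
  assumes "length ws = k + l"
    and "\<And>us. length us = k \<Longrightarrow> set us \<subseteq> set ws \<Longrightarrow> ((\<lambda>s. \<alpha> (z s) (map (P s) us)) \<longlongrightarrow> \<alpha> z0 (map Q us)) F"
    and "\<And>us. length us = l \<Longrightarrow> set us \<subseteq> set ws \<Longrightarrow> ((\<lambda>s. \<beta> (z s) (map (P s) us)) \<longlongrightarrow> \<beta> z0 (map Q us)) F"
  shows "((\<lambda>s. wedge k l \<alpha> \<beta> (z s) (map (P s) ws)) \<longlongrightarrow> wedge k l \<alpha> \<beta> z0 (map Q ws)) F"
proof -
  have "((\<lambda>s. \<alpha> (z s) (map (P s) (nths ws S))) \<longlongrightarrow> \<alpha> z0 (map Q (nths ws S))) F"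
    "((\<lambda>s. \<beta> (z s) (map (P s) (nths ws (- S)))) \<longlongrightarrow> \<beta> z0 (map Q (nths ws (- S)))) F"
    if S: "S \<subseteq> {..<k + l}" "card S = k" for S
    using assms(2,3) length_nths_shuffle[OF assms(1) S] by (simp_all add: set_nths_subset)
  note lim = this
  show ?thesis
    unfolding wedge_def nths_map
  proof (rule tendsto_sum)
    fix S assume "S \<in> {S. S \<subseteq> {..<k + l} \<and> card S = k}"
    then have S: "S \<subseteq> {..<k + l}" "card S = k" by auto
    show "((\<lambda>s. ((- 1) ^ card {(i, j). i \<in> S \<and> j \<in> {..<k + l} - S \<and> j < i} *
        \<beta> (z s) (map (P s) (nths ws (- S)))) *\<^sub>R \<alpha> (z s) (map (P s) (nths ws S))) \<longlongrightarrow>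
      ((- 1) ^ card {(i, j). i \<in> S \<and> j \<in> {..<k + l} - S \<and> j < i} *
        \<beta> z0 (map Q (nths ws (- S)))) *\<^sub>R \<alpha> z0 (map Q (nths ws S))) F"
      by (intro tendsto_scaleR tendsto_mult tendsto_const lim[OF S])
  qed
qed

lemma smooth_form_tendsto:
  fixes \<alpha> :: "(complex^4, 'b::real_normed_vector) form"
  assumes "smooth_form_near k X \<alpha>" "z0 \<in> X" "(z \<longlongrightarrow> z0) F" "length us = k"
    and "\<And>w. w \<in> set us \<Longrightarrow> ((\<lambda>s. P s w) \<longlongrightarrow> Q w) F"
  shows "((\<lambda>s. \<alpha> (z s) (map (P s) us)) \<longlongrightarrow> \<alpha> z0 (map Q us)) F"
proof -
  obtain U where U: "open U" "z0 \<in> U" "\<And>z. z \<in> U \<Longrightarrow> alternating_multilinear k (\<alpha> z)"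
    "\<And>vs. length vs = k \<Longrightarrow> smooth_on U (\<lambda>z. \<alpha> z vs)"
    using assms(1,2) unfolding smooth_form_near_def by blast
  have ml: "multilinear_on_lists k (\<alpha> z)" if "z \<in> U" for z
    using U(3)[OF that] by (simp add: multilinear_on_lists_def alternating_multilinear_def)
  show ?thesis
  proof (rule multilinear_tendsto[OF _ ml[OF U(2)] _ assms(5,4)])
    show "\<forall>\<^sub>F s in F. multilinear_on_lists k (\<alpha> (z s))"
      using topological_tendstoD[OF assms(3) U(1,2)] by eventually_elim (rule ml)
    show "((\<lambda>s. \<alpha> (z s) vs) \<longlongrightarrow> \<alpha> z0 vs) F" if "length vs = k" for vs
      by (rule continuous_on_tendsto_compose[OF smooth_on_continuous_on[OF U(4)[OF that]] assms(3) U(2)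
            topological_tendstoD[OF assms(3) U(1,2)]])
  qed
qed

text \<open>
  The curvature of a smooth potential is multilinear in the tangent vectors, as a derivative of a linear family
  is linear in its parameter, and it is continuous for fixed vectors.
\<close>

lemma curvature_tendsto:
  assumes \<epsilon>: "\<epsilon> > 0" and z: "(z \<longlongrightarrow> z0) F" and us: "length us = 2"
    and P: "\<And>w. w \<in> set us \<Longrightarrow> ((\<lambda>s. P s w) \<longlongrightarrow> Q w) F"
  shows "((\<lambda>s. curvature (gauge_potential \<epsilon> c) (z s) (map (P s) us)) \<longlongrightarrow>
    curvature (gauge_potential \<epsilon> c) z0 (map Q us)) F"
proof -
  define G where "G y v = c ** potential \<epsilon> y v ** cadj c" for y v
  have bl: "bounded_linear (\<lambda>m. c ** m ** cadj c)"
    by (rule bounded_linear_compose[OF matrix_mult.bounded_linear_left matrix_mult.bounded_linear_right])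
  have G: "linear (G y)" for y
    using linear_compose[OF linear_potential bounded_linear.linear[OF bl]] by (simp add: o_def G_def[abs_def])
  have sm: "smooth_on UNIV (\<lambda>y. G y v)" for v
    unfolding G_def using smooth_on_intros(3)[OF open_UNIV bl smooth_potential[OF \<epsilon>]] .
  define D where "D y u v = frechet_derivative (\<lambda>y. G y v) (at y) u" for y u v
  have d: "((\<lambda>y. G y v) has_derivative (\<lambda>u. D y u v)) (at y)" for y v
    unfolding D_def using smooth_on_has_derivative[OF sm] by simp
  have D1: "linear (\<lambda>u. D y u v)" for y v
    using has_derivative_linear[OF d] .
  have D2: "linear (\<lambda>v. D y u v)" for y u
  proof (rule linearI)
    have "((\<lambda>y. G y (v + w)) has_derivative (\<lambda>u. D y u v + D y u w)) (at y)" for v w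
      unfolding linear_add[OF G] by (intro derivative_intros d)
    from has_derivative_unique[OF d this] show "D y u (v + w) = D y u v + D y u w" for v w
      by metis
    have "((\<lambda>y. G y (t *\<^sub>R v)) has_derivative (\<lambda>u. t *\<^sub>R D y u v)) (at y)" for t v
      unfolding linear_scale[OF G] by (intro derivative_intros d)
    from has_derivative_unique[OF d this] show "D y u (t *\<^sub>R v) = t *\<^sub>R D y u v" for t v
      by metis
  qed
  have K: "curvature (gauge_potential \<epsilon> c) y [u, v] = D y u v - D y v u + bracket (G y u) (G y v)" for y u v
    by (simp add: curvature_def ext_deriv1_def D_def G_def gauge_potential_def)
  have br: "linear (\<lambda>m. bracket m n)" "linear (\<lambda>m. bracket n m)" for n
    by (auto simp: linear_iff bracket_def matrix_ring algebra_simps)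
  have ml: "multilinear_on_lists 2 (curvature (gauge_potential \<epsilon> c) y)" for y
    unfolding multilinear_on_lists_def
  proof (intro allI impI)
    fix vs :: "(complex^4) list" and i :: nat assume "length vs = 2" "i < 2"
    then obtain a b where vs: "vs = [a, b]" using length_eq_numeral(1) by blast
    have "linear (\<lambda>u. D y u b - D y b u + bracket (G y u) (G y b))"
      "linear (\<lambda>u. D y a u - D y u a + bracket (G y a) (G y u))"
      using linear_compose[OF G br(1)] linear_compose[OF G br(2)]
      by (auto intro!: linear_compose_add linear_compose_sub D1 D2 simp: o_def)
    moreover have "i = 0 \<or> i = 1" using \<open>i < 2\<close> by auto
    ultimately show "linear (\<lambda>u. curvature (gauge_potential \<epsilon> c) y (vs[i := u]))"
      by (auto simp: vs K)
  qed
  have cont: "((\<lambda>s. f (z s)) \<longlongrightarrow> f z0) F" if "smooth_on UNIV f" for f :: "complex^4 \<Rightarrow> mat2"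
    by (rule continuous_on_tendsto_compose[OF smooth_on_continuous_on[OF that] z]) auto
  have "((\<lambda>s. curvature (gauge_potential \<epsilon> c) (z s) vs) \<longlongrightarrow> curvature (gauge_potential \<epsilon> c) z0 vs) F"
    if "length vs = 2" for vs
  proof -
    obtain a b where vs: "vs = [a, b]" using length_eq_numeral(1)[OF \<open>length vs = 2\<close>] by blast
    show ?thesis
      unfolding vs K bracket_def D_def
      by (intro tendsto_intros matrix_mult.tendsto cont sm smooth_on_frechet_derivative)
  qed
  then show ?thesis
    using multilinear_tendsto[of 2 "\<lambda>s. curvature (gauge_potential \<epsilon> c) (z s)" F, OF _ ml _ P us] ml by simp
qed

text \<open>
  Off the zero section all forms are pulled back to the cylinder, where the curvature is conjugate to \<open>F_cyl\<close>.  For the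
  second equation it suffices that \<open>F \<and> \<omega> \<and> \<omega>\<close> vanishes, whatever the volume form is.
\<close>

lemma hermitian_yang_mills_gauge_potential:
  assumes \<epsilon>: "\<epsilon> > 0" and c: "c \<in> SU2"
    and frame: "\<And>x y w. c ** pure_quat x y w ** cadj c = x *\<^sub>R T1 + y *\<^sub>R T3 - w *\<^sub>R T2"
    and st: "stenzel_structure \<epsilon> \<omega> \<Omega>1 \<Omega>2"
  shows "hermitian_yang_mills \<epsilon> \<omega> \<Omega>1 (gauge_potential \<epsilon> c)"
proof -
  define K where "K = curvature (gauge_potential \<epsilon> c)"
  define W where "W = (\<lambda>z vs. wedge 2 2 \<omega> \<omega> z vs / 2)"
  have smooth: "smooth_form_near 2 (Xeps \<epsilon>) \<omega>" "smooth_form_near 3 (Xeps \<epsilon>) \<Omega>1"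
    using st unfolding stenzel_structure_def by blast+
  have off: "(length vs = 5 \<longrightarrow> wedge 2 3 K \<Omega>1 z vs = 0) \<and> (length vs = 6 \<longrightarrow> wedge 2 4 K W z vs = 0)"
    if z: "z \<in> Xeps \<epsilon>" "quat_Im z \<noteq> 0" and vs: "set vs \<subseteq> T_Xeps z" for z vs
  proof -
    obtain r p q where x: "(r, p, q) \<in> cyl \<epsilon>" and ze: "cyl_map \<epsilon> (r, p, q) = z"
      using cyl_map_surj[OF \<epsilon> z] by blast
    have r: "r > \<epsilon>" and q: "q \<in> SU2" using x by (auto simp: cyl_def)
    define x where "x = (r, p, q)"
    have xc: "x \<in> cyl \<epsilon>" and zx: "z = cyl_map \<epsilon> x"
      using \<open>(r, p, q) \<in> cyl \<epsilon>\<close> ze by (simp_all add: x_def)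
    define D where "D = frechet_derivative (cyl_map \<epsilon>) (at x)"
    have D: "D (s, p ** \<alpha>, q ** \<beta>) = cyl_field \<epsilon> s \<alpha> \<beta> (r, p, q)" if "\<beta> \<in> su2" for s \<alpha> \<beta>
      unfolding D_def x_def using cyl_map_has_derivative(2)[OF \<epsilon> r that] .
    have "\<exists>v. v \<in> T_cyl x \<and> D v = u" if "u \<in> T_Xeps z" for u
    proof -
      obtain s \<alpha> \<beta> where "\<alpha> \<in> su2" "\<beta> \<in> su2" "u = cyl_field \<epsilon> s \<alpha> \<beta> (r, p, q)"
        using cyl_field_surj[OF x \<epsilon>, of u] \<open>u \<in> T_Xeps z\<close> ze by metis
      then show ?thesis
        using x D by (intro exI[of _ "(s, p ** \<alpha>, q ** \<beta>)"])
          (simp add: T_cyl_def x_def cyl_def SU2_cancel)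
    qed
    then obtain L where L: "\<And>u. u \<in> T_Xeps z \<Longrightarrow> L u \<in> T_cyl x \<and> D (L u) = u" by metis
    have forms: "length us = 2 \<Longrightarrow> set us \<subseteq> T_cyl x \<Longrightarrow> \<omega> (cyl_map \<epsilon> x) (map D us) = omega_cyl \<epsilon> x us"
      "length us = 3 \<Longrightarrow> set us \<subseteq> T_cyl x \<Longrightarrow> \<Omega>1 (cyl_map \<epsilon> x) (map D us) = Omega1_cyl \<epsilon> x us" for us
      using st xc unfolding stenzel_structure_def agree_on_cyl_def pullback_def D_def by blast+
    define ws where "ws = map L vs"
    have ws: "vs = map D ws" "set ws \<subseteq> T_cyl x" "length ws = length vs"
      using vs L by (auto simp: ws_def o_def intro!: map_idI[symmetric])
    \<comment> \<open>The fibre coordinate of the canonical map at \<open>x\<close>.\<close>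
    define g where "g = c ** q ** cadj c"
    have Kx: "K (cyl_map \<epsilon> x) (map D us) = g ** F_cyl \<epsilon> T1 T2 T3 x us ** cadj g"
      if us: "length us = 2" "set us \<subseteq> set ws" for us
    proof -
      obtain v1 v2 where v: "us = [v1, v2]" using length_eq_numeral(1)[OF us(1)] by blast
      have "v1 \<in> T_cyl (r, p, q)" "v2 \<in> T_cyl (r, p, q)"
        using us(2) ws(2) by (auto simp: v x_def)
      then obtain s1 \<alpha>1 \<beta>1 s2 \<alpha>2 \<beta>2 where v12: "v1 = (s1, p ** \<alpha>1, q ** \<beta>1)" "v2 = (s2, p ** \<alpha>2, q ** \<beta>2)"
        and su: "\<alpha>1 \<in> su2" "\<beta>1 \<in> su2" "\<alpha>2 \<in> su2" "\<beta>2 \<in> su2"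
        using T_cyl_E[OF x] by metis
      show ?thesis
        unfolding v v12 list.map D[OF su(2)] D[OF su(4)] K_def g_def x_def
        by (rule curvature_gauge_cyl_field[OF x \<epsilon> c frame su])
    qed
    have lin: "linear (\<lambda>m. g ** m ** cadj g)"
      by (rule bounded_linear.linear[OF bounded_linear_compose[OF matrix_mult.bounded_linear_left matrix_mult.bounded_linear_right]])
    have "wedge 2 3 K \<Omega>1 z vs = 0" if "length vs = 5"
    proof -
      have "wedge 2 3 K \<Omega>1 z vs =
          wedge 2 3 (\<lambda>x us. g ** F_cyl \<epsilon> T1 T2 T3 x us ** cadj g) (Omega1_cyl \<epsilon>) x ws"
        unfolding ws(1) zx wedge_pullback
      proof (rule wedge_cong)
        show "\<Omega>1 (cyl_map \<epsilon> x) (map D us) = Omega1_cyl \<epsilon> x us" if "length us = 3" "set us \<subseteq> set ws" for us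
          using forms(2) that ws(2) by (meson order_trans)
        show "K (cyl_map \<epsilon> x) (map D us) = g ** F_cyl \<epsilon> T1 T2 T3 x us ** cadj g"
          if "length us = 2" "set us \<subseteq> set ws" for us
          by (rule Kx[OF that])
      qed (simp add: ws(3) \<open>length vs = _\<close>)
      also have "\<dots> = 0"
        unfolding wedge_linear_map[OF lin]
        by (subst F_cyl_wedge_Omega1)
          (use that ws(3) Rplus_pos[OF \<epsilon>, of "fst x"] in \<open>simp_all add: matrix_zero\<close>)
      finally show ?thesis .
    qed
    moreover have "wedge 2 4 K W z vs = 0" if "length vs = 6"
    proof -
      have "wedge 2 4 K W z vs = wedge 2 4 (\<lambda>x us. g ** F_cyl \<epsilon> T1 T2 T3 x us ** cadj g)
          (\<lambda>x vs. wedge 2 2 (omega_cyl \<epsilon>) (omega_cyl \<epsilon>) x vs / 2) x ws"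
        unfolding ws(1) zx wedge_pullback
      proof (rule wedge_cong)
        fix us assume us: "length us = 4" "set us \<subseteq> set ws"
        have "wedge 2 2 \<omega> \<omega> (cyl_map \<epsilon> x) (map D us) = wedge 2 2 (omega_cyl \<epsilon>) (omega_cyl \<epsilon>) x us"
          unfolding wedge_pullback
        proof (rule wedge_cong)
          have w: "\<omega> (cyl_map \<epsilon> x) (map D vs') = omega_cyl \<epsilon> x vs'"
            if "length vs' = 2" "set vs' \<subseteq> set us" for vs'
            using forms(1) that us(2) ws(2) by (meson order_trans)
          show "\<omega> (cyl_map \<epsilon> x) (map D vs') = omega_cyl \<epsilon> x vs'"
            if "length vs' = 2" "set vs' \<subseteq> set us" for vs'
            using that by (rule w)
          show "\<omega> (cyl_map \<epsilon> x) (map D vs') = omega_cyl \<epsilon> x vs'"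
            if "length vs' = 2" "set vs' \<subseteq> set us" for vs'
            using that by (rule w)
        qed (simp add: us(1))
        then show "W (cyl_map \<epsilon> x) (map D us) = wedge 2 2 (omega_cyl \<epsilon>) (omega_cyl \<epsilon>) x us / 2"
          by (simp add: W_def)
      next
        show "K (cyl_map \<epsilon> x) (map D us) = g ** F_cyl \<epsilon> T1 T2 T3 x us ** cadj g"
          if "length us = 2" "set us \<subseteq> set ws" for us
          by (rule Kx[OF that])
      qed (simp add: ws(3) \<open>length vs = _\<close>)
      also have "\<dots> = 0"
        unfolding wedge_linear_map[OF lin]
        by (subst F_cyl_wedge_omega_omega) (use that ws(3) in \<open>simp_all add: matrix_zero\<close>)
      finally show ?thesis .
    qed
    ultimately show ?thesis by blast
  qed
  have all: "(length vs = 5 \<longrightarrow> wedge 2 3 K \<Omega>1 z0 vs = 0) \<and> (length vs = 6 \<longrightarrow> wedge 2 4 K W z0 vs = 0)"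
    if z0: "z0 \<in> Xeps \<epsilon>" and vs: "set vs \<subseteq> T_Xeps z0" for z0 vs
  proof (cases "quat_Im z0 = 0")
    case False
    then show ?thesis using off z0 vs by blast
  next
    case True
    obtain z where z: "(z \<longlongrightarrow> z0) (at_right (0 :: real))"
      and z': "\<And>s. s > 0 \<Longrightarrow> z s \<in> Xeps \<epsilon> \<and> quat_Im (z s) \<noteq> 0"
      using zero_section_limit[OF \<epsilon> z0 True] by blast
    have nz: "y \<noteq> 0" if "y \<in> Xeps \<epsilon>" for y
      using that \<epsilon> by (auto simp: Xeps_def)
    define P where "P s = tangent_proj (z s)" for s
    have P: "((\<lambda>s. P s w) \<longlongrightarrow> tangent_proj z0 w) (at_right 0)" for w
      unfolding P_def by (rule tangent_proj_tendsto[OF z nz[OF z0]])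
    have vs': "map (tangent_proj z0) vs = vs"
      using vs tangent_proj(2)[OF nz[OF z0]] by (auto intro!: map_idI)
    have pos: "\<forall>\<^sub>F s in at_right (0::real). s > 0"
      by (simp add: eventually_at_right_less)
    have sub: "set (map (P s) vs) \<subseteq> T_Xeps (z s)" if "s > 0" for s
      using tangent_proj(1)[OF nz] z'[OF that] by (auto simp: P_def)
    have z5: "wedge 2 3 K \<Omega>1 z0 vs = 0" if "length vs = 5"
    proof -
      have "((\<lambda>s. wedge 2 3 K \<Omega>1 (z s) (map (P s) vs)) \<longlongrightarrow>
          wedge 2 3 K \<Omega>1 z0 (map (tangent_proj z0) vs)) (at_right 0)"
        by (rule wedge_tendsto)
          (simp_all add: K_def that curvature_tendsto[OF \<epsilon> z] smooth_form_tendsto[OF smooth(2) z0 z] P)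
      moreover have "\<forall>\<^sub>F s in at_right 0. wedge 2 3 K \<Omega>1 (z s) (map (P s) vs) = 0"
        using pos by eventually_elim (use off z' sub that in simp)
      ultimately have "((\<lambda>s::real. 0) \<longlongrightarrow> wedge 2 3 K \<Omega>1 z0 vs) (at_right 0)"
        unfolding vs' by (rule Lim_transform_eventually)
      then show ?thesis
        using tendsto_unique[OF trivial_limit_at_right_real _ tendsto_const] by metis
    qed
    have z6: "wedge 2 4 K W z0 vs = 0" if "length vs = 6"
    proof -
      have W: "((\<lambda>s. W (z s) (map (P s) us)) \<longlongrightarrow> W z0 (map (tangent_proj z0) us)) (at_right 0)"
        if "length us = 4" for us
        unfolding W_def
        by (intro tendsto_divide tendsto_const wedge_tendsto)
          (simp_all add: that smooth_form_tendsto[OF smooth(1) z0 z] P)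
      have "((\<lambda>s. wedge 2 4 K W (z s) (map (P s) vs)) \<longlongrightarrow>
          wedge 2 4 K W z0 (map (tangent_proj z0) vs)) (at_right 0)"
        by (rule wedge_tendsto)
          (simp_all add: K_def that W curvature_tendsto[OF \<epsilon> z] P)
      moreover have "\<forall>\<^sub>F s in at_right 0. wedge 2 4 K W (z s) (map (P s) vs) = 0"
        using pos by eventually_elim (use off z' sub that in simp)
      ultimately have "((\<lambda>s::real. 0) \<longlongrightarrow> wedge 2 4 K W z0 vs) (at_right 0)"
        unfolding vs' by (rule Lim_transform_eventually)
      then show ?thesis
        using tendsto_unique[OF trivial_limit_at_right_real _ tendsto_const] by metis
    qed
    show ?thesis using z5 z6 by blast
  qed
  then show ?thesis
    unfolding hermitian_yang_mills_def Lambda_contr_def star6_def K_def W_def by simp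
qed

section \<open>Holonomy\<close>

text \<open>
  Away from finitely many parameters the velocity of the joined path is twice that of one of its parts, and
  horizontality does not depend on the speed.
\<close>

lemma horizontal_path_join:
  assumes lin: "\<And>z. linear (\<lambda>u. a z [u])"
    and h1: "horizontal_path \<epsilon> a \<Gamma>1" and h2: "horizontal_path \<epsilon> a \<Gamma>2" and eq: "\<Gamma>1 1 = \<Gamma>2 0"
  shows "horizontal_path \<epsilon> a (\<Gamma>1 +++ \<Gamma>2)"
proof -
  have v: "valid_path \<Gamma>1" "valid_path \<Gamma>2" using h1 h2 by (auto simp: horizontal_path_def)
  have lin': "connection_form a y [k *\<^sub>R w] = k *\<^sub>R connection_form a y [w]" for y w k
    by (cases y; cases w) (simp add: connection_form_def linear_scale[OF lin] matrix_ring scaleR_add_right)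
  have ex: "\<exists>S. finite S \<and> (\<forall>t\<in>{0..1} - S. \<Gamma> differentiable (at t) \<and>
      connection_form a (\<Gamma> t) [vector_derivative \<Gamma> (at t)] = 0)" if h: "horizontal_path \<epsilon> a \<Gamma>" for \<Gamma>
  proof -
    obtain S where S: "finite S" "\<forall>t\<in>{0..1} - S. connection_form a (\<Gamma> t) [vector_derivative \<Gamma> (at t)] = 0"
      using h by (auto simp: horizontal_path_def)
    obtain S' where S': "finite S'" "\<Gamma> C1_differentiable_on ({0..1} - S')"
      using h by (auto simp: horizontal_path_def valid_path_def piecewise_C1_differentiable_on_def)
    show ?thesis
      using S S' by (intro exI[of _ "S \<union> S'"]) (auto simp: C1_differentiable_on_eq)
  qed
  obtain S1 where S1: "finite S1" "\<And>t. t \<in> {0..1} - S1 \<Longrightarrow> \<Gamma>1 differentiable (at t)"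
    "\<And>t. t \<in> {0..1} - S1 \<Longrightarrow> connection_form a (\<Gamma>1 t) [vector_derivative \<Gamma>1 (at t)] = 0"
    using ex[OF h1] by blast
  obtain S2 where S2: "finite S2" "\<And>t. t \<in> {0..1} - S2 \<Longrightarrow> \<Gamma>2 differentiable (at t)"
    "\<And>t. t \<in> {0..1} - S2 \<Longrightarrow> connection_form a (\<Gamma>2 t) [vector_derivative \<Gamma>2 (at t)] = 0"
    using ex[OF h2] by blast
  \<comment> \<open>The exceptional parameters of both parts, rescaled, and the joint.\<close>
  define S where "S = insert (1/2) ((\<lambda>x. x / 2) ` S1 \<union> (\<lambda>x. (x + 1) / 2) ` S2)"
  have "connection_form a ((\<Gamma>1 +++ \<Gamma>2) t) [vector_derivative (\<Gamma>1 +++ \<Gamma>2) (at t)] = 0"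
    if t: "t \<in> {0..1} - S" for t
  proof (cases "t < 1/2")
    case True
    have "2 * t \<notin> S1"
    proof
      assume "2 * t \<in> S1"
      then have "2 * t / 2 \<in> (\<lambda>x. x / 2) ` S1" by blast
      then show False using t by (simp add: S_def)
    qed
    then have t2: "2 * t \<in> {0..1} - S1" using t True by auto
    define D where "D = vector_derivative \<Gamma>1 (at (2 * t))"
    have d: "(\<Gamma>1 has_vector_derivative D) (at (2 * t))"
      using S1(2)[OF t2] unfolding D_def vector_derivative_works .
    have "((\<lambda>x. 2 * x) has_vector_derivative 2) (at t)"
      by (auto intro!: derivative_eq_intros simp: has_real_derivative_iff_has_vector_derivative[symmetric])
    from vector_diff_chain_at[OF this d]
    have "(\<Gamma>1 +++ \<Gamma>2 has_vector_derivative 2 *\<^sub>R D) (at t)"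
      by (rule has_vector_derivative_transform_within_open[of _ _ _ "{..<1/2}"])
        (use True in \<open>auto simp: joinpaths_def\<close>)
    then show ?thesis
      using S1(3)[OF t2] True by (simp add: vector_derivative_at lin' joinpaths_def D_def)
  next
    case False
    then have False': "t > 1/2" using t by (auto simp: S_def)
    have "2 * t - 1 \<notin> S2"
    proof
      assume "2 * t - 1 \<in> S2"
      then have "(2 * t - 1 + 1) / 2 \<in> (\<lambda>x. (x + 1) / 2) ` S2" by blast
      then show False using t by (simp add: S_def)
    qed
    then have t2: "2 * t - 1 \<in> {0..1} - S2" using t False' by auto
    define D where "D = vector_derivative \<Gamma>2 (at (2 * t - 1))"
    have d: "(\<Gamma>2 has_vector_derivative D) (at (2 * t - 1))"
      using S2(2)[OF t2] unfolding D_def vector_derivative_works .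
    have "((\<lambda>x. 2 * x - 1) has_vector_derivative 2) (at t)"
      by (auto intro!: derivative_eq_intros simp: has_real_derivative_iff_has_vector_derivative[symmetric])
    from vector_diff_chain_at[OF this d]
    have "(\<Gamma>1 +++ \<Gamma>2 has_vector_derivative 2 *\<^sub>R D) (at t)"
      by (rule has_vector_derivative_transform_within_open[of _ _ _ "{1/2<..}"])
        (use False' in \<open>auto simp: joinpaths_def\<close>)
    then show ?thesis
      using S2(3)[OF t2] False' by (simp add: vector_derivative_at lin' joinpaths_def D_def)
  qed
  moreover have "finite S" using S1(1) S2(1) by (simp add: S_def)
  moreover have "valid_path (\<Gamma>1 +++ \<Gamma>2)"
    using v eq by (intro valid_path_join) (auto simp: pathfinish_def pathstart_def)
  moreover have "(\<Gamma>1 +++ \<Gamma>2) ` {0..1} \<subseteq> Xeps \<epsilon> \<times> SU2"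
  proof -
    have "path_image (\<Gamma>1 +++ \<Gamma>2) \<subseteq> path_image \<Gamma>1 \<union> path_image \<Gamma>2"
      by (rule path_image_join_subset)
    then show ?thesis
      using h1 h2 unfolding horizontal_path_def path_image_def by blast
  qed
  ultimately show ?thesis unfolding horizontal_path_def by blast
qed

lemma horizontal_path_C1:
  assumes "\<And>t. (\<Gamma> has_vector_derivative \<Gamma>' t) (at t)" "continuous_on UNIV \<Gamma>'"
    and "\<And>t. \<Gamma> t \<in> Xeps \<epsilon> \<times> SU2" "\<And>t. connection_form a (\<Gamma> t) [\<Gamma>' t] = 0"
  shows "horizontal_path \<epsilon> a \<Gamma>"
proof -
  have "\<Gamma> C1_differentiable_on {0..1}"
    unfolding C1_differentiable_on_def
    using assms(1) continuous_on_subset[OF assms(2)] by blast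
  then have "valid_path \<Gamma>"
    by (simp add: valid_path_def C1_differentiable_imp_piecewise)
  moreover have "\<Gamma> ` {0..1} \<subseteq> Xeps \<epsilon> \<times> SU2"
    using assms(3) by blast
  moreover have "\<forall>t\<in>{0..1} - {}. connection_form a (\<Gamma> t) [vector_derivative \<Gamma> (at t)] = 0"
    using assms(4) vector_derivative_at[OF assms(1)] by simp
  ultimately show ?thesis
    unfolding horizontal_path_def by blast
qed

definition transports :: "real \<Rightarrow> (complex^4, mat2) form \<Rightarrow> (complex^4) \<times> mat2 \<Rightarrow> (complex^4) \<times> mat2 \<Rightarrow> bool" where
  "transports \<epsilon> a y y' \<longleftrightarrow> (\<exists>\<Gamma>. horizontal_path \<epsilon> a \<Gamma> \<and> \<Gamma> 0 = y \<and> \<Gamma> 1 = y')"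

lemma linear_gauge_potential: "linear (\<lambda>u. gauge_potential \<epsilon> c z [u])"
  using linear_compose[OF linear_potential, of "\<lambda>m. c ** m ** cadj c"]
  by (simp add: gauge_potential_def o_def linear_iff matrix_ring)

lemma transports_trans:
  assumes "transports \<epsilon> (gauge_potential \<epsilon> c) x y" "transports \<epsilon> (gauge_potential \<epsilon> c) y z"
  shows "transports \<epsilon> (gauge_potential \<epsilon> c) x z"
proof -
  obtain \<Gamma>1 \<Gamma>2 where "horizontal_path \<epsilon> (gauge_potential \<epsilon> c) \<Gamma>1" "\<Gamma>1 0 = x" "\<Gamma>1 1 = y"
    "horizontal_path \<epsilon> (gauge_potential \<epsilon> c) \<Gamma>2" "\<Gamma>2 0 = y" "\<Gamma>2 1 = z"
    using assms by (auto simp: transports_def)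
  then have "horizontal_path \<epsilon> (gauge_potential \<epsilon> c) (\<Gamma>1 +++ \<Gamma>2)"
    "(\<Gamma>1 +++ \<Gamma>2) 0 = x" "(\<Gamma>1 +++ \<Gamma>2) 1 = z"
    using horizontal_path_join[of "gauge_potential \<epsilon> c", OF linear_gauge_potential] by (auto simp: joinpaths_def)
  then show ?thesis
    unfolding transports_def by blast
qed

lemma connection_form_zero:
  "potential \<epsilon> z u = m \<Longrightarrow> c ** m ** cadj c ** g + w = 0 \<Longrightarrow> connection_form (gauge_potential \<epsilon> c) (z, g) [(u, w)] = 0"
  by (simp add: connection_form_def gauge_potential_def matrix_ring)
    (metis matrix_add_ldistrib matrix_zero(2))

lemma of_quats_scale: "of_quats (s *\<^sub>R A) (t *\<^sub>R B) = s *\<^sub>R of_quats A 0 + t *\<^sub>R of_quats 0 B"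
  using of_quats_linear(1)[of "s *\<^sub>R A" 0 0 "t *\<^sub>R B"] of_quats_linear(3)[of s A 0] of_quats_linear(3)[of t 0 B]
  by simp

text \<open>
  Along a ray in the fibre of \<open>T\<^sup>*S\<^sup>3\<close> the directions of \<open>x\<close> and \<open>y\<close> are constant.  Then \<open>X\<^sup>* X'\<close> and \<open>Y\<^sup>* Y'\<close> are real
  and \<open>X' \<bottom> Y\<close>, so the potential vanishes and the constant lift is horizontal.
\<close>

lemma transport_radial:
  assumes \<epsilon>: "\<epsilon> > 0" and X: "quat X" "inner X X = 2 * \<epsilon>\<^sup>2" and Y: "quat Y" "inner X Y = 0" and g: "g \<in> SU2"
  defines "z \<equiv> \<lambda>l. of_quats ((sqrt (\<epsilon>\<^sup>2 + l\<^sup>2 * (inner Y Y / 2)) / \<epsilon>) *\<^sub>R X) (l *\<^sub>R Y)"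
  shows "transports \<epsilon> (gauge_potential \<epsilon> c) (z l0, g) (z (l0 + l1), g)"
proof -
  define N where "N = inner Y Y / 2"
  have N: "N \<ge> 0" by (simp add: N_def)
  define f where "f l = sqrt (\<epsilon>\<^sup>2 + l\<^sup>2 * N)" for l
  have fp: "\<epsilon>\<^sup>2 + l\<^sup>2 * N > 0" for l using \<epsilon> N by (simp add: add_pos_nonneg)
  define l where "l t = l0 + t * l1" for t
  define b where "b t = l t * l1 * N / f (l t) / \<epsilon>" for t
  have f: "((\<lambda>t. f (l t) / \<epsilon>) has_real_derivative b t) (at t)" for t
    unfolding f_def b_def l_def using fp[of "l0 + t * l1"] \<epsilon>
    by (auto intro!: derivative_eq_intros simp: field_simps)
  have lt: "(l has_real_derivative l1) (at t)" for t
    unfolding l_def by (auto intro!: derivative_eq_intros)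
  have zt: "z (l t) = (f (l t) / \<epsilon>) *\<^sub>R of_quats X 0 + l t *\<^sub>R of_quats 0 Y" for t
    unfolding z_def of_quats_scale f_def N_def ..
  have zq: "quat_Re (z l) = (f l / \<epsilon>) *\<^sub>R X" "quat_Im (z l) = l *\<^sub>R Y" for l
    unfolding z_def f_def N_def by (rule re_im_of_quats; intro quat_simps X Y)+
  define z' where "z' t = b t *\<^sub>R of_quats X 0 + l1 *\<^sub>R of_quats 0 Y" for t
  have z'q: "quat_Re (z' t) = b t *\<^sub>R X" "quat_Im (z' t) = l1 *\<^sub>R Y" for t
    unfolding z'_def of_quats_scale[symmetric] by (rule re_im_of_quats; intro quat_simps X Y)+
  have d: "((\<lambda>t. z (l t)) has_vector_derivative z' t) (at t)" for t
  proof -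
    have "((\<lambda>t. (f (l t) / \<epsilon>) *\<^sub>R of_quats X 0 + l t *\<^sub>R of_quats 0 Y) has_vector_derivative
       ((f (l t) / \<epsilon>) *\<^sub>R 0 + b t *\<^sub>R of_quats X 0) + (l t *\<^sub>R 0 + l1 *\<^sub>R of_quats 0 Y)) (at t)"
      by (intro has_vector_derivative_add has_vector_derivative_scaleR f lt has_vector_derivative_const)
    then show ?thesis unfolding zt z'_def by simp
  qed
  have pot: "potential \<epsilon> (z (l t)) (z' t) = 0" for t
  proof -
    have "skew (r *\<^sub>R mat 1) = 0" for r by (simp add: skew_def cadj_simps)
    then show ?thesis
      unfolding potential_def conn_formula_def zq z'q
      using Y(2) quat_cadj_mult(1)[OF X(1)] quat_cadj_mult(1)[OF Y(1)]
      by (simp add: cadj_simps matrix_ring)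
  qed
  have Xe: "z l \<in> Xeps \<epsilon>" for l
  proof -
    have "f l * f l = \<epsilon>\<^sup>2 + l\<^sup>2 * N" using fp[of l] by (simp add: f_def)
    then show ?thesis
      unfolding Xeps_iff zq using X(2) Y(2) \<epsilon> by (simp add: N_def field_simps power2_eq_square)
  qed
  have "horizontal_path \<epsilon> (gauge_potential \<epsilon> c) (\<lambda>t. (z (l t), g))"
  proof (rule horizontal_path_C1[where \<Gamma>' = "\<lambda>t. (z' t, 0)"])
    show "((\<lambda>t. (z (l t), g)) has_vector_derivative (z' t, 0)) (at t)" for t
      by (intro has_vector_derivative_Pair d has_vector_derivative_const)
    have "f (l t) \<noteq> 0" for t using fp[of "l t"] by (simp add: f_def)
    then show "continuous_on UNIV (\<lambda>t. (z' t, 0 :: mat2))"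
      unfolding z'_def b_def using \<epsilon>
      by (intro continuous_intros) (auto simp: f_def l_def intro!: continuous_intros)
    show "(z (l t), g) \<in> Xeps \<epsilon> \<times> SU2" for t using Xe g by simp
    show "connection_form (gauge_potential \<epsilon> c) (z (l t), g) [(z' t, 0)] = 0" for t
      by (rule connection_form_zero[OF pot]) (simp add: matrix_zero)
  qed
  then show ?thesis
    unfolding transports_def by (intro exI[of _ "\<lambda>t. (z (l t), g)"]) (simp add: l_def)
qed

lemma su2_unit_square: "\<xi> \<in> su2 \<Longrightarrow> inner \<xi> \<xi> = 2 \<Longrightarrow> \<xi> ** \<xi> = - mat 1"
  using quat_cadj_mult(1)[OF su2_quat, of \<xi>] cadj_su2[of \<xi>] by (simp add: matrix_minus_left) (metis minus_minus)

text \<open>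
  On \<open>U exp(\<pi> t \<xi>)\<close>, half of the Maurer-Cartan form is the constant \<open>\<pi> \<xi> / 2\<close>, so the transport is by \<open>exp(- \<pi> t \<xi> / 2)\<close>,
  which ends at \<open>- \<xi>\<close>; all this conjugated by \<open>c\<close>.
\<close>

lemma transport_half_circle:
  assumes \<epsilon>: "\<epsilon> > 0" and U: "U \<in> SU2" and \<xi>: "\<xi> \<in> su2" "inner \<xi> \<xi> = 2" and g: "g \<in> SU2" and c: "c \<in> SU2"
  shows "transports \<epsilon> (gauge_potential \<epsilon> c) (of_quats (\<epsilon> *\<^sub>R U) 0, g)
    (of_quats (- (\<epsilon> *\<^sub>R U)) 0, c ** (- \<xi>) ** cadj c ** g)"
proof -
  have sq: "\<xi> ** \<xi> = - mat 1" "\<xi> ** (\<xi> ** A) = - A" for A :: mat2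
    using su2_unit_square[OF \<xi>] by (simp_all add: matrix_mul_assoc matrix_minus_left)
  have E: "x *\<^sub>R mat 1 + y *\<^sub>R \<xi> \<in> SU2" if "x\<^sup>2 + y\<^sup>2 = 1" for x y
  proof -
    have "inner (mat 1) \<xi> = 0" "inner (mat 1 :: mat2) (mat 1) = 2"
      using \<xi>(1) by (auto simp: su2_iff inner_mat2 mat_nth pure_quat_nth)
    then have "inner (x *\<^sub>R mat 1 + y *\<^sub>R \<xi>) (x *\<^sub>R mat 1 + y *\<^sub>R \<xi>) = 2 * (x\<^sup>2 + y\<^sup>2)"
      using \<xi>(2) by (simp add: inner_add_left inner_add_right inner_commute power2_eq_square)
    then show ?thesis
      using that by (simp add: SU2_iff quat_simps su2_quat[OF \<xi>(1)])
  qed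
  define z where "z t = cos (pi * t) *\<^sub>R of_quats (\<epsilon> *\<^sub>R U) 0 + sin (pi * t) *\<^sub>R of_quats (\<epsilon> *\<^sub>R (U ** \<xi>)) 0" for t
  define z' where "z' t = (- sin (pi * t) * pi) *\<^sub>R of_quats (\<epsilon> *\<^sub>R U) 0
    + (cos (pi * t) * pi) *\<^sub>R of_quats (\<epsilon> *\<^sub>R (U ** \<xi>)) 0" for t
  define e where "e t = cos (pi / 2 * t) *\<^sub>R mat 1 + (- sin (pi / 2 * t)) *\<^sub>R \<xi>" for t
  define h where "h t = c ** e t ** cadj c ** g" for t
  define h' where "h' t = c ** ((- sin (pi / 2 * t) * (pi / 2)) *\<^sub>R mat 1 + (- cos (pi / 2 * t) * (pi / 2)) *\<^sub>R \<xi>) ** cadj c ** g" for t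
  \<comment> \<open>The point on the unit sphere; its scaled copy \<open>z t\<close> is written as a combination of two fixed vectors above, for differentiation.\<close>
  define V where "V t = U ** (cos (pi * t) *\<^sub>R mat 1 + sin (pi * t) *\<^sub>R \<xi>)" for t
  have V: "V t \<in> SU2" for t
    unfolding V_def by (intro SU2_mult U E) simp
  have add0: "of_quats A 0 + of_quats B 0 = of_quats (A + B) 0" for A B
    using of_quats_linear(1)[of A B 0 0] by simp
  have scale0: "r *\<^sub>R of_quats A 0 = of_quats (r *\<^sub>R A) 0" for r A
    using of_quats_linear(3)[of r A 0] by simp
  have zV: "z t = of_quats (\<epsilon> *\<^sub>R V t) 0" "z' t = of_quats ((\<epsilon> * pi) *\<^sub>R (V t ** \<xi>)) 0" for t
    unfolding z_def z'_def V_def scale0 add0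
    by (rule arg_cong[where f = "\<lambda>A. of_quats A 0"], simp add: matrix_ring sq algebra_simps)+
  have Vq: "quat (\<epsilon> *\<^sub>R V t)" "quat ((\<epsilon> * pi) *\<^sub>R (V t ** \<xi>))" for t
    by (intro quat_simps SU2_quat V su2_quat \<xi>)+
  note zq = re_im_of_quats[OF Vq(1) quat_simps(9), folded zV(1)]
    re_im_of_quats[OF Vq(2) quat_simps(9), folded zV(2)]
  have "inner (V t) (V t) = 2" for t using V[of t] by (simp add: SU2_iff)
  then have norm: "Rplus \<epsilon> (norm (z t)) = \<epsilon>" for t
    unfolding Rplus_norm inner_C4 zq using \<epsilon> by (simp add: power2_eq_square)
  have pot: "potential \<epsilon> (z t) (z' t) = (pi / 2) *\<^sub>R \<xi>" for t
  proof -
    have "cadj (\<epsilon> *\<^sub>R V t) ** ((\<epsilon> * pi) *\<^sub>R (V t ** \<xi>)) = (\<epsilon>\<^sup>2 * pi) *\<^sub>R \<xi>"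
      by (simp add: cadj_simps matrix_ring SU2_cancel[OF V] power2_eq_square)
    moreover have "skew (r *\<^sub>R \<xi>) = r *\<^sub>R \<xi>" for r
      by (simp add: skew_def cadj_simps cadj_su2[OF \<xi>(1)] scaleR_2[symmetric])
    moreover have "skew 0 = 0" by (simp add: skew_def cadj_simps)
    ultimately show ?thesis
      unfolding potential_def conn_formula_def norm zq using \<epsilon>
      by (simp add: matrix_zero cadj_simps)
  qed
  have "horizontal_path \<epsilon> (gauge_potential \<epsilon> c) (\<lambda>t. (z t, h t))"
  proof (rule horizontal_path_C1[where \<Gamma>' = "\<lambda>t. (z' t, h' t)"])
    show "((\<lambda>t. (z t, h t)) has_vector_derivative (z' t, h' t)) (at t)" for t
    proof (rule has_vector_derivative_Pair)
      show "(z has_vector_derivative z' t) (at t)"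
        unfolding z_def[abs_def] z'_def
        by (auto intro!: derivative_eq_intros)
      have "bounded_linear (\<lambda>m. c ** m ** cadj c ** g)"
        by (intro bounded_linear_compose[OF matrix_mult.bounded_linear_left]
            matrix_mult.bounded_linear_right)
      moreover have "(e has_vector_derivative
          (- sin (pi / 2 * t) * (pi / 2)) *\<^sub>R mat 1 + (- cos (pi / 2 * t) * (pi / 2)) *\<^sub>R \<xi>) (at t)"
        unfolding e_def[abs_def]
        by (auto intro!: derivative_eq_intros)
      ultimately show "(h has_vector_derivative h' t) (at t)"
        unfolding h_def[abs_def] h'_def by (rule bounded_linear.has_vector_derivative)
    qed
    show "continuous_on UNIV (\<lambda>t. (z' t, h' t))"
      unfolding z'_def h'_def
      by (intro continuous_intros matrix_mult.continuous_on)
    show "(z t, h t) \<in> Xeps \<epsilon> \<times> SU2" for t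
    proof -
      have "z t \<in> Xeps \<epsilon>"
        unfolding Xeps_iff zq using \<open>\<And>t. inner (V t) (V t) = 2\<close> by (simp add: power2_eq_square)
      moreover have "h t \<in> SU2"
        unfolding h_def e_def by (intro SU2_mult c E SU2_cadj g) simp
      ultimately show ?thesis by simp
    qed
    show "connection_form (gauge_potential \<epsilon> c) (z t, h t) [(z' t, h' t)] = 0" for t
      by (rule connection_form_zero[OF pot])
        (simp add: h_def h'_def e_def matrix_ring SU2_cancel[OF c] sq algebra_simps)
  qed
  moreover have "z 0 = of_quats (\<epsilon> *\<^sub>R U) 0" "h 0 = g" "h 1 = c ** (- \<xi>) ** cadj c ** g"
    by (simp_all add: z_def h_def e_def matrix_ring SU2_cancel[OF c])
  moreover have "z 1 = of_quats (- (\<epsilon> *\<^sub>R U)) 0"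
    unfolding zV V_def by (simp add: matrix_ring)
  ultimately show ?thesis
    unfolding transports_def by (intro exI[of _ "\<lambda>t. (z t, h t)"]) simp
qed

text \<open>
  Take \<open>\<xi>\<close> orthogonal to the imaginary part of \<open>h\<close>.  Then \<open>h \<xi>\<close> is imaginary, and \<open>\<eta> = - h \<xi>\<close> works because
  \<open>\<xi>\<^sup>2 = - 1\<close>.  Within the span of \<open>j\<close> and \<open>k\<close> such a \<open>\<xi>\<close> always exists.
\<close>

lemma SU2_product_of_units:
  assumes h: "h \<in> SU2"
  obtains \<xi> \<eta> where "\<xi> \<in> su2" "inner \<xi> \<xi> = 2" "\<eta> \<in> su2" "inner \<eta> \<eta> = 2" "\<eta> ** \<xi> = h"
proof -
  define b1 b2 where "b1 = Re (h $ 1 $ 2)" and "b2 = Im (h $ 1 $ 2)"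
  obtain y w where yw: "y * y + w * w = 1" "y * b1 + w * b2 = 0"
  proof (cases "b1 = 0 \<and> b2 = 0")
    case True
    then show thesis using that[of 1 0] by simp
  next
    case False
    define n where "n = sqrt (b1\<^sup>2 + b2\<^sup>2)"
    have n: "n * n = b1\<^sup>2 + b2\<^sup>2" "n \<noteq> 0"
      using False by (simp_all add: n_def sum_power2_eq_zero_iff)
    have "(- b2 / n) * (- b2 / n) + (b1 / n) * (b1 / n) = (b1\<^sup>2 + b2\<^sup>2) / (n * n)"
      by (simp add: add_divide_distrib power2_eq_square)
    also have "\<dots> = 1" unfolding n(1)[symmetric] using n(2) by simp
    finally show thesis using that[of "- b2 / n" "b1 / n"] by simp
  qed
  define \<xi> where "\<xi> = pure_quat 0 y w"
  have \<xi>: "\<xi> \<in> su2" "inner \<xi> \<xi> = 2"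
    using yw(1) by (auto simp: \<xi>_def su2_iff inner_mat2 pure_quat_nth)
  have "inner (h ** \<xi>) (h ** \<xi>) = 2" using inner_SU2_left[OF h] \<xi>(2) by simp
  moreover have "h ** \<xi> \<in> su2"
  proof (rule quat_inner_zero_su2)
    show "quat (h ** \<xi>)" by (intro quat_simps SU2_quat[OF h] su2_quat[OF \<xi>(1)])
    show "inner (mat 1) (h ** \<xi>) = 0"
      using SU2_quat[OF h] yw(2)
      by (simp add: inner_mat2 mat_nth mat2_mult_nth \<xi>_def pure_quat_nth quat_def b1_def b2_def algebra_simps)
  qed
  moreover have "- (h ** \<xi>) ** \<xi> = h"
    using su2_unit_square[OF \<xi>] by (simp add: matrix_ring)
  ultimately show thesis
    using that[of \<xi> "- (h ** \<xi>)"] \<xi> by (simp add: su2_minus)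
qed

text \<open>
  The loop goes down a ray to the zero section, along a half circle to the antipode, back along another half circle,
  and up the ray.
\<close>

lemma irreducible_gauge_potential:
  assumes \<epsilon>: "\<epsilon> > 0" and c: "c \<in> SU2"
  shows "irreducible_connection \<epsilon> (gauge_potential \<epsilon> c)"
  unfolding irreducible_connection_def
proof (intro ballI subset_antisym subsetI)
  fix z g assume "z \<in> Xeps \<epsilon>" "g \<in> holonomy_group \<epsilon> (gauge_potential \<epsilon> c) z"
  then obtain \<Gamma> where \<Gamma>: "horizontal_path \<epsilon> (gauge_potential \<epsilon> c) \<Gamma>" "\<Gamma> 1 = (z, g)"
    by (auto simp: holonomy_group_def)
  have "\<Gamma> ` {0..1} \<subseteq> Xeps \<epsilon> \<times> SU2"
    using \<Gamma>(1) by (simp add: horizontal_path_def)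
  then have "\<Gamma> 1 \<in> Xeps \<epsilon> \<times> SU2" by (simp add: image_subset_iff)
  then show "g \<in> SU2" by (simp add: \<Gamma>(2))
next
  fix z g assume z: "z \<in> Xeps \<epsilon>" and g: "g \<in> SU2"
  define X Y where "X = quat_Re z" and "Y = quat_Im z"
  define R where "R = sqrt (inner X X / 2)"
  have XY: "inner X X - inner Y Y = 2 * \<epsilon>\<^sup>2" "inner X Y = 0" "quat X" "quat Y"
    using z unfolding Xeps_iff X_def Y_def by (auto simp: quat_re_im)
  have R2: "inner X X / 2 = \<epsilon>\<^sup>2 + inner Y Y / 2" using XY(1) by simp
  then have "inner X X / 2 > 0" using \<epsilon> by (simp add: add_pos_nonneg)
  then have R: "R > 0" "R * R = inner X X / 2" by (simp_all add: R_def)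
  define U where "U = inverse R *\<^sub>R X"
  have iX: "inner X X = 2 * (R * R)" using R(2) by simp
  have U: "U \<in> SU2"
    using R(1) by (simp add: U_def SU2_iff quat_simps XY(3) iX) (simp add: field_simps)
  have X0: "quat (\<epsilon> *\<^sub>R U)" "inner (\<epsilon> *\<^sub>R U) (\<epsilon> *\<^sub>R U) = 2 * \<epsilon>\<^sup>2" "inner (\<epsilon> *\<^sub>R U) Y = 0"
    using U XY(2) by (simp_all add: SU2_iff quat_simps power2_eq_square) (simp add: U_def)
  have z1: "of_quats ((sqrt (\<epsilon>\<^sup>2 + 1\<^sup>2 * (inner Y Y / 2)) / \<epsilon>) *\<^sub>R (\<epsilon> *\<^sub>R U)) (1 *\<^sub>R Y) = z"
    using \<epsilon> R(1) of_quats_re_im[of z]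
    by (simp add: R2[symmetric] R_def[symmetric] U_def X_def[symmetric] Y_def[symmetric])
  have z0: "of_quats ((sqrt (\<epsilon>\<^sup>2 + 0\<^sup>2 * (inner Y Y / 2)) / \<epsilon>) *\<^sub>R (\<epsilon> *\<^sub>R U)) (0 *\<^sub>R Y) = of_quats (\<epsilon> *\<^sub>R U) 0"
    using \<epsilon> by simp
  let ?T = "transports \<epsilon> (gauge_potential \<epsilon> c)"
  have down: "?T (z, h) (of_quats (\<epsilon> *\<^sub>R U) 0, h)" and up: "?T (of_quats (\<epsilon> *\<^sub>R U) 0, h) (z, h)"
    if "h \<in> SU2" for h
    using transport_radial[OF \<epsilon> X0(1,2) XY(4) X0(3) that, of c 1 "-1"]
      transport_radial[OF \<epsilon> X0(1,2) XY(4) X0(3) that, of c 0 1] z1 z0 by simp_all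
  obtain \<xi> \<eta> where \<xi>: "\<xi> \<in> su2" "inner \<xi> \<xi> = 2" and \<eta>: "\<eta> \<in> su2" "inner \<eta> \<eta> = 2"
    and prod: "\<eta> ** \<xi> = cadj c ** g ** c"
    using SU2_product_of_units[OF SU2_mult[OF SU2_mult[OF SU2_cadj[OF c] g] c]] by metis
  define h where "h = c ** (- \<xi>) ** cadj c ** mat 1"
  have U': "- U \<in> SU2" using U by (simp add: SU2_iff quat_simps)
  have "- \<xi> \<in> SU2" using \<xi> by (simp add: SU2_iff quat_simps su2_quat)
  then have h: "h \<in> SU2" unfolding h_def by (intro SU2_mult c SU2_cadj SU2_one)
  have 1: "?T (of_quats (\<epsilon> *\<^sub>R U) 0, mat 1) (of_quats (\<epsilon> *\<^sub>R (- U)) 0, h)"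
    using transport_half_circle[OF \<epsilon> U \<xi> SU2_one c] by (simp add: h_def)
  have "?T (of_quats (\<epsilon> *\<^sub>R (- U)) 0, h) (of_quats (\<epsilon> *\<^sub>R U) 0, c ** (- \<eta>) ** cadj c ** h)"
    using transport_half_circle[OF \<epsilon> U' \<eta> h c] by simp
  moreover have "c ** (- \<eta>) ** cadj c ** h = c ** (\<eta> ** \<xi>) ** cadj c"
    by (simp add: h_def matrix_ring SU2_cancel[OF c])
  moreover have "\<dots> = g"
    unfolding prod by (simp add: matrix_ring SU2_cancel[OF c])
  ultimately have 2: "?T (of_quats (\<epsilon> *\<^sub>R (- U)) 0, h) (of_quats (\<epsilon> *\<^sub>R U) 0, g)"
    by simp
  have "?T (z, mat 1) (z, g)"
    using down[OF SU2_one] 1 2 up[OF g] transports_trans by blast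
  then show "g \<in> holonomy_group \<epsilon> (gauge_potential \<epsilon> c) z"
    by (auto simp: transports_def holonomy_group_def)
qed


section \<open>The instanton\<close>

theorem theorem2:
  fixes \<epsilon> :: real
    and T1 T2 T3 :: mat2
    and \<omega> \<Omega>1 \<Omega>2 :: "(complex^4, real) form"
  assumes "\<epsilon> > 0"
    and "su2_basis T1 T2 T3"
    and "stenzel_structure \<epsilon> \<omega> \<Omega>1 \<Omega>2"
  shows "\<exists>c a. extends_lambda1 c \<and>
           is_connection \<epsilon> a \<and>
           irreducible_connection \<epsilon> a \<and>
           hermitian_yang_mills \<epsilon> \<omega> \<Omega>1 a \<and>
           agree_on_cyl \<epsilon> 1 (pullback (canonical_map \<epsilon> c) (connection_form a))
             (A_cyl \<epsilon> T1 T2 T3) \<and>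
           agree_on_cyl \<epsilon> 2 (pullback (canonical_map \<epsilon> c) (curvature_form a))
             (F_cyl \<epsilon> T1 T2 T3)"
proof -
  obtain c where c: "extends_lambda1 c"
    and frame: "\<And>x y w. c ** pure_quat x y w ** cadj c = x *\<^sub>R T1 + y *\<^sub>R T3 - w *\<^sub>R T2"
    using su2_basis_frame[OF assms(2)] by blast
  have "c \<in> SU2" using c by (simp add: extends_lambda1_def)
  then show ?thesis
    using c is_connection_gauge_potential[OF assms(1)] irreducible_gauge_potential[OF assms(1)]
      hermitian_yang_mills_gauge_potential[OF assms(1) _ frame assms(3)]
      agree_A_cyl[OF assms(1) _ frame] agree_F_cyl[OF assms(1) _ frame]
    by blast
qed

end
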